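(* Let $\alpha,\beta>-1$. Let $r\ge 1$ be an integer and let $f:[-1,1]\to\mathbb{R}$ be a function whose derivative $f^{(r-1)}$ is absolutely continuous on $[-1,1]$ and satisfies $f^{(r-1)}(t)=f^{(r-1)}(-1)+\int_{-1}^t g(y)\,dy$ for all $t\in[-1,1]$, for some absolutely integrable $g$ of bounded variation on $[-1,1]$. For each $n$ let $E_n[f]=f-L[f]$, where $L[f]$ is the polynomial of degree at most $n+1$ interpolating $f$ at the $n+2$ roots $-1=x_{n+1}<x_n<\cdots<x_1<x_0=1$ of $(1-t^2)P_n^{(\alpha,\beta)}(t)$. Then for $n\ge r+1$, $$\|E_n[f]\|_\infty=n^{-r}\cdot\begin{cases} O\left(n^{-\min\{0,\alpha+\frac12,\beta+\frac12\}}\right),&-1<\alpha,\beta\le\frac32,\\ O\left(n^{-\min\{0,\alpha+\frac12,2+\alpha-\beta,\frac52-\beta\}}\right),&-1<\alpha\le\frac32,\ \beta>\frac32,\\ O\left(n^{-\min\{0,\beta+\frac12,2+\beta-\alpha,\frac52-\alpha\}}\right),&\alpha>\frac32,\ -1<\beta\le\frac32,\\ O\left(n^{-\min\{0,2+\alpha-\beta,2+\beta-\alpha,\frac52-\alpha,\frac52-\beta\}}\right),&\alpha,\beta>\frac32. \end{cases}$$ In particular, $\|E_n[f]\|_\infty=O(n^{-r})$ whenever $(\alpha,\beta)\in S$, where $$S=\left[-\tfrac12,\tfrac52\right]^2\setminus\left(\left\{(\alpha,\beta):-\tfrac12\le\alpha\le\tfrac12,\ 2+\alpha<\beta\le\tfrac52\right\}\cup\left\{(\alpha,\beta):\tfrac32\le\alpha\le\tfrac52,\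 -\tfrac12\le\beta<\alpha-2\right\}\right).$$
   Context: $P_n^{(\alpha,\beta)}$ is the Jacobi polynomial of degree $n$ (orthogonal on $[-1,1]$ with respect to the weight $(1-t)^\alpha(1+t)^\beta$, normalized by $P_n^{(\alpha,\beta)}(1)=\binom{n+\alpha}{n}$); its $n$ roots are simple and lie in $(-1,1)$. $\|\cdot\|_\infty$ is the supremum norm on $[-1,1]$; $f^{(0)}=f$. The $O$-constants may depend on $f,r,\alpha,\beta$ but not on $n$. *)

theory Defs
  imports "HOL-Analysis.Analysis" "HOL-Computational_Algebra.Polynomial"
begin

section \<open>Jacobi polynomials\<close>

definition jacobi_weight :: "real \<Rightarrow> real \<Rightarrow> real \<Rightarrow> real" where
  "jacobi_weight \<alpha> \<beta> t = (1 - t) powr \<alpha> * (1 + t) powr \<beta>"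

definition is_jacobi_poly :: "real \<Rightarrow> real \<Rightarrow> nat \<Rightarrow> real poly \<Rightarrow> bool" where
  "is_jacobi_poly \<alpha> \<beta> n P \<longleftrightarrow>
     degree P = n \<and>
     (\<forall>q. degree q < n \<longrightarrow>
        integral {-1..1} (\<lambda>t. poly P t * poly q t * jacobi_weight \<alpha> \<beta> t) = 0) \<and>
     poly P 1 = (real n + \<alpha>) gchoose n"

text \<open>For \<open>\<alpha>, \<beta> > -1\<close> this description is proper, see \<open>is_jacobi_poly_jacobi_poly\<close> and
  \<open>is_jacobi_poly_unique\<close> below.\<close>

definition jacobi_poly :: "real \<Rightarrow> real \<Rightarrow> nat \<Rightarrow> real poly" where
  "jacobi_poly \<alpha> \<beta> n = (THE P. is_jacobi_poly \<alpha> \<beta> n P)"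


section \<open>Interpolation at the zeros of \<open>(1 - t\<^sup>2) P\<^sub>n(t)\<close>\<close>

definition jacobi_nodes :: "real \<Rightarrow> real \<Rightarrow> nat \<Rightarrow> real set" where
  "jacobi_nodes \<alpha> \<beta> n = {x. (1 - x\<^sup>2) * poly (jacobi_poly \<alpha> \<beta> n) x = 0}"

text \<open>For \<open>\<alpha>, \<beta> > -1\<close> there are exactly \<open>n + 2\<close> nodes (\<open>card_jacobi_nodes\<close>), and the interpolant
  exists and is unique (\<open>jacobi_interpolant_ex1\<close>).\<close>

definition jacobi_interpolant :: "real \<Rightarrow> real \<Rightarrow> nat \<Rightarrow> (real \<Rightarrow> real) \<Rightarrow> real poly" where
  "jacobi_interpolant \<alpha> \<beta> n f =
     (THE L. degree L \<le> n + 1 \<and> (\<forall>x\<in>jacobi_nodes \<alpha> \<beta> n. poly L x = f x))"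

definition interp_error :: "real \<Rightarrow> real \<Rightarrow> nat \<Rightarrow> (real \<Rightarrow> real) \<Rightarrow> real \<Rightarrow> real" where
  "interp_error \<alpha> \<beta> n f t = f t - poly (jacobi_interpolant \<alpha> \<beta> n f) t"

definition sup_norm :: "(real \<Rightarrow> real) \<Rightarrow> real" where
  "sup_norm h = (SUP t\<in>{-1..1}. \<bar>h t\<bar>)"


section \<open>Regularity of functions\<close>

text \<open>Iterated derivative relative to \<open>S\<close>; for \<open>S = {-1..1}\<close> it is one-sided at the end points and
  ignores the values outside \<open>S\<close>.\<close>

primrec nth_deriv_on :: "real set \<Rightarrow> nat \<Rightarrow> (real \<Rightarrow> real) \<Rightarrow> real \<Rightarrow> real" where
  "nth_deriv_on S 0 f = f"
| "nth_deriv_on S (Suc k) f = (\<lambda>t. vector_derivative (nth_deriv_on S k f) (at t within S))"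

definition times_differentiable_on :: "nat \<Rightarrow> (real \<Rightarrow> real) \<Rightarrow> real set \<Rightarrow> bool" where
  "times_differentiable_on m f S \<longleftrightarrow> (\<forall>k<m. nth_deriv_on S k f differentiable_on S)"

text \<open>In the following two definitions \<open>S\<close> is meant to be an interval. \<open>Radon_Nikodym\<close> has an
  unrelated constant \<open>absolutely_continuous\<close> for measures.\<close>

definition abs_continuous_on :: "real set \<Rightarrow> (real \<Rightarrow> real) \<Rightarrow> bool" where
  "abs_continuous_on S f \<longleftrightarrow>
     (\<forall>\<epsilon>>0. \<exists>\<delta>>0. \<forall>(m::nat) u v.
        (\<forall>i<m. u i \<in> S \<and> v i \<in> S \<and> u i \<le> v i) \<and>
        disjoint_family_on (\<lambda>i. {u i<..<v i}) {..<m} \<and>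
        (\<Sum>i<m. v i - u i) < \<delta> \<longrightarrow> (\<Sum>i<m. \<bar>f (v i) - f (u i)\<bar>) < \<epsilon>)"

definition bounded_variation_on :: "real set \<Rightarrow> (real \<Rightarrow> real) \<Rightarrow> bool" where
  "bounded_variation_on S g \<longleftrightarrow>
     (\<exists>V. \<forall>(m::nat) x. (\<forall>i\<le>m. x i \<in> S) \<and> (\<forall>i<m. x i \<le> x (Suc i)) \<longrightarrow>
        (\<Sum>i<m. \<bar>g (x (Suc i)) - g (x i)\<bar>) \<le> V)"


section \<open>Exponents\<close>

text \<open>The bound on the error is \<open>n powr - r * n powr - rate_exponent \<alpha> \<beta>\<close>.\<close>

definition rate_exponent :: "real \<Rightarrow> real \<Rightarrow> real" where
  "rate_exponent \<alpha> \<beta> =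
     (if \<alpha> \<le> 3/2 \<and> \<beta> \<le> 3/2 then Min {0, \<alpha> + 1/2, \<beta> + 1/2}
      else if \<alpha> \<le> 3/2 \<and> \<beta> > 3/2 then Min {0, \<alpha> + 1/2, 2 + \<alpha> - \<beta>, 5/2 - \<beta>}
      else if \<alpha> > 3/2 \<and> \<beta> \<le> 3/2 then Min {0, \<beta> + 1/2, 2 + \<beta> - \<alpha>, 5/2 - \<alpha>}
      else Min {0, 2 + \<alpha> - \<beta>, 2 + \<beta> - \<alpha>, 5/2 - \<alpha>, 5/2 - \<beta>})"

definition good_params :: "(real \<times> real) set" where
  "good_params =
     {-1/2..5/2} \<times> {-1/2..5/2} -
       ({(\<alpha>, \<beta>). -1/2 \<le> \<alpha> \<and> \<alpha> \<le> 1/2 \<and> 2 + \<alpha> < \<beta> \<and> \<beta> \<le> 5/2} \<union>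
        {(\<alpha>, \<beta>). 3/2 \<le> \<alpha> \<and> \<alpha> \<le> 5/2 \<and> -1/2 \<le> \<beta> \<and> \<beta> < \<alpha> - 2})"


section \<open>Well-definedness\<close>

lemma jacobi_weight_integrable:
  assumes "\<alpha> > -1" "\<beta> > -1"
  shows "jacobi_weight \<alpha> \<beta> absolutely_integrable_on {-1..1}"
proof (rule nonnegative_absolutely_integrable_1)
  have "((\<lambda>t. t powr (\<beta>+1-1) * (1 - t) powr (\<alpha>+1-1)) has_integral Beta (\<beta>+1) (\<alpha>+1)) {0..1}"
    by (rule has_integral_Beta_real) (use assms in auto)
  then have "((\<lambda>t. t powr \<beta> * (1 - t) powr \<alpha>) has_integral Beta (\<beta>+1) (\<alpha>+1)) (cbox 0 (1::real))"
    by simp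
  from has_integral_affinity'[OF this, of "1/2" "1/2"]
  have "(\<lambda>x. (x/2+1/2) powr \<beta> * (1/2 - x/2) powr \<alpha>) integrable_on {-1..1}"
    by (auto simp: integrable_on_def)
  from integrable_on_cmult_left[OF this, of "2 powr \<alpha> * 2 powr \<beta>"]
  have "(\<lambda>x. 2 powr \<alpha> * 2 powr \<beta> * ((x/2+1/2) powr \<beta> * (1/2 - x/2) powr \<alpha>)) integrable_on {-1..1}"
    by simp
  then show "jacobi_weight \<alpha> \<beta> integrable_on {-1..1}"
  proof (rule integrable_eq)
    fix x :: real assume "x \<in> {-1..1}"
    then have "(x/2+1/2) powr \<beta> = (1+x) powr \<beta> / 2 powr \<beta>" "(1/2 - x/2) powr \<alpha> = (1-x) powr \<alpha> / 2 powr \<alpha>"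
      by (subst powr_divide[symmetric]; simp add: field_simps)+
    then show "2 powr \<alpha> * 2 powr \<beta> * ((x/2+1/2) powr \<beta> * (1/2 - x/2) powr \<alpha>) = jacobi_weight \<alpha> \<beta> x"
      by (simp add: jacobi_weight_def)
  qed
qed (simp add: jacobi_weight_def)

lemma poly_jacobi_weight_integrable:
  assumes "\<alpha> > -1" "\<beta> > -1"
  shows "(\<lambda>t. poly p t * jacobi_weight \<alpha> \<beta> t) integrable_on {-1..1}"
proof -
  have c: "continuous_on {-1..1} (poly p)" by (intro continuous_intros)
  have "(\<lambda>t. poly p t * jacobi_weight \<alpha> \<beta> t) absolutely_integrable_on {-1..1}"
    by (rule absolutely_integrable_bounded_measurable_product_real)
      (auto intro!: jacobi_weight_integrable assms continuous_imp_measurable_on_sets_lebesgue c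
         compact_imp_bounded compact_continuous_image)
  then show ?thesis using absolutely_integrable_on_def by blast
qed

lemma jacobi_integral_pos:
  assumes ab: "\<alpha> > -1" "\<beta> > -1" and "p \<noteq> 0" and nn: "\<And>t. t \<in> {-1<..<1} \<Longrightarrow> poly p t \<ge> 0"
  shows "integral {-1..1} (\<lambda>t. poly p t * jacobi_weight \<alpha> \<beta> t) > 0"
proof -
  let ?f = "\<lambda>t. poly p t * jacobi_weight \<alpha> \<beta> t"
  have int: "?f integrable_on {-1..1}" by (rule poly_jacobi_weight_integrable[OF ab])
  have nn1: "?f t \<ge> 0" if "t \<in> {-1..1}" for t
  proof (cases "t = -1 \<or> t = 1")
    case False then show ?thesis using that nn[of t] by (auto simp: jacobi_weight_def)
  qed (auto simp: jacobi_weight_def)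
  have cont: "continuous_on {-1/2..1/2} ?f"
    unfolding jacobi_weight_def by (intro continuous_intros) auto
  have "integral {-1/2..1/2} ?f \<noteq> 0"
  proof
    assume "integral {-1/2..1/2} ?f = 0"
    then have "\<forall>t\<in>{-1/2..1/2}. ?f t = 0"
      using integral_eq_0_iff[OF cont] nn1 by fastforce
    then have "{-1/2..1/2} \<subseteq> {t. poly p t = 0}" by (force simp: jacobi_weight_def)
    from finite_subset[OF this poly_roots_finite[OF \<open>p \<noteq> 0\<close>]]
    show False using infinite_Icc[of "-1/2" "1/2::real"] by simp
  qed
  moreover have "integral {-1/2..1/2} ?f \<ge> 0"
    by (rule integral_nonneg) (use nn1 integrable_continuous_real[OF cont] in auto)
  moreover have "integral {-1/2..1/2} ?f \<le> integral {-1..1} ?f"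
    by (rule integral_subset_le) (use nn1 integrable_continuous_real[OF cont] int in auto)
  ultimately show ?thesis by linarith
qed

context
  fixes \<alpha> \<beta> :: real
  assumes ab: "\<alpha> > -1" "\<beta> > -1"
begin

private definition I :: "real poly \<Rightarrow> real" where
  "I p = integral {-1..1} (\<lambda>t. poly p t * jacobi_weight \<alpha> \<beta> t)"

private lemma I_add: "I (p + q) = I p + I q"
  unfolding I_def using integral_add[OF poly_jacobi_weight_integrable[OF ab] poly_jacobi_weight_integrable[OF ab], of p q]
  by (simp add: algebra_simps)

private lemma I_smult: "I (smult c p) = c * I p"
  unfolding I_def by (simp add: mult.assoc)

private lemma I_minus: "I (- p) = - I p"
  using I_smult[of "-1" p] by simp

private lemma I_diff: "I (p - q) = I p - I q"
  using I_add[of p "-q"] I_minus[of q] by simp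

private lemma I_sum: "I (sum h A) = (\<Sum>a\<in>A. I (h a))"
  by (induction A rule: infinite_finite_induct) (auto simp: I_add I_def[of 0])

private lemma I_pos: "p \<noteq> 0 \<Longrightarrow> (\<And>t. t \<in> {-1<..<1} \<Longrightarrow> poly p t \<ge> 0) \<Longrightarrow> I p > 0"
  unfolding I_def by (rule jacobi_integral_pos[OF ab])

private lemma I_square_pos: "p \<noteq> 0 \<Longrightarrow> I (p * p) > 0"
  by (rule I_pos) auto

private lemma orth_unique:
  assumes "degree P = n" "degree Q = n" "P \<noteq> 0"
    "\<And>q. degree q < n \<Longrightarrow> I (P * q) = 0" "\<And>q. degree q < n \<Longrightarrow> I (Q * q) = 0"
  shows "\<exists>c. Q = smult c P"
proof -
  define c where "c = coeff Q n / coeff P n"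
  define R where "R = Q - smult c P"
  have lc: "coeff P n \<noteq> 0" using assms(1,3) leading_coeff_neq_0 by blast
  have "R = 0"
  proof (rule ccontr)
    assume R0: "R \<noteq> 0"
    have "degree R \<le> n" unfolding R_def using assms(1,2) by (intro degree_diff_le) auto
    moreover have "coeff R n = 0" unfolding R_def c_def using lc by simp
    ultimately have "degree R < n" using R0 leading_coeff_neq_0 le_neq_implies_less by metis
    then have "I (R * R) = 0"
      using assms(4,5) unfolding R_def by (simp add: left_diff_distrib I_diff I_smult)
    then show False using I_square_pos[OF R0] by simp
  qed
  then show ?thesis unfolding R_def by auto
qed

private lemma orth_exists: "\<exists>P. degree P = n \<and> P \<noteq> 0 \<and> (\<forall>q. degree q < n \<longrightarrow> I (P * q) = 0)"
proof (induction n rule: less_induct)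
  case (less n)
  then obtain B where B: "\<And>k. k < n \<Longrightarrow> degree (B k) = k"  "\<And>k. k < n \<Longrightarrow> B k \<noteq> 0"
    "\<And>k q. k < n \<Longrightarrow> degree q < k \<Longrightarrow> I (B k * q) = 0"
    by metis
  have orth: "I (B j * B k) = 0" if "j < n" "k < n" "j \<noteq> k" for j k
    using that B(1)[of j] B(1)[of k] B(3)[of j "B k"] B(3)[of k "B j"]
    by (cases "k < j") (auto simp: mult.commute)
  define S where "S = (\<Sum>k<n. smult (I (monom 1 n * B k) / I (B k * B k)) (B k))"
  define P where "P = monom 1 n - S"
  have cS: "coeff S i = 0" if "i \<ge> n" for i
    unfolding S_def coeff_sum using that B(1) by (intro sum.neutral) (auto intro!: coeff_eq_0)
  have cP: "coeff P n = 1" unfolding P_def using cS by simp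
  have dP: "degree P = n"
  proof (rule antisym)
    show "degree P \<le> n" by (rule degree_le) (auto simp: P_def cS)
    show "n \<le> degree P" by (rule le_degree) (simp add: cP)
  qed
  have PB: "I (P * B k) = 0" if k: "k < n" for k
  proof -
    have "I (S * B k) = (\<Sum>j<n. I (monom 1 n * B j) / I (B j * B j) * I (B j * B k))"
      unfolding S_def sum_distrib_right I_sum by (simp add: I_smult)
    also have "\<dots> = (\<Sum>j<n. if j = k then I (monom 1 n * B k) else 0)"
      using orth k I_square_pos[OF B(2)] by (intro sum.cong) (auto simp: less_imp_neq[symmetric])
    finally show ?thesis unfolding P_def left_diff_distrib I_diff using k by simp
  qed
  have "I (P * q) = 0" if "degree q < n" for q
    using that
  proof (induction "degree q" arbitrary: q rule: less_induct)
    case (less q)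
    define k where "k = degree q"
    define c where "c = coeff q k / coeff (B k) k"
    define q' where "q' = q - smult c (B k)"
    have k: "k < n" using less.prems k_def by simp
    have lc: "coeff (B k) k \<noteq> 0" using B(1,2)[OF k] leading_coeff_neq_0 by metis
    have d: "degree q' \<le> k" unfolding q'_def using B(1)[OF k] k_def by (intro degree_diff_le) auto
    have z: "coeff q' k = 0" unfolding q'_def c_def using lc by simp
    have "I (P * q') = 0"
    proof (cases "q' = 0")
      case True then show ?thesis by (simp add: I_def)
    next
      case False
      then have "degree q' < k" using d z leading_coeff_neq_0 le_neq_implies_less by metis
      then show ?thesis using less.hyps[of q'] k k_def by simp
    qed
    moreover have "q = q' + smult c (B k)" unfolding q'_def by simp
    ultimately show ?case using PB[OF k] by (simp add: distrib_left I_add I_smult)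
  qed
  then show ?case using dP cP by (intro exI[of _ P]) auto
qed

private lemma orth_at_1:
  assumes "degree P = n" "P \<noteq> 0" "\<And>q. degree q < n \<Longrightarrow> I (P * q) = 0"
  shows "poly P 1 \<noteq> 0"
proof
  assume "poly P 1 = 0"
  then obtain S where S: "P = [:-1,1:] * S" by (metis poly_eq_0_iff_dvd dvdE)
  have S0: "S \<noteq> 0" using S assms(2) by auto
  then have "degree P = Suc (degree S)" unfolding S by (subst degree_mult_eq) auto
  then have "I (P * S) = 0" using assms by auto
  moreover have "I ([:1,-1:] * (S * S)) > 0" proof (rule I_pos)
    show "[:1,-1:] * (S * S) \<noteq> 0" using S0 by (simp only: mult_eq_0_iff) simp
    show "poly ([:1,-1:] * (S * S)) t \<ge> 0" if "t \<in> {-1<..<1}" for t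
      unfolding poly_mult by (rule mult_nonneg_nonneg) (use that in auto)
  qed
  moreover have "[:1,-1:] * (S * S) = - (P * S)" unfolding S by (simp add: algebra_simps)
  ultimately show False by (simp add: I_minus)
qed

private lemma gchoose_pos: "(real n + \<alpha>) gchoose n > 0"
  unfolding gbinomial_prod_rev using ab by (intro divide_pos_pos prod_pos) auto

private lemma is_jacobi_poly_I:
  "is_jacobi_poly \<alpha> \<beta> n P \<longleftrightarrow>
     degree P = n \<and> (\<forall>q. degree q < n \<longrightarrow> I (P * q) = 0) \<and> poly P 1 = (real n + \<alpha>) gchoose n"
  by (simp add: is_jacobi_poly_def I_def)

lemma is_jacobi_poly_unique:
  assumes P: "is_jacobi_poly \<alpha> \<beta> n P" and Q: "is_jacobi_poly \<alpha> \<beta> n Q"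
  shows "Q = P"
proof -
  have P1: "poly P 1 > 0" "poly Q 1 = poly P 1"
    using P Q gchoose_pos unfolding is_jacobi_poly_I by auto
  then have "P \<noteq> 0" by auto
  then obtain c where c: "Q = smult c P"
    using orth_unique[of P n Q] P Q unfolding is_jacobi_poly_I by auto
  then have "c = 1" using P1 by auto
  then show ?thesis using c by simp
qed

lemma is_jacobi_poly_jacobi_poly: "is_jacobi_poly \<alpha> \<beta> n (jacobi_poly \<alpha> \<beta> n)"
proof -
  obtain P where P: "degree P = n" "P \<noteq> 0" "\<And>q. degree q < n \<Longrightarrow> I (P * q) = 0"
    using orth_exists by blast
  have P1: "poly P 1 \<noteq> 0" by (rule orth_at_1) (use P in auto)
  define c where "c = ((real n + \<alpha>) gchoose n) / poly P 1"
  have "c \<noteq> 0" unfolding c_def using P1 gchoose_pos[of n] by simp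
  then have "is_jacobi_poly \<alpha> \<beta> n (smult c P)"
    unfolding is_jacobi_poly_I using P P1 by (auto simp: I_smult c_def)
  then show ?thesis unfolding jacobi_poly_def using is_jacobi_poly_unique by (metis theI)
qed

private lemma sign_split:
  fixes p :: "real poly"
  assumes "p \<noteq> 0"
  shows "\<exists>Z s. finite Z \<and> Z \<subseteq> {x. x \<in> {-1<..<1} \<and> poly p x = 0} \<and> s \<noteq> 0 \<and>
           (\<forall>t\<in>{-1<..<1}. s * poly (p * (\<Prod>z\<in>Z. [:-z, 1:])) t \<ge> 0)"
  using assms
proof (induction "degree p" arbitrary: p rule: less_induct)
  case (less p)
  show ?case
  proof (cases "\<exists>z\<in>{-1<..<1}. poly p z = 0")
    case False
    then have p0: "poly p 0 \<noteq> 0" by auto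
    have "poly p 0 * poly p t \<ge> 0" if t: "t \<in> {-1<..<1}" for t
    proof (rule ccontr)
      assume a: "\<not> ?thesis"
      then have ne: "t \<noteq> 0" by auto
      then show False
      proof (cases "t < 0")
        case True
        then show False using poly_IVT[of t 0 p] a False t by (force simp: mult.commute)
      next
        case f: False
        then show False using poly_IVT[of 0 t p] a False t ne by force
      qed
    qed
    then show ?thesis using p0 by (intro exI[of _ "{}"] exI[of _ "poly p 0"]) auto
  next
    case True
    then obtain z where z: "z \<in> {-1<..<1}" "poly p z = 0" by blast
    then obtain q where q: "p = [:-z, 1:] * q" by (metis poly_eq_0_iff_dvd dvdE)
    have q0: "q \<noteq> 0" using q less.prems by auto
    have "degree p = Suc (degree q)" unfolding q using q0 by (subst degree_mult_eq) auto
    then obtain Z s where Z: "finite Z" "Z \<subseteq> {x. x \<in> {-1<..<1} \<and> poly q x = 0}" "s \<noteq> 0"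
      "\<And>t. t \<in> {-1<..<1} \<Longrightarrow> s * poly (q * (\<Prod>z\<in>Z. [:-z, 1:])) t \<ge> 0"
      using less.hyps[of q] q0 by auto
    show ?thesis
    proof (cases "z \<in> Z")
      case True
      have "p * (\<Prod>z\<in>Z - {z}. [:-z, 1:]) = q * (\<Prod>z\<in>Z. [:-z, 1:])"
        unfolding q using prod.remove[OF Z(1) True, of "\<lambda>z. [:-z, 1:]"] by (simp only: ac_simps)
      then show ?thesis using Z q by (intro exI[of _ "Z - {z}"] exI[of _ s]) auto
    next
      case False
      have e: "p * (\<Prod>z\<in>insert z Z. [:-z, 1:]) = [:-z,1:]^2 * (q * (\<Prod>z\<in>Z. [:-z, 1:]))"
        unfolding q power2_eq_square using prod.insert[OF Z(1) False, of "\<lambda>z. [:-z, 1:]"]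
        by (simp only: ac_simps)
      have "s * poly (p * (\<Prod>z\<in>insert z Z. [:-z, 1:])) t \<ge> 0" if "t \<in> {-1<..<1}" for t
      proof -
        have "poly ([:-z,1:]^2) t * (s * poly (q * (\<Prod>z\<in>Z. [:-z, 1:])) t) \<ge> 0"
          by (rule mult_nonneg_nonneg) (use Z(4)[OF that] in auto)
        then show ?thesis unfolding e poly_mult by (simp only: ac_simps)
      qed
      then show ?thesis using Z q z by (intro exI[of _ "insert z Z"] exI[of _ s]) auto
    qed
  qed
qed

lemma jacobi_poly_roots:
  shows "card {x. poly (jacobi_poly \<alpha> \<beta> n) x = 0} = n"
    and "{x. poly (jacobi_poly \<alpha> \<beta> n) x = 0} \<subseteq> {-1<..<1}"
proof -
  define P where "P = jacobi_poly \<alpha> \<beta> n"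
  let ?R = "{x. poly P x = 0}"
  have P: "degree P = n" "\<And>q. degree q < n \<Longrightarrow> I (P * q) = 0" "poly P 1 \<noteq> 0"
    using is_jacobi_poly_jacobi_poly[of n] gchoose_pos[of n] unfolding P_def is_jacobi_poly_I by auto
  have P0: "P \<noteq> 0" using P(3) by auto
  have fin: "finite ?R" by (rule poly_roots_finite[OF P0])
  obtain Z s where Z: "finite Z" "Z \<subseteq> {x. x \<in> {-1<..<1} \<and> poly P x = 0}" "s \<noteq> 0"
      "\<And>t. t \<in> {-1<..<1} \<Longrightarrow> s * poly (P * (\<Prod>z\<in>Z. [:-z, 1:])) t \<ge> 0"
    using sign_split[OF P0] by blast
  define q where "q = (\<Prod>z\<in>Z. [:-z, 1:])"
  have q0: "q \<noteq> 0" unfolding q_def using Z(1) by auto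
  have dq: "degree q = card Z" unfolding q_def by (subst degree_prod_eq_sum_degree) auto
  have "I (smult s (P * q)) > 0"
    by (rule I_pos) (use P0 q0 Z(3,4) q_def in auto)
  then have "I (P * q) \<noteq> 0" by (auto simp: I_smult)
  then have "n \<le> card Z" using P(2)[of q] dq by linarith
  moreover have "card ?R \<le> n" using card_poly_roots_bound[OF P0] P(1) by simp
  moreover have "card Z \<le> card ?R" by (rule card_mono[OF fin]) (use Z(2) in auto)
  ultimately have c: "card Z = n" "card ?R = n" by auto
  have "Z = ?R" by (rule card_subset_eq[OF fin]) (use Z(2) c in auto)
  then show "card {x. poly (jacobi_poly \<alpha> \<beta> n) x = 0} = n"
    "{x. poly (jacobi_poly \<alpha> \<beta> n) x = 0} \<subseteq> {-1<..<1}" using c Z(2) P_def by auto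
qed

lemma card_jacobi_nodes: "card (jacobi_nodes \<alpha> \<beta> n) = n + 2"
proof -
  let ?R = "{x. poly (jacobi_poly \<alpha> \<beta> n) x = 0}"
  have e: "jacobi_nodes \<alpha> \<beta> n = {-1, 1} \<union> ?R"
    unfolding jacobi_nodes_def by (auto simp: power2_eq_1_iff)
  have "jacobi_poly \<alpha> \<beta> n \<noteq> 0"
    using is_jacobi_poly_jacobi_poly[of n] gchoose_pos[of n] unfolding is_jacobi_poly_I by auto
  then have "finite ?R" by (rule poly_roots_finite)
  then show ?thesis unfolding e using jacobi_poly_roots[of n]
    by (subst card_Un_disjoint) auto
qed

lemma jacobi_interpolant_ex1:
  "\<exists>!L. degree L \<le> n + 1 \<and> (\<forall>x\<in>jacobi_nodes \<alpha> \<beta> n. poly L x = f x)"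
proof -
  define A where "A = jacobi_nodes \<alpha> \<beta> n"
  have card: "card A = n + 2" unfolding A_def by (rule card_jacobi_nodes)
  then have fin: "finite A" by (metis card.infinite add_is_0 zero_neq_numeral)
  define l :: "real \<Rightarrow> real poly" where "l x = (\<Prod>y\<in>A - {x}. [:-y, 1:])" for x
  define L where "L = (\<Sum>x\<in>A. smult (f x / poly (l x) x) (l x))"
  have "degree (l x) = n + 1" if "x \<in> A" for x
    unfolding l_def using card that fin by (subst degree_prod_eq_sum_degree) auto
  then have dL: "degree L \<le> n + 1" unfolding L_def
    by (intro degree_sum_le fin) (metis degree_smult_le)
  have l0: "poly (l x) y = 0 \<longleftrightarrow> y \<in> A - {x}" for x y
    unfolding l_def poly_prod using fin by auto
  have L: "poly L x = f x" if "x \<in> A" for x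
  proof -
    have "poly L x = (\<Sum>y\<in>A. if y = x then f x else 0)"
      unfolding L_def poly_sum using l0 that by (intro sum.cong) auto
    then show ?thesis using fin that by simp
  qed
  show ?thesis
  proof (rule ex1I[of _ L])
    fix M assume M: "degree M \<le> n + 1 \<and> (\<forall>x\<in>jacobi_nodes \<alpha> \<beta> n. poly M x = f x)"
    show "M = L"
      by (rule poly_eqI_degree[of A]) (use M L dL card A_def in auto)
  qed (use dL L A_def in auto)
qed

end

end

theory Submission
  imports Defs
begin

text \<open>
  Write \<open>f\<close> as a polynomial plus an average, with respect to the density \<open>g\<close>, of the truncated powers
  \<open>(t - y)\<^sub>+\<^bsup>r-1\<^esup> / (r-1)!\<close>. By the second mean value theorem the bounded variation of \<open>g\<close> reduces
  everything to a uniform bound for the interpolation error \<open>K\<^sub>r(t, y)\<close> of \<open>(t - y)\<^sub>+\<^bsup>r\<^esup> / r!\<close>.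
  As a function of \<open>y\<close>, \<open>K\<^sub>s\<^sub>+\<^sub>1\<close> is an antiderivative of \<open>- K\<^sub>s\<close> and is orthogonal to polynomials of degree
  about \<open>n\<close>; testing with a localized polynomial shows that this gains a factor \<open>1/n\<close> at every step. The
  kernel \<open>K\<^sub>0\<close>, the error for a step function, is an alternating sum dominated by a single fundamental
  polynomial, so no logarithm is lost and \<open>K\<^sub>0\<close> is bounded by the largest fundamental polynomial.

  The fundamental polynomials are quotients of \<open>(1 - t\<^sup>2) P\<^sub>n(t)\<close> by its derivative at a node, so only the
  relative size of \<open>P\<^sub>n\<close> and \<open>P\<^sub>n'\<close> matters. In the Liouville normal form of the Jacobi equation the energy
  \<open>u\<^sup>2 + u'\<^sup>2 / N\<^sup>2\<close> varies only by a bounded factor at angular distance at least \<open>const / n\<close> from the end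
  points, and closer to an end point \<open>P\<^sub>n\<close> is comparable to its value there.
\<close>

section \<open>Interpolation of a step function\<close>

text \<open>Estimating the error by the sum of all fundamental polynomials would cost a logarithm,
  and asymptotic formulas for Jacobi polynomials would be needed uniformly up to the end points.
  Both are avoided. In the second half every value of \<open>P_n\<close> and every derivative at a
  node is measured against one quantity, the energy at 0. The normalisation of \<open>P_n\<close>
  then drops out, and the end point -1 follows from 1 by a reflection that fixes 0 and exchanges
  \<alpha> and \<beta>. The remaining quotients are, up to constants, monomials in the distances of
  the argument and of the node from the end points, cut off at const / n^2, divided by the squared
  distance of the two points. They are extremal at corners of their range, and the corner values are
  the exponents of the theorem: a list of linear conditions on one number \<rho>, without any case
  distinction.\<close>

definition divdiff_part :: "real set \<Rightarrow> real set \<Rightarrow> real" where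
  "divdiff_part A Z = (\<Sum>a\<in>A. 1 / (\<Prod>z\<in>Z - {a}. a - z))"

text \<open>\<open>divdiff_part A Z\<close> is the divided difference over Z of the indicator
  function of A, and this is the usual recursion. It holds term by term: for a other than u and v it
  is the partial fraction identity for \<open>1 / ((a - u) * (a - v))\<close>.\<close>

lemma divdiff_part_rec:
  assumes fin: "finite Z" and A: "A \<subseteq> Z" and uv: "u \<in> Z" "v \<in> Z" "u \<noteq> v"
  shows "(v - u) * divdiff_part A Z =
         divdiff_part (A - {u}) (Z - {u}) - divdiff_part (A - {v}) (Z - {v})"
proof -
  define T where "T Z a = 1 / (\<Prod>z\<in>Z - {a}. a - z)" for Z and a :: real
  have finA: "finite A" using fin A finite_subset by blast
  have step: "(v - u) * T Z a = (if a = u then 0 else T (Z - {u}) a) - (if a = v then 0 else T (Z - {v}) a)"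
    if a: "a \<in> A" for a
  proof -
    have aZ: "a \<in> Z" using a A by auto
    consider "a = u" | "a = v" | "a \<noteq> u" "a \<noteq> v" by blast
    then show ?thesis
    proof cases
      case 1
      have "(\<Prod>z\<in>Z - {u}. u - z) = (u - v) * (\<Prod>z\<in>Z - {u} - {v}. u - z)"
        by (rule prod.remove) (use fin uv in auto)
      moreover have "Z - {u} - {v} = Z - {v} - {u}" by auto
      ultimately show ?thesis using 1 uv by (simp add: T_def divide_simps)
    next
      case 2
      have "(\<Prod>z\<in>Z - {v}. v - z) = (v - u) * (\<Prod>z\<in>Z - {v} - {u}. v - z)"
        by (rule prod.remove) (use fin uv in auto)
      moreover have "Z - {u} - {v} = Z - {v} - {u}" by auto
      ultimately show ?thesis using 2 uv by (simp add: T_def divide_simps)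
    next
      case 3
      let ?P = "\<Prod>z\<in>Z - {u} - {v} - {a}. a - z"
      have P: "?P \<noteq> 0" using fin by auto
      have sets: "Z - {u} - {a} - {v} = Z - {u} - {v} - {a}" "Z - {v} - {a} - {u} = Z - {u} - {v} - {a}"
          "Z - {a} - {u} = Z - {u} - {a}" by auto
      have e1: "(\<Prod>z\<in>Z - {u} - {a}. a - z) = (a - v) * ?P"
        using prod.remove[of "Z - {u} - {a}" v "\<lambda>z. a - z"] fin uv 3
        unfolding sets by auto
      have e2: "(\<Prod>z\<in>Z - {v} - {a}. a - z) = (a - u) * ?P"
        using prod.remove[of "Z - {v} - {a}" u "\<lambda>z. a - z"] fin uv 3
        unfolding sets by auto
      have e3: "(\<Prod>z\<in>Z - {a}. a - z) = (a - u) * ((a - v) * ?P)"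
        using prod.remove[of "Z - {a}" u "\<lambda>z. a - z"] fin uv 3 e1
        unfolding sets by auto
      have "a - u \<noteq> 0" "a - v \<noteq> 0" using 3 by auto
      then have "(v - u) * (1 / ((a - u) * ((a - v) * p))) = 1 / ((a - v) * p) - 1 / ((a - u) * p)"
        if "p \<noteq> 0" for p
      proof -
        have "1 / ((a - v) * p) = (a - u) / ((a - u) * ((a - v) * p))"
          "1 / ((a - u) * p) = (a - v) / ((a - u) * ((a - v) * p))"
          using that \<open>a - u \<noteq> 0\<close> \<open>a - v \<noteq> 0\<close> by simp_all
        then show ?thesis by (simp only: diff_divide_distrib[symmetric]) simp
      qed
      from this[OF P] show ?thesis using 3 unfolding T_def e1 e2 e3 by simp
    qed
  qed
  have s: "(\<Sum>a\<in>A. if a = w then 0 else g a) = sum g (A - {w})" for w and g :: "real \<Rightarrow> real"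
    by (subst sum.mono_neutral_right[OF finA, of "A - {w}"]) (auto intro: sum.cong)
  have "(v - u) * divdiff_part A Z = (\<Sum>a\<in>A. (v - u) * T Z a)"
    by (simp add: divdiff_part_def T_def sum_distrib_left)
  also have "\<dots> = (\<Sum>a\<in>A. (if a = u then 0 else T (Z - {u}) a) - (if a = v then 0 else T (Z - {v}) a))"
    using step by (intro sum.cong) auto
  also have "\<dots> = sum (T (Z - {u})) (A - {u}) - sum (T (Z - {v})) (A - {v})"
    by (simp add: sum_subtractf s)
  finally show ?thesis by (simp add: divdiff_part_def T_def)
qed

lemma divdiff_part_self:
  assumes "finite Z" "Z \<noteq> {}"
  shows "divdiff_part Z Z = (if card Z = 1 then 1 else 0)"
  using assms
proof (induction "card Z" arbitrary: Z rule: less_induct)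
  case (less Z)
  show ?case
  proof (cases "card Z = 1")
    case True
    then obtain z where "Z = {z}" by (auto simp: card_1_singleton_iff)
    then show ?thesis by (simp add: divdiff_part_def)
  next
    case False
    then have "card Z \<ge> 2" using less.prems by (metis One_nat_def Suc_1 Suc_leI card_0_eq le_neq_implies_less less_one not_less)
    then have "\<not> card Z \<le> Suc 0" by simp
    then obtain u v where uv: "u \<in> Z" "v \<in> Z" "u \<noteq> v"
      unfolding card_le_Suc0_iff_eq[OF less.prems(1)] by blast
    have "(v - u) * divdiff_part Z Z = divdiff_part (Z - {u}) (Z - {u}) - divdiff_part (Z - {v}) (Z - {v})"
      by (rule divdiff_part_rec) (use less.prems uv in auto)
    also have "\<dots> = 0"
    proof -
      have "divdiff_part (Z - {w}) (Z - {w}) = (if card Z - 1 = 1 then 1 else 0)" if "w \<in> Z" for w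
      proof -
        have c: "card (Z - {w}) = card Z - 1" using that less.prems(1) by simp
        then have "card (Z - {w}) < card Z" "card (Z - {w}) \<noteq> 0" using \<open>card Z \<ge> 2\<close> by linarith+
        then have "card (Z - {w}) < card Z" "Z - {w} \<noteq> {}" by (metis card.empty)+
        then show ?thesis using less.hyps[of "Z - {w}"] less.prems(1) c by simp
      qed
      then show ?thesis using uv by simp
    qed
    finally show ?thesis using uv False by simp
  qed
qed

text \<open>Recursion with u in A and v outside A, so u < v. Removing u keeps the number of upper
  points, removing v lowers it by one, and the minus sign between the two terms makes their signs
  agree. The induction ends at a constant function, 0 or 1.\<close>

lemma divdiff_part_sign:
  assumes "finite Z" "A \<subseteq> Z" "\<And>a b. a \<in> A \<Longrightarrow> b \<in> Z - A \<Longrightarrow> a < b"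
  shows "(-1) ^ card (Z - A) * divdiff_part A Z \<ge> 0"
  using assms
proof (induction "card Z" arbitrary: Z A rule: less_induct)
  case (less Z A)
  consider "A = {}" | "A = Z" "Z \<noteq> {}" | "A \<noteq> {}" "Z - A \<noteq> {}" using less.prems by blast
  then show ?case
  proof cases
    case 1 then show ?thesis by (simp add: divdiff_part_def)
  next
    case 2 then show ?thesis using divdiff_part_self[of Z] less.prems by auto
  next
    case 3
    then obtain u v where uv: "u \<in> A" "v \<in> Z" "v \<notin> A" by auto
    then have lt: "u < v" using less.prems(3) by auto
    have uZ: "u \<in> Z" using uv less.prems by auto
    define c where "c = card (Z - {v} - A)"
    have c: "card (Z - A) = Suc c"
      unfolding c_def using less.prems(1) uv
      by (metis Diff_iff card_Suc_Diff1 finite_Diff Diff_insert2 Diff_insert)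
    have "(-1) ^ card ((Z - {u}) - (A - {u})) * divdiff_part (A - {u}) (Z - {u}) \<ge> 0"
      by (rule less.hyps) (use less.prems uv uZ in \<open>auto intro: card_Diff1_less simp del: card_Diff_insert\<close>)
    moreover have "(Z - {u}) - (A - {u}) = Z - A" using uv by auto
    moreover have "(-1) ^ card ((Z - {v}) - A) * divdiff_part A (Z - {v}) \<ge> 0"
      by (rule less.hyps) (use less.prems uv in \<open>auto intro: card_Diff1_less simp del: card_Diff_insert\<close>)
    ultimately have "(-1) ^ card (Z - A) * (divdiff_part (A - {u}) (Z - {u}) - divdiff_part A (Z - {v})) \<ge> 0"
      unfolding c by (simp add: c c_def[symmetric] right_diff_distrib)
    moreover have "(v - u) * divdiff_part A Z = divdiff_part (A - {u}) (Z - {u}) - divdiff_part A (Z - {v})"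
      using divdiff_part_rec[OF less.prems(1,2) uZ uv(2)] lt uv by simp
    ultimately have "(-1) ^ card (Z - A) * ((v - u) * divdiff_part A Z) \<ge> 0" by simp
    then have "(v - u) * ((-1) ^ card (Z - A) * divdiff_part A Z) \<ge> 0"
      by (simp only: mult.left_commute)
    then show ?thesis using lt by (simp add: zero_le_mult_iff)
  qed
qed

section \<open>Lagrange interpolation and its error\<close>

definition lagrange_basis :: "real set \<Rightarrow> real \<Rightarrow> real \<Rightarrow> real" where
  "lagrange_basis X x t = (\<Prod>z\<in>X - {x}. (t - z) / (x - z))"

definition lagrange_error :: "real set \<Rightarrow> (real \<Rightarrow> real) \<Rightarrow> real \<Rightarrow> real" where
  "lagrange_error X f t = f t - (\<Sum>x\<in>X. f x * lagrange_basis X x t)"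

lemma lagrange_basis_node:
  assumes "finite X" "x \<in> X" "t \<in> X"
  shows "lagrange_basis X x t = (if x = t then 1 else 0)"
  using assms unfolding lagrange_basis_def by (auto intro!: prod.neutral)

lemma lagrange_error_node:
  assumes "finite X" "t \<in> X"
  shows "lagrange_error X f t = 0"
proof -
  have "(\<Sum>x\<in>X. f x * lagrange_basis X x t) = (\<Sum>x\<in>X. if x = t then f t else 0)"
    using assms by (intro sum.cong) (auto simp: lagrange_basis_node)
  then show ?thesis using assms by (simp add: lagrange_error_def)
qed

text \<open>Adjoining t to the nodes turns the value at t into a term of a divided difference; x - t
  in place of t - x causes the minus sign.\<close>

lemma lagrange_basis_term:
  assumes "finite X" "x \<in> X" "t \<notin> X"
  shows "lagrange_basis X x t = - (\<Prod>z\<in>X. t - z) * (1 / (\<Prod>z\<in>insert t X - {x}. x - z))"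
proof -
  have xt: "x \<noteq> t" using assms by auto
  have e1: "(\<Prod>z\<in>X. t - z) = (t - x) * (\<Prod>z\<in>X - {x}. t - z)"
    by (rule prod.remove) (use assms in auto)
  have "insert t X - {x} = insert t (X - {x})" using xt by auto
  then have e2: "(\<Prod>z\<in>insert t X - {x}. x - z) = (x - t) * (\<Prod>z\<in>X - {x}. x - z)"
    using assms by (simp add: prod.insert)
  have ne: "(\<Prod>z\<in>X - {x}. x - z) \<noteq> 0" using assms by auto
  have "- ((t - x) * P) * (1 / ((x - t) * Q)) = P / Q" if "Q \<noteq> 0" for P Q
  proof -
    have "- ((t - x) * P) = (x - t) * P" by (simp add: algebra_simps)
    then show ?thesis using xt by simp
  qed
  from this[OF ne] show ?thesis
    unfolding e1 e2 by (simp add: lagrange_basis_def prod_dividef)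
qed

lemma lagrange_basis_sum:
  assumes "finite X" "A \<subseteq> X" "t \<notin> X"
  shows "(\<Sum>x\<in>A. lagrange_basis X x t) = - (\<Prod>z\<in>X. t - z) * divdiff_part A (insert t X)"
  unfolding divdiff_part_def sum_distrib_left
  by (intro sum.cong refl lagrange_basis_term) (use assms in auto)

lemma abs_le_if_opposite_sign:
  fixes u v :: real
  assumes "(-1) ^ k * (u + v) \<ge> 0" "(-1) ^ Suc k * v \<ge> 0"
  shows "\<bar>u + v\<bar> \<le> \<bar>u\<bar>"
  using assms by (cases "even k") auto

text \<open>The error at \<open>t\<close> is a divided difference of the step function. Adding the node next to the
  jump to the lower part gives one of the opposite sign, so that single term dominates.\<close>

lemma lagrange_error_step_le:
  assumes fin: "finite X" and ne: "X \<noteq> {}" and bd: "\<And>x. x \<in> X \<Longrightarrow> \<bar>lagrange_basis X x t\<bar> \<le> B"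
  shows "\<bar>lagrange_error X (\<lambda>x. if u < x then 1 else 0) t\<bar> \<le> B"
proof -
  have B0: "B \<ge> 0" using ne bd by (meson abs_ge_zero all_not_in_conv order_trans)
  show ?thesis
  proof (cases "t \<in> X")
    case True
    then show ?thesis using B0 fin by (simp add: lagrange_error_node)
  next
    case False
    define W where "W = (\<Prod>z\<in>X. t - z)"
    have W0: "W \<noteq> 0" unfolding W_def using fin False by auto
    define Z where "Z = insert t X"
    define U where "U = {z \<in> Z. u < z}"
    define L where "L = Z - U"
    have finZ: "finite Z" unfolding Z_def using fin by simp
    have sub: "U \<subseteq> Z" "L \<subseteq> Z" unfolding U_def L_def by auto
    have finUL: "finite U" "finite L" using sub finZ finite_subset by blast+
    have ZL: "Z - L = U" unfolding L_def using sub by auto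
    have dZ: "divdiff_part Z Z = 0"
    proof -
      have "card Z \<noteq> 1" unfolding Z_def using fin False ne by simp
      then show ?thesis using divdiff_part_self[OF finZ] by (auto simp: Z_def)
    qed
    define T where "T a = 1 / (\<Prod>z\<in>Z - {a}. a - z)" for a
    have T: "\<bar>W * T x\<bar> \<le> B" if "x \<in> X" for x
      using bd[OF that] lagrange_basis_term[OF fin that False] unfolding T_def W_def Z_def by simp
    have err: "lagrange_error X (\<lambda>x. if u < x then 1 else 0) t = - W * divdiff_part L Z"
    proof -
      have "lagrange_error X (\<lambda>x. if u < x then 1 else 0) t
          = (if u < t then 1 else 0) - (\<Sum>x\<in>X. if u < x then lagrange_basis X x t else 0)"
        unfolding lagrange_error_def by (auto intro!: sum.cong)
      also have "(\<Sum>x\<in>X. if u < x then lagrange_basis X x t else 0) = (\<Sum>x\<in>U - {t}. lagrange_basis X x t)"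
        by (rule sum.mono_neutral_cong_right) (use fin False in \<open>auto simp: U_def Z_def\<close>)
      also have "\<dots> = - W * divdiff_part (U - {t}) Z"
        unfolding W_def Z_def by (rule lagrange_basis_sum) (use fin False in \<open>auto simp: U_def Z_def\<close>)
      finally have e: "lagrange_error X (\<lambda>x. if u < x then 1 else 0) t
          = (if u < t then 1 else 0) + W * divdiff_part (U - {t}) Z" by simp
      \<comment> \<open>The point t is a node of Z whose term stands for the function value itself;
        it belongs to U exactly when the step function is 1 at t.\<close>
      have "W * T t = 1" unfolding T_def Z_def W_def using False W0
        by (simp add: W_def[symmetric])
      moreover have "divdiff_part U Z = divdiff_part (U - {t}) Z + T t" if "u < t"
        unfolding divdiff_part_def T_def
        using sum.remove[OF finUL(1), of t "\<lambda>a. 1 / (\<Prod>z\<in>Z - {a}. a - z)"] that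
        by (simp add: U_def Z_def)
      moreover have "U - {t} = U" if "\<not> u < t" using that by (auto simp: U_def)
      ultimately have e2: "lagrange_error X (\<lambda>x. if u < x then 1 else 0) t = W * divdiff_part U Z"
        using e by (auto simp: algebra_simps)
      \<comment> \<open>The constant 1 has divided difference 0, which allows passing to the lower
        part, where the sign lemma applies.\<close>
      have "divdiff_part Z Z = divdiff_part U Z + divdiff_part L Z"
        unfolding divdiff_part_def L_def using sum.subset_diff[OF sub(1) finZ] by (simp add: add.commute)
      then have "divdiff_part U Z = - divdiff_part L Z" using dZ by linarith
      then show ?thesis using e2 by simp
    qed
    have sL: "(-1) ^ card U * divdiff_part L Z \<ge> 0"
      using divdiff_part_sign[OF finZ sub(2)] unfolding ZL by (force simp: L_def U_def)
    \<comment> \<open>The bound B is available at nodes of X only, so the dominating term must not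
      be that of t. If \<open>u < t\<close>, then t is an upper point and the largest element of L
      is a node; otherwise t is a lower point and the smallest element of U is a node.\<close>
    show ?thesis
    proof (cases "u < t")
      case True
      show ?thesis
      proof (cases "L = {}")
        case True
        then show ?thesis using err B0 by (simp add: divdiff_part_def)
      next
        case ne: False
        define a where "a = Max L"
        have a: "a \<in> L" "\<And>z. z \<in> L \<Longrightarrow> z \<le> a" unfolding a_def using finUL ne by auto
        then have aX: "a \<in> X" using \<open>u < t\<close> by (auto simp: L_def U_def Z_def)
        have e: "divdiff_part L Z = T a + divdiff_part (L - {a}) Z"
          unfolding divdiff_part_def T_def by (rule sum.remove) (use finUL a in auto)
        have ZLa: "Z - (L - {a}) = insert a U" using a sub by (auto simp: L_def)
        have "(-1) ^ card (Z - (L - {a})) * divdiff_part (L - {a}) Z \<ge> 0"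
        proof (rule divdiff_part_sign[OF finZ])
          show "L - {a} \<subseteq> Z" using sub by auto
          show "x < y" if "x \<in> L - {a}" "y \<in> Z - (L - {a})" for x y
            using that a(2)[of x] unfolding ZLa by (auto simp: L_def U_def)
        qed
        moreover have "card (Z - (L - {a})) = Suc (card U)"
          unfolding ZLa using finUL a by (simp add: L_def)
        ultimately have "\<bar>divdiff_part L Z\<bar> \<le> \<bar>T a\<bar>"
          using abs_le_if_opposite_sign[of "card U" "T a" "divdiff_part (L - {a}) Z"] sL e by simp
        then show ?thesis using T[OF aX] err
          by (simp add: abs_mult) (meson abs_ge_zero mult_left_mono order_trans)
      qed
    next
      case f: False
      show ?thesis
      proof (cases "U = {}")
        case True
        then have "L = Z" by (auto simp: L_def)
        then show ?thesis using err B0 dZ by simp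
      next
        case ne: False
        define b where "b = Min U"
        have b: "b \<in> U" "\<And>z. z \<in> U \<Longrightarrow> b \<le> z" unfolding b_def using finUL ne by auto
        then have bX: "b \<in> X" using f by (auto simp: U_def Z_def)
        have bL: "b \<notin> L" using b by (auto simp: L_def)
        have e: "divdiff_part (insert b L) Z = T b + divdiff_part L Z"
          unfolding divdiff_part_def T_def by (rule sum.insert) (use finUL bL in auto)
        have ZLb: "Z - insert b L = U - {b}" using ZL by auto
        have "(-1) ^ card (Z - insert b L) * divdiff_part (insert b L) Z \<ge> 0"
        proof (rule divdiff_part_sign[OF finZ])
          show "insert b L \<subseteq> Z" using sub b by auto
          show "x < y" if "x \<in> insert b L" "y \<in> Z - insert b L" for x y
            using that b(2)[of y] unfolding ZLb by (auto simp: L_def U_def)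
        qed
        moreover have "card U = Suc (card (Z - insert b L))"
          unfolding ZLb using finUL b by (metis card_Suc_Diff1)
        ultimately have "\<bar>divdiff_part L Z\<bar> \<le> \<bar>T b\<bar>"
          using sL e by (cases "even (card (Z - insert b L))") (auto simp: abs_if)
        then show ?thesis using T[OF bX] err
          by (simp add: abs_mult) (meson abs_ge_zero mult_left_mono order_trans)
      qed
    qed
  qed
qed

lemma lagrange_error_poly:
  assumes fin: "finite X" and deg: "degree q < card X"
  shows "lagrange_error X (poly q) t = 0"
proof -
  define l where "l x = (\<Prod>z\<in>X - {x}. smult (1 / (x - z)) [:-z, 1:])" for x
  have pl: "poly (l x) t = lagrange_basis X x t" for x t
    by (simp add: l_def lagrange_basis_def poly_prod diff_divide_distrib)
  define L where "L = (\<Sum>x\<in>X. smult (poly q x) (l x))"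
  have "degree (l x) < card X" if "x \<in> X" for x
  proof -
    have "degree (l x) \<le> (\<Sum>z\<in>X - {x}. (degree \<circ> (\<lambda>z. smult (1 / (x - z)) [:-z, 1:])) z)"
      unfolding l_def by (rule degree_prod_sum_le) (use fin in auto)
    also have "\<dots> \<le> (\<Sum>z\<in>X - {x}. 1)" by (intro sum_mono) simp
    also have "\<dots> < card X" using card_Diff1_less[OF fin that] by simp
    finally show ?thesis .
  qed
  then have "degree L < card X"
    unfolding L_def using deg by (intro degree_sum_less) (auto intro: le_less_trans[OF degree_smult_le])
  moreover have "poly L x = poly q x" if "x \<in> X" for x
    using lagrange_error_node[OF fin that, of "poly q"]
    by (simp add: L_def poly_sum pl lagrange_error_def)
  ultimately have "L = q" using deg by (intro poly_eqI_degree[of X]) auto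
  then have "poly q t = poly L t" by simp
  then show ?thesis by (simp add: L_def poly_sum pl lagrange_error_def)
qed

section \<open>Peano kernels\<close>

text \<open>The case distinction matters for \<open>s = 0\<close>: it gives the step function,
  whereas \<open>max 0 (x - y) ^ 0\<close> would be 1 everywhere.\<close>

definition trunc_power :: "nat \<Rightarrow> real \<Rightarrow> real \<Rightarrow> real" where
  "trunc_power s x y = (if y < x then (x - y) ^ s / fact s else 0)"

definition peano_kernel :: "real set \<Rightarrow> nat \<Rightarrow> real \<Rightarrow> real \<Rightarrow> real" where
  "peano_kernel X s t y = lagrange_error X (\<lambda>x. trunc_power s x y) t"

lemma trunc_power_integral:
  assumes "a \<le> b"
  shows "(trunc_power s x has_integral (trunc_power (Suc s) x a - trunc_power (Suc s) x b)) {a..b}"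
proof -
  have e: "trunc_power (Suc s) x = (\<lambda>u. max 0 (x - u) ^ Suc s / fact (Suc s))"
    by (auto simp: trunc_power_def fun_eq_iff max_def)
  \<comment> \<open>For \<open>s = 0\<close> the integrand jumps at x and the antiderivative has a
    corner there, so this point is exempted.\<close>
  have "(trunc_power s x has_integral (- trunc_power (Suc s) x b - (- trunc_power (Suc s) x a))) {a..b}"
  proof (rule fundamental_theorem_of_calculus_interior_strong[of "{x}"])
    show "continuous_on {a..b} (\<lambda>u. - trunc_power (Suc s) x u)"
      unfolding e by (intro continuous_intros) auto
    fix u assume u: "u \<in> {a<..<b} - {x}"
    show "((\<lambda>u. - trunc_power (Suc s) x u) has_vector_derivative trunc_power s x u) (at u)"
    proof (cases "u < x")
      case True
      have "((\<lambda>u. (x - u) ^ Suc s) has_real_derivative (1 + real s) * ((0 - 1) * (x - u) ^ s)) (at u)"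
        by (intro DERIV_power_Suc DERIV_diff DERIV_const DERIV_ident)
      then have "((\<lambda>u. - ((x - u) ^ Suc s / fact (Suc s))) has_real_derivative
          - ((1 + real s) * ((0 - 1) * (x - u) ^ s) / fact (Suc s))) (at u)"
        by (intro DERIV_minus DERIV_cdivide)
      moreover have "- ((1 + real s) * ((0 - 1) * (x - u) ^ s) / fact (Suc s)) = trunc_power s x u"
        using True by (simp add: trunc_power_def fact_Suc)
      ultimately have "((\<lambda>u. - ((x - u) ^ Suc s / fact (Suc s))) has_real_derivative trunc_power s x u) (at u)"
        by simp
      then have "((\<lambda>u. - trunc_power (Suc s) x u) has_real_derivative trunc_power s x u) (at u)"
        by (rule has_field_derivative_transform_within_open[of _ _ _ "{..<x}"])
          (use True in \<open>auto simp: trunc_power_def\<close>)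
      then show ?thesis by (simp add: has_real_derivative_iff_has_vector_derivative)
    next
      case False
      have "((\<lambda>u. 0) has_real_derivative 0) (at u)" by simp
      then have "((\<lambda>u. - trunc_power (Suc s) x u) has_real_derivative 0) (at u)"
        by (rule has_field_derivative_transform_within_open[of _ _ _ "{x<..}"])
          (use False u in \<open>auto simp: trunc_power_def\<close>)
      then show ?thesis using False by (simp add: has_real_derivative_iff_has_vector_derivative trunc_power_def)
    qed
  qed (use assms in auto)
  then show ?thesis by (simp add: algebra_simps)
qed

text \<open>The error at t is a finite linear combination of values at t and at the nodes, hence
  commutes with integration in a parameter. The set S records for which x the integral has to be
  known.\<close>

lemma lagrange_error_has_integral:
  assumes "finite X" "t \<in> S" "X \<subseteq> S"
    and "\<And>x. x \<in> S \<Longrightarrow> (h x has_integral I x) T"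
  shows "((\<lambda>y. lagrange_error X (\<lambda>x. h x y) t) has_integral lagrange_error X I t) T"
  unfolding lagrange_error_def
  by (intro has_integral_diff has_integral_sum has_integral_mult_left assms) (use assms in auto)

lemma peano_kernel_integral:
  assumes "finite X" "a \<le> b"
  shows "(peano_kernel X s t has_integral
           (peano_kernel X (Suc s) t a - peano_kernel X (Suc s) t b)) {a..b}"
proof -
  have "((\<lambda>y. lagrange_error X (\<lambda>x. trunc_power s x y) t) has_integral
      lagrange_error X (\<lambda>x. trunc_power (Suc s) x a - trunc_power (Suc s) x b) t) {a..b}"
    by (rule lagrange_error_has_integral[where S = UNIV])
      (use assms trunc_power_integral in auto)
  moreover have "lagrange_error X (\<lambda>x. trunc_power (Suc s) x a - trunc_power (Suc s) x b) t =
      peano_kernel X (Suc s) t a - peano_kernel X (Suc s) t b"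
    by (simp add: peano_kernel_def lagrange_error_def left_diff_distrib sum_subtractf)
  ultimately show ?thesis unfolding peano_kernel_def by simp
qed

section \<open>Orthogonality of the kernels to polynomials\<close>

lemma poly_antiderivative_exists:
  fixes q :: "real poly"
  shows "\<exists>R. pderiv R = q \<and> degree R \<le> Suc (degree q)"
proof -
  define R where "R = (\<Sum>i\<le>degree q. monom (coeff q i / real (Suc i)) (Suc i))"
  have "pderiv R = (\<Sum>i\<le>degree q. pderiv (monom (coeff q i / real (Suc i)) (Suc i)))"
    unfolding R_def using higher_pderiv_sum[of 1] by simp
  also have "\<dots> = (\<Sum>i\<le>degree q. monom (coeff q i) i)"
    by (intro sum.cong) (auto simp: pderiv_monom simp del: of_nat_Suc)
  finally have "pderiv R = (\<Sum>i\<le>degree q. monom (coeff q i) i)" .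
  then have "pderiv R = q" by (simp add: poly_as_sum_of_monoms)
  moreover have "degree R \<le> Suc (degree q)"
    unfolding R_def by (intro degree_sum_le) (auto intro: order_trans[OF degree_monom_le])
  ultimately show ?thesis by blast
qed

text \<open>Writing one factor x - y as a difference lowers the exponent at the price of replacing
  \<open>q y\<close> by \<open>y * q y\<close>; hence the induction is over all q.\<close>

lemma power_poly_integral_exists:
  fixes q :: "real poly"
  shows "\<exists>Q. degree Q \<le> degree q + s + 1 \<and>
           (\<forall>x\<ge>a. ((\<lambda>y. (x - y) ^ s * poly q y) has_integral poly Q x) {a..x})"
proof (induction s arbitrary: q)
  case 0
  obtain R where R: "pderiv R = q" "degree R \<le> Suc (degree q)"
    using poly_antiderivative_exists by blast
  have "((\<lambda>y. (x - y) ^ 0 * poly q y) has_integral poly (R - [:poly R a:]) x) {a..x}" if "x \<ge> a" for x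
  proof -
    have "(poly q has_integral (poly R x - poly R a)) {a..x}"
      by (rule fundamental_theorem_of_calculus[OF that])
        (use R(1) in \<open>auto simp: has_real_derivative_iff_has_vector_derivative[symmetric]
            intro!: has_field_derivative_at_within poly_DERIV\<close>)
    then show ?thesis by simp
  qed
  moreover have "degree (R - [:poly R a:]) \<le> degree q + 0 + 1"
    using R(2) by (intro degree_diff_le) auto
  ultimately show ?case by blast
next
  case (Suc s)
  obtain Q1 where Q1: "degree Q1 \<le> degree q + s + 1"
    "\<And>x. x \<ge> a \<Longrightarrow> ((\<lambda>y. (x - y) ^ s * poly q y) has_integral poly Q1 x) {a..x}"
    using Suc by blast
  obtain Q2 where Q2: "degree Q2 \<le> degree ([:0,1:] * q) + s + 1"
    "\<And>x. x \<ge> a \<Longrightarrow> ((\<lambda>y. (x - y) ^ s * poly ([:0,1:] * q) y) has_integral poly Q2 x) {a..x}"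
    using Suc by blast
  have "((\<lambda>y. (x - y) ^ Suc s * poly q y) has_integral poly ([:0,1:] * Q1 - Q2) x) {a..x}" if "x \<ge> a" for x
  proof -
    have "((\<lambda>y. x * ((x - y) ^ s * poly q y) - (x - y) ^ s * poly ([:0,1:] * q) y) has_integral
        (x * poly Q1 x - poly Q2 x)) {a..x}"
      by (intro has_integral_diff has_integral_mult_right Q1 Q2 that)
    moreover have "x * ((x - y) ^ s * poly q y) - (x - y) ^ s * poly ([:0,1:] * q) y
        = (x - y) ^ Suc s * poly q y" for y by (simp add: algebra_simps)
    ultimately show ?thesis by simp
  qed
  moreover have "degree ([:0,1:] * Q1 - Q2) \<le> degree q + Suc s + 1"
  proof (rule degree_diff_le)
    have d1: "degree ([:0,1:] * p) \<le> Suc (degree p)" for p :: "real poly"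
      using degree_mult_le[of "[:0,1:]" p] by simp
    show "degree ([:0,1:] * Q1) \<le> degree q + Suc s + 1" using Q1(1) d1[of Q1] by linarith
    show "degree Q2 \<le> degree q + Suc s + 1" using Q2(1) d1[of q] by linarith
  qed
  ultimately show ?case by blast
qed

text \<open>Pairing the truncated power with q in the variable y leaves a polynomial in x of degree
  at most \<open>degree q + s + 1\<close>. The interpolation error annihilates it, and error and
  integral may be exchanged.\<close>

lemma peano_kernel_orthogonal:
  assumes X: "finite X" "X \<subseteq> {-1..1}" and t: "t \<in> {-1..1}" and deg: "degree q + s + 1 < card X"
  shows "((\<lambda>y. peano_kernel X s t y * poly q y) has_integral 0) {-1..1}"
proof -
  obtain Q where Q: "degree Q \<le> degree q + s + 1"
    "\<And>x. x \<ge> -1 \<Longrightarrow> ((\<lambda>y. (x - y) ^ s * poly q y) has_integral poly Q x) {-1..x}"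
    using power_poly_integral_exists[of q s "-1"] by blast
  define Q' where "Q' = smult (1 / fact s) Q"
  have "((\<lambda>y. trunc_power s x y * poly q y) has_integral poly Q' x) {-1..1}" if x: "x \<in> {-1..1}" for x
  proof -
    have i: "((\<lambda>y. (1 / fact s) * ((x - y) ^ s * poly q y)) has_integral ((1 / fact s) * poly Q x)) {-1..x}"
      by (intro has_integral_mult_right Q) (use x in auto)
    \<comment> \<open>Below x the truncation is void; at \<open>y = x\<close> the two integrands may
      differ when \<open>s = 0\<close>.\<close>
    have "((\<lambda>y. trunc_power s x y * poly q y) has_integral poly Q' x) {-1..x}"
      by (rule has_integral_spike_finite[OF _ _ i[unfolded poly_smult[symmetric] Q'_def[symmetric]], of "{x}"])
        (auto simp: trunc_power_def)
    moreover have "((\<lambda>y. trunc_power s x y * poly q y) has_integral 0) {x..1}"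
      by (rule has_integral_is_0) (auto simp: trunc_power_def)
    ultimately have "((\<lambda>y. trunc_power s x y * poly q y) has_integral poly Q' x + 0) {-1..1}"
      by (intro has_integral_combine[of "-1" x 1]) (use x in auto)
    then show ?thesis by simp
  qed
  from lagrange_error_has_integral[OF X(1) t X(2) this]
  have "((\<lambda>y. lagrange_error X (\<lambda>x. trunc_power s x y * poly q y) t) has_integral
      lagrange_error X (poly Q') t) {-1..1}" by simp
  moreover have "lagrange_error X (\<lambda>x. trunc_power s x y * poly q y) t = peano_kernel X s t y * poly q y" for y
    unfolding peano_kernel_def lagrange_error_def left_diff_distrib sum_distrib_right
    by (simp add: mult.assoc mult.commute[of "poly q y"])
  moreover have "lagrange_error X (poly Q') t = 0"
    by (rule lagrange_error_poly[OF X(1)]) (use Q(1) deg in \<open>auto simp: Q'_def\<close>)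
  ultimately show ?thesis by simp
qed

section \<open>Lipschitz functions orthogonal to polynomials\<close>

lemma chebyshev_exists:
  "\<exists>T :: real poly. degree T \<le> k \<and> (\<forall>\<theta>. poly T (cos \<theta>) = cos (real k * \<theta>))"
proof -
  \<comment> \<open>Two consecutive polynomials are carried along for the three-term
    recursion.\<close>
  have "\<exists>T U :: real poly. degree T \<le> k \<and> degree U \<le> Suc k \<and>
      (\<forall>\<theta>. poly T (cos \<theta>) = cos (real k * \<theta>)) \<and> (\<forall>\<theta>. poly U (cos \<theta>) = cos (real (Suc k) * \<theta>))"
  proof (induction k)
    case 0
    show ?case by (intro exI[of _ 1] exI[of _ "[:0,1:]"]) simp
  next
    case (Suc k)
    then obtain T U :: "real poly" where TU: "degree T \<le> k" "degree U \<le> Suc k"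
      "\<And>\<theta>. poly T (cos \<theta>) = cos (real k * \<theta>)" "\<And>\<theta>. poly U (cos \<theta>) = cos (real (Suc k) * \<theta>)"
      by blast
    define V where "V = [:0,2:] * U - T"
    have "degree ([:0,2:] * U) \<le> Suc (Suc k)"
      using degree_mult_le[of "[:0,2:]" U] TU(2) by simp
    then have "degree V \<le> Suc (Suc k)" unfolding V_def using TU(1) by (intro degree_diff_le) auto
    moreover have "poly V (cos \<theta>) = cos (real (Suc (Suc k)) * \<theta>)" for \<theta>
    proof -
      have "cos (real (Suc k) * \<theta> + \<theta>) + cos (real (Suc k) * \<theta> - \<theta>) = 2 * cos \<theta> * cos (real (Suc k) * \<theta>)"
        by (simp add: cos_add cos_diff)
      moreover have "real (Suc k) * \<theta> + \<theta> = real (Suc (Suc k)) * \<theta>" "real (Suc k) * \<theta> - \<theta> = real k * \<theta>"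
        by (simp_all add: algebra_simps)
      ultimately show ?thesis by (simp add: V_def TU)
    qed
    ultimately show ?case using TU by blast
  qed
  then show ?thesis by blast
qed

lemma sin_ge_half:
  fixes z :: real
  assumes "0 \<le> z" "z \<le> 1"
  shows "sin z \<ge> z / 2"
proof -
  have "sin z - z/2 \<ge> sin 0 - 0/2"
  proof (rule DERIV_nonneg_imp_nondecreasing[OF assms(1)])
    fix x assume x: "0 \<le> x" "x \<le> z"
    have "cos x \<ge> cos (pi/3)"
      by (rule cos_monotone_0_pi_le) (use x assms pi_gt3 in auto)
    then have "cos x - 1/2 \<ge> 0" by (simp add: cos_60)
    moreover have "((\<lambda>x. sin x - x/2) has_real_derivative (cos x - 1/2)) (at x)"
      by (auto intro!: derivative_eq_intros)
    ultimately show "\<exists>y. ((\<lambda>x. sin x - x/2) has_real_derivative y) (at x) \<and> y \<ge> 0" by blast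
  qed
  then show ?thesis by simp
qed

lemma sin_ge_sin:
  assumes "0 \<le> d" "d \<le> p" "p \<le> pi - d"
  shows "sin d \<le> sin p"
proof (cases "p \<le> pi/2")
  case True
  then show ?thesis using assms by (intro sin_monotone_2pi_le) auto
next
  case False
  have "sin d \<le> sin (pi - p)" using assms False by (intro sin_monotone_2pi_le) auto
  then show ?thesis by simp
qed

lemma abs_cos_diff_le: "\<bar>cos x - cos y\<bar> \<le> \<bar>x - y\<bar>" for x y :: real
proof -
  have "\<bar>cos x - cos y\<bar> = 2 * \<bar>sin ((x + y) / 2)\<bar> * \<bar>sin ((y - x) / 2)\<bar>"
    by (simp add: cos_diff_cos abs_mult)
  also have "\<dots> \<le> 2 * 1 * \<bar>(y - x) / 2\<bar>"
    by (intro mult_mono abs_sin_le_one abs_sin_x_le_abs_x) auto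
  finally show ?thesis by simp
qed

text \<open>With the Chebyshev polynomial \<open>T\<close> of degree \<open>k\<close> and a zero \<open>\<xi>\<close> of it, \<open>(T x / (x - \<xi>))\<^sup>2\<close> serves
  as an algebraic Fejer kernel.\<close>

lemma localized_poly_exists:
  assumes k: "k \<ge> 1" and \<phi>: "1 / real k \<le> \<phi>" "\<phi> \<le> pi - 1 / real k" "cos (real k * \<phi>) = 0"
  obtains p :: "real poly" where "degree p \<le> 2 * k - 2" "\<And>x. poly p x \<ge> 0"
    "\<And>x. x \<in> {-1..1} \<Longrightarrow> poly p x * (x - cos \<phi>)\<^sup>2 \<le> 1"
    "integral {-1..1} (poly p) \<ge> real k / 16"
proof -
  obtain T :: "real poly" where T: "degree T \<le> k" "\<And>\<theta>. poly T (cos \<theta>) = cos (real k * \<theta>)"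
    using chebyshev_exists by blast
  define \<xi> where "\<xi> = cos \<phi>"
  have "poly T \<xi> = 0" using T(2) \<phi> by (simp add: \<xi>_def)
  then obtain g where g: "T = [:-\<xi>, 1:] * g" by (metis poly_eq_0_iff_dvd dvdE)
  have T0: "T \<noteq> 0" using T(2)[of 0] by auto
  then have g0: "g \<noteq> 0" using g by auto
  have "degree T = Suc (degree g)" unfolding g using g0 by (subst degree_mult_eq) auto
  then have dg: "degree g \<le> k - 1" using T(1) by simp
  define p where "p = g * g"
  have "degree p \<le> 2 * k - 2" unfolding p_def using degree_mult_le[of g g] dg by simp
  moreover have "poly p x \<ge> 0" for x by (simp add: p_def)
  moreover have "poly p x * (x - \<xi>)\<^sup>2 \<le> 1" if "x \<in> {-1..1}" for x
  proof -
    have "poly p x * (x - \<xi>)\<^sup>2 = (poly T x)\<^sup>2" by (simp add: p_def g power2_eq_square algebra_simps)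
    also have "poly T x = cos (real k * arccos x)" using T(2)[of "arccos x"] that by simp
    also have "(cos (real k * arccos x))\<^sup>2 \<le> 1" by (simp add: abs_square_le_1)
    finally show ?thesis .
  qed
  moreover have "integral {-1..1} (poly p) \<ge> real k / 16"
  proof -
    define h where "h = 1 / real k"
    have h: "0 < h" "h \<le> 1" "real k * h = 1" "1/2 \<le> real k" using k by (auto simp: h_def)
    have s0: "sin \<phi> > 0" by (rule sin_gt_zero) (use \<phi> h in \<open>auto simp: h_def[symmetric]\<close>)
    \<comment> \<open>Writing x as the cosine of \<open>\<phi> + e\<close> with
      \<open>\<bar>e\<bar> \<le> h\<close>, the modulus of T is at least
      \<open>k * \<bar>e\<bar> / 2\<close> and that of \<open>x - \<xi>\<close> at most
      \<open>2 * \<bar>e\<bar> * sin \<phi>\<close>. The square of the quotient of these bounds is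
      c.\<close>
    define c where "c = (real k)\<^sup>2 / (16 * (sin \<phi>)\<^sup>2)"
    have low: "poly p x \<ge> c" if x: "x \<in> {cos (\<phi> + h)..cos (\<phi> - h)}" "x \<noteq> \<xi>" for x
    proof -
      have x1: "x \<in> {-1..1}"
        using x(1) cos_ge_minus_one[of "\<phi> + h"] cos_le_one[of "\<phi> - h"]
        unfolding atLeastAtMost_iff by linarith
      define e where "e = arccos x - \<phi>"
      have xe: "x = cos (\<phi> + e)" using x1 by (simp add: e_def)
      have r: "0 \<le> \<phi> + e" "\<phi> + e \<le> pi" using x1 by (auto simp: e_def arccos_lbound arccos_ubound)
      have "\<phi> + e \<le> \<phi> + h"
      proof (rule ccontr)
        assume "\<not> ?thesis"
        then have "cos (\<phi> + e) < cos (\<phi> + h)"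
          using r \<phi> h by (intro cos_monotone_0_pi) (auto simp: h_def[symmetric])
        then show False using x xe by simp
      qed
      moreover have "\<phi> - h \<le> \<phi> + e"
      proof (rule ccontr)
        assume "\<not> ?thesis"
        then have "cos (\<phi> - h) < cos (\<phi> + e)"
          using r \<phi> h by (intro cos_monotone_0_pi) (auto simp: h_def[symmetric])
        then show False using x xe by simp
      qed
      ultimately have e: "\<bar>e\<bar> \<le> h" by auto
      have e0: "e \<noteq> 0" using x(2) xe by (auto simp: \<xi>_def)
      have T1: "\<bar>poly T x\<bar> = sin (real k * \<bar>e\<bar>)"
      proof -
        have "poly T x = - sin (real k * \<phi>) * sin (real k * e)"
          unfolding xe T(2) using \<phi>(3) by (simp add: distrib_left cos_add)
        moreover have "\<bar>sin (real k * \<phi>)\<bar> = 1"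
          using sin_cos_squared_add[of "real k * \<phi>"] \<phi>(3) by (auto simp: power2_eq_1_iff)
        ultimately have "\<bar>poly T x\<bar> = \<bar>sin (real k * e)\<bar>" by (simp add: abs_mult)
        also have "\<dots> = \<bar>sin (real k * \<bar>e\<bar>)\<bar>" by (cases "e \<ge> 0") auto
        also have "\<dots> = sin (real k * \<bar>e\<bar>)"
        proof -
          have "real k * \<bar>e\<bar> \<le> 1" using e h(3) mult_left_mono[OF e, of "real k"] by simp
          then have "sin (real k * \<bar>e\<bar>) \<ge> 0" using pi_gt3 by (intro sin_ge_zero) auto
          then show ?thesis by simp
        qed
        finally show ?thesis .
      qed
      have "real k * \<bar>e\<bar> \<le> 1" using mult_left_mono[OF e, of "real k"] h(3) by simp
      then have T2: "\<bar>poly T x\<bar> \<ge> real k * \<bar>e\<bar> / 2" unfolding T1 by (intro sin_ge_half) auto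
      \<comment> \<open>The factor \<open>sin \<phi>\<close> accounts for the compression of
        distances by the cosine near the end points. It is obtained because \<phi> keeps the
        distance \<open>1 / k\<close> from 0 and pi, whence
        \<open>sin \<bar>e/2\<bar> \<le> sin \<phi>\<close>.\<close>
      have d: "\<bar>x - \<xi>\<bar> \<le> 2 * \<bar>e\<bar> * sin \<phi>"
      proof -
        have "\<bar>sin (\<phi> + e/2)\<bar> \<le> \<bar>sin \<phi>\<bar> * \<bar>cos (e/2)\<bar> + \<bar>cos \<phi>\<bar> * \<bar>sin (e/2)\<bar>"
          unfolding sin_add by (metis abs_mult abs_triangle_ineq)
        also have "\<dots> \<le> \<bar>sin \<phi>\<bar> * 1 + 1 * \<bar>sin (e/2)\<bar>"
          by (intro add_mono mult_mono) auto
        finally have 1: "\<bar>sin (\<phi> + e/2)\<bar> \<le> sin \<phi> + \<bar>sin (e/2)\<bar>" using s0 by simp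
        have "\<bar>sin (e/2)\<bar> = \<bar>sin \<bar>e/2\<bar>\<bar>" by (cases "e \<ge> 0") auto
        moreover have "sin \<bar>e/2\<bar> \<ge> 0" using e h pi_gt3 by (intro sin_ge_zero) auto
        moreover have "sin \<bar>e/2\<bar> \<le> sin \<phi>"
          by (rule sin_ge_sin) (use e \<phi> h in \<open>auto simp: h_def[symmetric]\<close>)
        ultimately have "\<bar>sin (\<phi> + e/2)\<bar> \<le> 2 * sin \<phi>" using 1 by linarith
        moreover have "\<bar>sin (e/2)\<bar> \<le> \<bar>e/2\<bar>" by (rule abs_sin_x_le_abs_x)
        ultimately have "2 * \<bar>sin (\<phi> + e/2)\<bar> * \<bar>sin (e/2)\<bar> \<le> 2 * (2 * sin \<phi>) * \<bar>e/2\<bar>"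
          using s0 by (intro mult_mono) auto
        moreover have "\<bar>x - \<xi>\<bar> = 2 * \<bar>sin (\<phi> + e/2)\<bar> * \<bar>sin (e/2)\<bar>"
          unfolding xe \<xi>_def by (simp add: cos_diff_cos abs_mult add_divide_distrib)
        ultimately show ?thesis by (simp add: mult_ac)
      qed
      have "real k * \<bar>e\<bar> / 2 \<le> \<bar>x - \<xi>\<bar> * \<bar>poly g x\<bar>"
        using T2 by (simp add: g abs_mult[symmetric] algebra_simps)
      also have "\<dots> \<le> 2 * \<bar>e\<bar> * sin \<phi> * \<bar>poly g x\<bar>" using d by (intro mult_right_mono) auto
      finally have "\<bar>e\<bar> * real k \<le> \<bar>e\<bar> * (4 * sin \<phi> * \<bar>poly g x\<bar>)" by (simp add: mult_ac)
      then have "real k \<le> 4 * sin \<phi> * \<bar>poly g x\<bar>" using e0 by simp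
      then have "(real k)\<^sup>2 \<le> (4 * sin \<phi> * \<bar>poly g x\<bar>)\<^sup>2" by (intro power_mono) auto
      also have "\<dots> = 16 * (sin \<phi>)\<^sup>2 * poly p x" by (simp add: p_def power_mult_distrib power2_eq_square)
      finally show ?thesis unfolding c_def using s0 by (simp add: divide_le_eq mult_ac)
    qed
    have le: "cos (\<phi> + h) \<le> cos (\<phi> - h)"
      using \<phi> h by (intro cos_monotone_0_pi_le) (auto simp: h_def[symmetric])
    \<comment> \<open>The lower bound came from cancelling e, so it leaves out \<xi>; a single point
      does not affect the integral.\<close>
    have i1: "((\<lambda>x. if x = \<xi> then poly p x else c) has_integral (cos (\<phi> - h) - cos (\<phi> + h)) * c)
        {cos (\<phi> + h)..cos (\<phi> - h)}"
      by (rule has_integral_spike_finite[of "{\<xi>}" _ _ "\<lambda>_. c"])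
        (use has_integral_const_real[of c "cos (\<phi> + h)" "cos (\<phi> - h)"] le in auto)
    have ip: "poly p integrable_on {a..b}" for a b
      by (intro integrable_continuous_real continuous_intros)
    have "(cos (\<phi> - h) - cos (\<phi> + h)) * c \<le> integral {cos (\<phi> + h)..cos (\<phi> - h)} (poly p)"
      by (rule has_integral_le[OF i1 integrable_integral[OF ip]]) (use low in auto)
    also have "\<dots> \<le> integral {-1..1} (poly p)"
      by (rule integral_subset_le[OF _ ip ip]) (auto simp: p_def intro: order_trans[OF _ cos_le_one]
          order_trans[OF cos_ge_minus_one])
    finally have I: "(cos (\<phi> - h) - cos (\<phi> + h)) * c \<le> integral {-1..1} (poly p)" .
    have "cos (\<phi> - h) - cos (\<phi> + h) = 2 * sin \<phi> * sin h" by (simp add: cos_add cos_diff)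
    also have "\<dots> \<ge> 2 * sin \<phi> * (h/2)" using s0 sin_ge_half[of h] h by (intro mult_left_mono) auto
    finally have "sin \<phi> * h * c \<le> (cos (\<phi> - h) - cos (\<phi> + h)) * c"
      by (intro mult_right_mono) (auto simp: c_def)
    moreover have "sin \<phi> * h * c = real k / (16 * sin \<phi>)"
      unfolding c_def using s0 h k by (simp add: h_def power2_eq_square)
    moreover have "real k / (16 * sin \<phi>) \<ge> real k / 16"
      using s0 k by (intro divide_left_mono) auto
    ultimately show ?thesis using I by linarith
  qed
  ultimately show ?thesis using that[of p] by (simp add: \<xi>_def)
qed

text \<open>The zeros \<open>(i + 1/2) * pi / k\<close> are the midpoints of the k cells of length
  \<open>pi / k\<close>, so every angle is within \<open>pi / (2 * k) \<le> 2 / k\<close> of one of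
  them; the outermost ones are at distance \<open>pi / (2 * k) \<ge> 1 / k\<close> from 0 and
  pi.\<close>

lemma chebyshev_angle_near:
  assumes k: "k \<ge> 1" and \<theta>: "0 \<le> \<theta>" "\<theta> \<le> pi"
  obtains \<phi> where "1 / real k \<le> \<phi>" "\<phi> \<le> pi - 1 / real k" "cos (real k * \<phi>) = 0"
    "\<bar>\<phi> - \<theta>\<bar> \<le> 2 / real k"
proof -
  \<comment> \<open>At \<open>\<theta> = pi\<close> the floor is k, one beyond the last
    cell.\<close>
  define i where "i = min (k - 1) (nat \<lfloor>real k * \<theta> / pi\<rfloor>)"
  define \<phi> where "\<phi> = (real i + 1/2) * pi / real k"
  have k0: "real k > 0" using k by simp
  have ik: "real i \<le> real k - 1" using k by (auto simp: i_def min_def)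
  have pi: "pi/2 \<ge> 1" "pi/2 \<le> 2" using pi_gt3 pi_less_4 by auto
  have "real k * \<phi> = (real i + 1/2) * pi" using k0 by (simp add: \<phi>_def)
  then have kp: "real k * \<phi> = real i * pi + pi/2" by (simp add: algebra_simps)
  have "cos (real k * \<phi>) = 0" unfolding kp by (simp add: cos_add)
  moreover have "1 / real k \<le> \<phi>"
  proof -
    have "1 \<le> real i * pi + pi/2" using pi by (meson add_increasing mult_nonneg_nonneg of_nat_0_le_iff pi_ge_zero)
    then have "1 \<le> real k * \<phi>" unfolding kp .
    then show ?thesis using k0 by (simp add: divide_le_eq mult.commute)
  qed
  moreover have "\<phi> \<le> pi - 1 / real k"
  proof -
    have "real i * pi \<le> (real k - 1) * pi" using ik by (intro mult_right_mono) auto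
    then have "real k * \<phi> \<le> real k * (pi - 1 / real k)" unfolding kp using k0 pi by (simp add: algebra_simps)
    then show ?thesis using k0 by simp
  qed
  moreover have "\<bar>\<phi> - \<theta>\<bar> \<le> 2 / real k"
  proof -
    define z where "z = real k * \<theta> / pi"
    have z: "0 \<le> z" "z \<le> real k" "real k * \<theta> = z * pi" using \<theta> k0 by (auto simp: z_def divide_le_eq)
    have "real i \<le> z \<and> z \<le> real i + 1"
    proof (cases "nat \<lfloor>z\<rfloor> \<le> k - 1")
      case True
      then have "real i = real_of_int \<lfloor>z\<rfloor>" using z by (simp add: i_def z_def[symmetric])
      then show ?thesis by linarith
    next
      case False
      then have "real i = real k - 1" using k by (simp add: i_def z_def[symmetric])
      moreover have "real_of_int \<lfloor>z\<rfloor> \<ge> real k" using False z k by linarith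
      ultimately show ?thesis using z by linarith
    qed
    then have "real i * pi \<le> z * pi" "z * pi \<le> (real i + 1) * pi"
      using pi_ge_zero by (blast intro: mult_right_mono)+
    then have "real i * pi \<le> z * pi" "z * pi \<le> real i * pi + pi" by (simp_all only: distrib_right mult_1)
    then have "\<bar>real k * \<phi> - real k * \<theta>\<bar> \<le> 2"
      unfolding kp z(3) abs_le_iff using pi by linarith
    then have "real k * \<bar>\<phi> - \<theta>\<bar> \<le> 2" using k0 by (simp add: right_diff_distrib[symmetric] abs_mult)
    then show ?thesis using k0 by (simp add: le_divide_eq mult.commute)
  qed
  ultimately show ?thesis using that by blast
qed

lemma inverse_quadratic_integral_le:
  fixes \<xi> \<delta> :: real
  assumes "\<delta> > 0"
  shows "(\<lambda>x. 1 / ((x - \<xi>)\<^sup>2 + \<delta>\<^sup>2)) integrable_on {-1..1}"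
    and "integral {-1..1} (\<lambda>x. 1 / ((x - \<xi>)\<^sup>2 + \<delta>\<^sup>2)) \<le> pi / \<delta>"
proof -
  have pos: "(x - \<xi>)\<^sup>2 + \<delta>\<^sup>2 > 0" for x using assms by (simp add: add_nonneg_pos)
  have "((\<lambda>x. 1 / ((x - \<xi>)\<^sup>2 + \<delta>\<^sup>2)) has_integral
      (arctan ((1 - \<xi>) / \<delta>) / \<delta> - arctan ((-1 - \<xi>) / \<delta>) / \<delta>)) {-1..1}"
  proof (rule fundamental_theorem_of_calculus)
    fix x :: real
    have "((\<lambda>x. arctan ((x - \<xi>) / \<delta>) / \<delta>) has_real_derivative (inverse (1 + ((x - \<xi>) / \<delta>)\<^sup>2) * (1 / \<delta>) / \<delta>)) (at x)"
      using assms by (auto intro!: derivative_eq_intros)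
    moreover have "inverse (1 + ((x - \<xi>) / \<delta>)\<^sup>2) * (1 / \<delta>) / \<delta> = 1 / ((x - \<xi>)\<^sup>2 + \<delta>\<^sup>2)"
    proof -
      have "(1 + ((x - \<xi>) / \<delta>)\<^sup>2) * \<delta> * \<delta> = (x - \<xi>)\<^sup>2 + \<delta>\<^sup>2"
        using assms by (simp add: power2_eq_square field_simps)
      moreover have "inverse A * (1 / \<delta>) / \<delta> = 1 / (A * \<delta> * \<delta>)" for A
        by (simp add: divide_inverse mult_ac)
      ultimately show ?thesis by metis
    qed
    ultimately show "((\<lambda>x. arctan ((x - \<xi>) / \<delta>) / \<delta>) has_vector_derivative 1 / ((x - \<xi>)\<^sup>2 + \<delta>\<^sup>2)) (at x within {-1..1})"
      by (simp add: has_real_derivative_iff_has_vector_derivative has_vector_derivative_at_within)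
  qed simp
  moreover have "arctan ((1 - \<xi>) / \<delta>) / \<delta> - arctan ((-1 - \<xi>) / \<delta>) / \<delta> \<le> pi / \<delta>"
    using arctan_ubound[of "(1 - \<xi>) / \<delta>"] arctan_lbound[of "(-1 - \<xi>) / \<delta>"] assms
    by (simp add: diff_divide_distrib[symmetric] divide_right_mono)
  ultimately show "(\<lambda>x. 1 / ((x - \<xi>)\<^sup>2 + \<delta>\<^sup>2)) integrable_on {-1..1}"
    "integral {-1..1} (\<lambda>x. 1 / ((x - \<xi>)\<^sup>2 + \<delta>\<^sup>2)) \<le> pi / \<delta>"
    by (auto simp: integral_unique)
qed

text \<open>Let M be the maximum of the modulus of F, attained with sign \<sigma> near the peak
  \<xi> of a test polynomial p. By orthogonality, M times the integral of p is the integral of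
  \<open>(M - \<sigma> * F x) * p x\<close>. Within \<delta> of \<xi> the Lipschitz condition makes
  the first factor O(B / k); farther out it is at most 2 M, and by the decay of p that part is at
  most half of the left side.\<close>

lemma lipschitz_orthogonal_bound:
  fixes F :: "real \<Rightarrow> real"
  assumes k: "k \<ge> 1"
    and lip: "\<And>x y. x \<in> {-1..1} \<Longrightarrow> y \<in> {-1..1} \<Longrightarrow> \<bar>F x - F y\<bar> \<le> B * \<bar>x - y\<bar>"
    and orth: "\<And>q. degree q \<le> 2 * k - 2 \<Longrightarrow> ((\<lambda>x. F x * poly q x) has_integral 0) {-1..1}"
    and x: "x \<in> {-1..1}"
  shows "\<bar>F x\<bar> \<le> (4 + 256 * pi) * B / real k"
proof -
  have B0: "B \<ge> 0" using lip[of 1 0] by simp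
  have "continuous_on {-1..1} F"
    unfolding continuous_on_iff
  proof (intro ballI allI impI)
    fix x e :: real assume x: "x \<in> {-1..1}" and e: "e > 0"
    have "dist (F y) (F x) < e" if "y \<in> {-1..1}" "dist y x < e / (B + 1)" for y
    proof -
      have "\<bar>F y - F x\<bar> \<le> B * \<bar>y - x\<bar>" using lip that x by blast
      also have "\<dots> \<le> (B + 1) * \<bar>y - x\<bar>" by (intro mult_right_mono) auto
      also have "\<dots> < e" using that(2) B0 by (simp add: dist_real_def less_divide_eq mult.commute)
      finally show ?thesis by (simp add: dist_real_def)
    qed
    then show "\<exists>d>0. \<forall>y\<in>{-1..1}. dist y x < d \<longrightarrow> dist (F y) (F x) < e"
      using e B0 by (intro exI[of _ "e / (B + 1)"]) auto
  qed
  then have cF: "continuous_on {-1..1} F" and "continuous_on {-1..1} (\<lambda>x. \<bar>F x\<bar>)"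
    by (auto intro: continuous_intros)
  from continuous_attains_sup[OF _ _ this(2)] obtain x0 where x0: "x0 \<in> {-1..1}"
    "\<And>y. y \<in> {-1..1} \<Longrightarrow> \<bar>F y\<bar> \<le> \<bar>F x0\<bar>" by auto
  define M where "M = \<bar>F x0\<bar>"
  obtain \<sigma> :: real where \<sigma>: "\<bar>\<sigma>\<bar> = 1" "\<sigma> * F x0 = M"
    by (rule that[of "if F x0 \<ge> 0 then 1 else -1"]) (auto simp: M_def)
  have k0: "real k > 0" using k by simp
  \<comment> \<open>Chosen so that the outer part, at most
    \<open>4 * M * (pi / \<delta>) = M * k / 32\<close>, is half of \<open>M * k / 16\<close>, a
    lower bound for M times the integral of p. The final constant \<open>4 + 256 * pi\<close> is
    twice \<open>2 + 128 * pi\<close>.\<close>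
  define \<delta> where "\<delta> = 128 * pi / real k"
  have \<delta>0: "\<delta> > 0" using k0 by (simp add: \<delta>_def)
  obtain \<phi> where \<phi>: "1 / real k \<le> \<phi>" "\<phi> \<le> pi - 1 / real k" "cos (real k * \<phi>) = 0"
    "\<bar>\<phi> - arccos x0\<bar> \<le> 2 / real k"
    using chebyshev_angle_near[OF k, of "arccos x0"] x0(1) by (auto simp: arccos_lbound arccos_ubound)
  define \<xi> where "\<xi> = cos \<phi>"
  have \<xi>x0: "\<bar>\<xi> - x0\<bar> \<le> 2 / real k"
    using abs_cos_diff_le[of \<phi> "arccos x0"] \<phi>(4) x0(1) by (simp add: \<xi>_def)
  obtain p where p: "degree p \<le> 2 * k - 2" "\<And>x. poly p x \<ge> 0"
    "\<And>x. x \<in> {-1..1} \<Longrightarrow> poly p x * (x - \<xi>)\<^sup>2 \<le> 1" "integral {-1..1} (poly p) \<ge> real k / 16"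
    using localized_poly_exists[OF k \<phi>(1-3)] unfolding \<xi>_def by blast
  define P where "P = integral {-1..1} (poly p)"
  define J where "J = integral {-1..1} (\<lambda>x. 1 / ((x - \<xi>)\<^sup>2 + \<delta>\<^sup>2))"
  have pI: "(poly p has_integral P) {-1..1}"
    unfolding P_def by (intro integrable_integral integrable_continuous_real continuous_intros)
  have JI: "((\<lambda>x. 1 / ((x - \<xi>)\<^sup>2 + \<delta>\<^sup>2)) has_integral J) {-1..1}"
    unfolding J_def by (intro integrable_integral inverse_quadratic_integral_le \<delta>0)
  \<comment> \<open>In the outer region p is at most
    \<open>2 / ((x - \<xi>)\<^sup>2 + \<delta>\<^sup>2)\<close>. This majorant is integrable over
    the whole interval, so that no integral has to be split at distance \<delta>.\<close>
  have pw: "M * poly p x - \<sigma> * (F x * poly p x)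
      \<le> B * (2 / real k + \<delta>) * poly p x + 4 * M * (1 / ((x - \<xi>)\<^sup>2 + \<delta>\<^sup>2))" if x: "x \<in> {-1..1}" for x
  proof -
    have e: "M * poly p x - \<sigma> * (F x * poly p x) = (M - \<sigma> * F x) * poly p x" by (simp add: algebra_simps)
    have M0: "M \<ge> 0" by (simp add: M_def)
    have pos: "(x - \<xi>)\<^sup>2 + \<delta>\<^sup>2 > 0" using \<delta>0 by (simp add: add_nonneg_pos)
    show ?thesis
    proof (cases "\<bar>x - \<xi>\<bar> \<le> \<delta>")
      case True
      have "M - \<sigma> * F x = \<sigma> * (F x0 - F x)" using \<sigma>(2) by (simp add: algebra_simps)
      also have "\<dots> \<le> \<bar>F x0 - F x\<bar>" using \<sigma>(1) by (metis abs_ge_self abs_mult mult_1)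
      also have "\<dots> \<le> B * \<bar>x0 - x\<bar>" by (rule lip[OF x0(1) x])
      also have "\<dots> \<le> B * (2 / real k + \<delta>)" using True \<xi>x0 B0 by (intro mult_left_mono) auto
      finally have "(M - \<sigma> * F x) * poly p x \<le> B * (2 / real k + \<delta>) * poly p x"
        using p(2) by (intro mult_right_mono) auto
      moreover have "4 * M * (1 / ((x - \<xi>)\<^sup>2 + \<delta>\<^sup>2)) \<ge> 0" using M0 pos by simp
      ultimately show ?thesis unfolding e by linarith
    next
      case False
      have "- (\<sigma> * F x) \<le> \<bar>F x\<bar>" using \<sigma>(1) by (metis abs_ge_minus_self abs_mult mult_1)
      then have "M - \<sigma> * F x \<le> 2 * M" using x0(2)[OF x] by (simp add: M_def)
      then have "(M - \<sigma> * F x) * poly p x \<le> 2 * M * poly p x"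
        using p(2) by (intro mult_right_mono) auto
      moreover have "poly p x \<le> 2 * (1 / ((x - \<xi>)\<^sup>2 + \<delta>\<^sup>2))"
      proof -
        have "\<delta>\<^sup>2 \<le> \<bar>x - \<xi>\<bar>\<^sup>2" using False \<delta>0 by (intro power_mono) auto
        then have "poly p x * ((x - \<xi>)\<^sup>2 + \<delta>\<^sup>2) \<le> poly p x * (2 * (x - \<xi>)\<^sup>2)"
          using p(2) by (intro mult_left_mono) auto
        also have "\<dots> \<le> 2" using p(3)[OF x] by simp
        finally show ?thesis using pos by (simp add: le_divide_eq)
      qed
      then have "2 * M * poly p x \<le> 2 * M * (2 * (1 / ((x - \<xi>)\<^sup>2 + \<delta>\<^sup>2)))"
        using M0 by (intro mult_left_mono) auto
      moreover have "B * (2 / real k + \<delta>) * poly p x \<ge> 0" using B0 k0 \<delta>0 p(2) by simp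
      ultimately show ?thesis unfolding e by linarith
    qed
  qed
  have "M * P - \<sigma> * 0 \<le> B * (2 / real k + \<delta>) * P + 4 * M * J"
    by (rule has_integral_le[OF has_integral_diff[OF has_integral_mult_right[OF pI] has_integral_mult_right[OF orth[OF p(1)]]]
        has_integral_add[OF has_integral_mult_right[OF pI] has_integral_mult_right[OF JI]]])
      (rule pw)
  moreover have "4 * M * J \<le> M / 2 * P"
  proof -
    have "4 * M * J \<le> 4 * M * (pi / \<delta>)"
      unfolding J_def using inverse_quadratic_integral_le(2)[OF \<delta>0] by (intro mult_left_mono) (auto simp: M_def)
    also have "\<dots> = M / 2 * (real k / 16)" using k0 by (simp add: \<delta>_def)
    also have "\<dots> \<le> M / 2 * P" using p(4) by (intro mult_left_mono) (auto simp: M_def P_def)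
    finally show ?thesis .
  qed
  ultimately have "M / 2 * P \<le> B * (2 / real k + \<delta>) * P" by linarith
  moreover have "P > 0" using p(4) k0 by (simp add: P_def)
  ultimately have "M / 2 \<le> B * (2 / real k + \<delta>)" by (simp only: mult_le_cancel_right_pos)
  then have "M \<le> (4 + 256 * pi) * B / real k" using k0 by (simp add: \<delta>_def field_simps)
  then show ?thesis using x0(2)[OF x] by (simp add: M_def)
qed

section \<open>Interpolation error for derivatives of bounded variation\<close>

lemma peano_kernel_bound:
  assumes X: "finite X" "X \<subseteq> {-1..1}" "card X = n + 2" and t: "t \<in> {-1..1}"
    and bd: "\<And>x. x \<in> X \<Longrightarrow> \<bar>lagrange_basis X x t\<bar> \<le> \<Lambda>"
    and r: "r \<ge> 1" "n \<ge> r + 1"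
    and s: "s \<le> r" and y: "y \<in> {-1..1}"
  shows "\<bar>peano_kernel X s t y\<bar> \<le> ((4 + 256 * pi) * (2 * real r) / real n) ^ s * \<Lambda>"
  using s y
proof (induction s arbitrary: y)
  case 0
  have "X \<noteq> {}" using X(3) by auto
  from lagrange_error_step_le[OF X(1) this bd]
  show ?case by (simp add: peano_kernel_def trunc_power_def cong: if_cong)
next
  case (Suc s)
  define B where "B = ((4 + 256 * pi) * (2 * real r) / real n) ^ s * \<Lambda>"
  \<comment> \<open>The largest k for which every q with \<open>degree q \<le> 2 * k - 2\<close>
    satisfies \<open>degree q + Suc s + 1 < n + 2\<close>.\<close>
  define k where "k = (n + 1 - s) div 2"
  have sr: "s < r" using Suc by simp
  have k1: "k \<ge> 1" unfolding k_def using r sr by simp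
  \<comment> \<open>As only \<open>n \<ge> r + 1\<close> is known, k may be far smaller than n / 2;
    the factor \<open>2 * r\<close> pays for that, by
    \<open>n \<le> (n - r + 1) * r\<close>.\<close>
  have kn: "real n \<le> real k * (2 * real r)"
  proof -
    have "n \<le> (n - r + 1) * r"
    proof -
      obtain d where d: "n = r + d" using r by (metis add_leD1 le_Suc_ex)
      obtain r' where r': "r = Suc r'" using r by (cases r) auto
      show ?thesis unfolding d r' by simp
    qed
    also have "n - r + 1 \<le> 2 * k" unfolding k_def using sr r by presburger
    finally have "n \<le> k * (2 * r)" by (simp add: mult_ac)
    then show ?thesis by (metis of_nat_le_iff of_nat_mult of_nat_numeral)
  qed
  have pos: "(4 + 256 * pi) > 0" by (simp add: add_pos_pos)
  have "X \<noteq> {}" using X(3) by auto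
  then have \<Lambda>0: "\<Lambda> \<ge> 0" using bd by (meson abs_ge_zero all_not_in_conv order_trans)
  then have B0: "B \<ge> 0" unfolding B_def using pos by simp
  have ub: "\<bar>peano_kernel X s t u\<bar> \<le> B" if "u \<in> {-1..1}" for u
    unfolding B_def using Suc.IH sr that by simp
  have lip: "\<bar>peano_kernel X (Suc s) t u - peano_kernel X (Suc s) t v\<bar> \<le> B * \<bar>u - v\<bar>"
    if "u \<in> {-1..1}" "v \<in> {-1..1}" "u \<le> v" for u v
  proof -
    have "norm (peano_kernel X (Suc s) t u - peano_kernel X (Suc s) t v) \<le> B * measure lborel (cbox u v)"
      by (rule has_integral_bound[OF B0])
        (use peano_kernel_integral[OF X(1) that(3), of s t] ub that in auto)
    then show ?thesis using that by simp
  qed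
  have "\<bar>peano_kernel X (Suc s) t y\<bar> \<le> (4 + 256 * pi) * B / real k"
  proof (rule lipschitz_orthogonal_bound[OF k1 _ _ Suc.prems(2)])
    show "\<bar>peano_kernel X (Suc s) t u - peano_kernel X (Suc s) t v\<bar> \<le> B * \<bar>u - v\<bar>"
      if "u \<in> {-1..1}" "v \<in> {-1..1}" for u v
      using lip[of u v] lip[of v u] that by (cases "u \<le> v") (auto simp: abs_minus_commute)
    show "((\<lambda>x. peano_kernel X (Suc s) t x * poly q x) has_integral 0) {-1..1}"
      if "degree q \<le> 2 * k - 2" for q
    proof (rule peano_kernel_orthogonal[OF X(1,2) t])
      have "2 * k \<le> n + 1 - s" unfolding k_def by simp
      then show "degree q + Suc s + 1 < card X" using that k1 X(3) by linarith
    qed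
  qed
  also have "\<dots> \<le> (4 + 256 * pi) * B * (2 * real r / real n)"
  proof -
    have "1 / real k \<le> 2 * real r / real n"
      using kn k1 r by (simp add: field_simps)
    then have "(4 + 256 * pi) * B * (1 / real k) \<le> (4 + 256 * pi) * B * (2 * real r / real n)"
      using pos B0 by (intro mult_left_mono) auto
    then show ?thesis by simp
  qed
  also have "\<dots> = ((4 + 256 * pi) * (2 * real r) / real n) ^ Suc s * \<Lambda>"
    by (simp add: B_def)
  finally show ?case .
qed

section \<open>Functions of bounded variation as integral weights\<close>

lemma bounded_variation_mono_majorant:
  fixes g :: "real \<Rightarrow> real"
  assumes "bounded_variation_on {a..b} g"
  obtains v where "\<And>x y. a \<le> x \<Longrightarrow> x \<le> y \<Longrightarrow> y \<le> b \<Longrightarrow> \<bar>g y - g x\<bar> \<le> v y - v x"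
proof -
  obtain V where V: "\<And>(m::nat) x. (\<forall>i\<le>m. x i \<in> {a..b}) \<Longrightarrow> (\<forall>i<m. x i \<le> x (Suc i)) \<Longrightarrow>
        (\<Sum>i<m. \<bar>g (x (Suc i)) - g (x i)\<bar>) \<le> V"
    using assms unfolding bounded_variation_on_def by blast
  \<comment> \<open>The majorant is the total variation v of g on \<open>{a..y}\<close>. Both v and
    \<open>v - g\<close> are then nondecreasing, which is the Jordan decomposition used
    later.\<close>
  define S where "S y = {\<Sum>i<m. \<bar>g (x (Suc i)) - g (x i)\<bar> | (m::nat) x.
      (\<forall>i\<le>m. x i \<in> {a..y}) \<and> (\<forall>i<m. x i \<le> x (Suc i))}" for y
  have bdd: "bdd_above (S y)" if "y \<le> b" for y
  proof (rule bdd_aboveI[of _ V])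
    fix s assume "s \<in> S y"
    then obtain m p where p: "s = (\<Sum>i<m. \<bar>g (p (Suc i)) - g (p i)\<bar>)"
      "\<forall>i\<le>m. p i \<in> {a..y}" "\<forall>i<m. p i \<le> p (Suc i)"
      unfolding S_def by blast
    from p(2) have "\<forall>i\<le>m. p i \<in> {a..b}" using that by auto
    then show "s \<le> V" unfolding p(1) using p(3) by (rule V)
  qed
  have ne: "S y \<noteq> {}" if "a \<le> y" for y
    unfolding S_def using that by (auto intro!: exI[of _ 0] exI[of _ "\<lambda>_. a"])
  have "\<bar>g y - g x\<bar> \<le> Sup (S y) - Sup (S x)" if xy: "a \<le> x" "x \<le> y" "y \<le> b" for x y
  proof -
    have "Sup (S x) \<le> Sup (S y) - \<bar>g y - g x\<bar>"
    proof (rule cSup_least[OF ne[OF xy(1)]])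
      fix s assume "s \<in> S x"
      then obtain m p where p: "s = (\<Sum>i<m. \<bar>g (p (Suc i)) - g (p i)\<bar>)"
        "\<And>i. i \<le> m \<Longrightarrow> p i \<in> {a..x}" "\<And>i. i < m \<Longrightarrow> p i \<le> p (Suc i)"
        unfolding S_def by blast
      \<comment> \<open>Appending x and y to a partition of \<open>{a..x}\<close> adds at least
        \<open>\<bar>g y - g x\<bar>\<close> to its sum.\<close>
      define q where "q i = (if i \<le> m then p i else if i = Suc m then x else y)" for i
      have "(\<Sum>i<m. \<bar>g (q (Suc i)) - g (q i)\<bar>) = s"
        unfolding p(1) by (intro sum.cong) (auto simp: q_def)
      then have e: "(\<Sum>i<Suc (Suc m). \<bar>g (q (Suc i)) - g (q i)\<bar>) = s + \<bar>g x - g (p m)\<bar> + \<bar>g y - g x\<bar>"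
        by (simp add: q_def)
      have "(\<Sum>i<Suc (Suc m). \<bar>g (q (Suc i)) - g (q i)\<bar>) \<in> S y"
      proof -
        have "\<forall>i\<le>Suc (Suc m). q i \<in> {a..y}"
        proof (intro allI impI)
          show "q i \<in> {a..y}" for i using p(2)[of i] xy by (auto simp: q_def)
        qed
        moreover have "\<forall>i<Suc (Suc m). q i \<le> q (Suc i)"
          using p(2)[of m] p(3) xy by (auto simp: q_def less_Suc_eq)
        ultimately show ?thesis unfolding S_def by blast
      qed
      then have "s + \<bar>g x - g (p m)\<bar> + \<bar>g y - g x\<bar> \<le> Sup (S y)"
        unfolding e by (rule cSup_upper[OF _ bdd[OF xy(3)]])
      then show "s \<le> Sup (S y) - \<bar>g y - g x\<bar>" by linarith
    qed
    then show ?thesis by linarith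
  qed
  then show thesis using that[of "\<lambda>y. Sup (S y)"] by blast
qed

lemma integral_mono_mult_bound:
  fixes f g :: "real \<Rightarrow> real"
  assumes f: "f integrable_on {a..b}" and ab: "a \<le> b"
    and g: "\<And>x y. a \<le> x \<Longrightarrow> x \<le> y \<Longrightarrow> y \<le> b \<Longrightarrow> g x \<le> g y"
    and M: "\<And>c. c \<in> {a..b} \<Longrightarrow> \<bar>integral {a..c} f\<bar> \<le> M" "\<And>c. c \<in> {a..b} \<Longrightarrow> \<bar>integral {c..b} f\<bar> \<le> M"
  obtains I where "((\<lambda>x. g x * f x) has_integral I) {a..b}" "\<bar>I\<bar> \<le> (\<bar>g a\<bar> + \<bar>g b\<bar>) * M"
proof -
  obtain c where c: "c \<in> {a..b}"
    "((\<lambda>x. g x * f x) has_integral (g a * integral {a..c} f + g b * integral {c..b} f)) {a..b}"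
    by (rule second_mean_value_theorem_full[OF f ab, where g = g]) (use g in blast)+
  have "\<bar>g a * integral {a..c} f + g b * integral {c..b} f\<bar>
      \<le> \<bar>g a\<bar> * \<bar>integral {a..c} f\<bar> + \<bar>g b\<bar> * \<bar>integral {c..b} f\<bar>"
    by (metis abs_mult abs_triangle_ineq)
  also have "\<dots> \<le> \<bar>g a\<bar> * M + \<bar>g b\<bar> * M" using M[OF c(1)] by (intro add_mono mult_left_mono) auto
  finally show ?thesis using that[OF c(2)] by (simp add: distrib_right)
qed

text \<open>By the second mean value theorem only the integrals of f over initial and final segments
  matter, not the size of f. With a Peano kernel as f these integrals are increments of the next
  kernel, which is smaller by a factor of order \<open>1 / n\<close>. The constant depends on g
  alone.\<close>

lemma bounded_variation_integral_bound:
  fixes g :: "real \<Rightarrow> real"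
  assumes bv: "bounded_variation_on {a..b} g" and ab: "a \<le> b"
  obtains C where "C \<ge> 0" "\<And>f. f integrable_on {a..b} \<Longrightarrow> (\<lambda>x. f x * g x) integrable_on {a..b}"
    "\<And>f M. f integrable_on {a..b} \<Longrightarrow>
    (\<And>c. c \<in> {a..b} \<Longrightarrow> \<bar>integral {a..c} f\<bar> \<le> M) \<Longrightarrow>
    (\<And>c. c \<in> {a..b} \<Longrightarrow> \<bar>integral {c..b} f\<bar> \<le> M) \<Longrightarrow>
    \<bar>integral {a..b} (\<lambda>x. f x * g x)\<bar> \<le> C * M"
proof -
  obtain v where v: "\<And>x y. a \<le> x \<Longrightarrow> x \<le> y \<Longrightarrow> y \<le> b \<Longrightarrow> \<bar>g y - g x\<bar> \<le> v y - v x"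
    using bounded_variation_mono_majorant[OF bv] by blast
  define w where "w x = v x - g x" for x
  have mono: "v x \<le> v y" "w x \<le> w y" if "a \<le> x" "x \<le> y" "y \<le> b" for x y
    using v[OF that] by (auto simp: w_def)
  define C where "C = (\<bar>v a\<bar> + \<bar>v b\<bar>) + (\<bar>w a\<bar> + \<bar>w b\<bar>)"
  have fg: "(\<lambda>x. f x * g x) = (\<lambda>x. v x * f x - w x * f x)" for f by (auto simp: w_def algebra_simps)
  have "(\<lambda>x. f x * g x) integrable_on {a..b}" if f: "f integrable_on {a..b}" for f
  proof -
    have "(\<lambda>x. v x * f x) integrable_on {a..b}"
      by (rule second_mean_value_theorem_full[OF f ab, where g = v])
        (use mono in \<open>blast intro: has_integral_integrable\<close>)+
    moreover have "(\<lambda>x. w x * f x) integrable_on {a..b}"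
      by (rule second_mean_value_theorem_full[OF f ab, where g = w])
        (use mono in \<open>blast intro: has_integral_integrable\<close>)+
    ultimately show ?thesis unfolding fg by (rule integrable_diff)
  qed
  moreover have "\<bar>integral {a..b} (\<lambda>x. f x * g x)\<bar> \<le> C * M"
    if f: "f integrable_on {a..b}"
      and M: "\<And>c. c \<in> {a..b} \<Longrightarrow> \<bar>integral {a..c} f\<bar> \<le> M" "\<And>c. c \<in> {a..b} \<Longrightarrow> \<bar>integral {c..b} f\<bar> \<le> M" for f M
  proof -
    obtain I where I: "((\<lambda>x. v x * f x) has_integral I) {a..b}" "\<bar>I\<bar> \<le> (\<bar>v a\<bar> + \<bar>v b\<bar>) * M"
      using integral_mono_mult_bound[where g = v, OF f ab mono(1) M] by blast
    obtain J where J: "((\<lambda>x. w x * f x) has_integral J) {a..b}" "\<bar>J\<bar> \<le> (\<bar>w a\<bar> + \<bar>w b\<bar>) * M"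
      using integral_mono_mult_bound[where g = w, OF f ab mono(2) M] by blast
    have "integral {a..b} (\<lambda>x. f x * g x) = I - J"
      unfolding fg using has_integral_diff[OF I(1) J(1)] by (simp add: integral_unique)
    then have "\<bar>integral {a..b} (\<lambda>x. f x * g x)\<bar> \<le> \<bar>I\<bar> + \<bar>J\<bar>" by (simp add: abs_triangle_ineq4)
    also have "\<dots> \<le> C * M" unfolding C_def distrib_right[of _ _ M] using I(2) J(2)
      by (simp add: distrib_right)
    finally show ?thesis .
  qed
  moreover have "C \<ge> 0" by (simp add: C_def)
  ultimately show thesis using that by blast
qed

section \<open>Taylor's formula with integral remainder\<close>

lemma trunc_power_increment:
  assumes "x \<le> z"
  shows "(z - x) * trunc_power s x y \<le> trunc_power (Suc s) z y - trunc_power (Suc s) x y"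
    and "trunc_power (Suc s) z y - trunc_power (Suc s) x y \<le> (z - x) * trunc_power s z y"
proof -
  \<comment> \<open>Since \<open>trunc_power\<close> depends on x - y only, integration in the first
    argument is integration in the second one after a reflection.\<close>
  have e: "trunc_power n (- y) = (\<lambda>u. trunc_power n (- u) y)" for n by (auto simp: trunc_power_def fun_eq_iff diff_diff_eq diff_diff_eq[symmetric] minus_diff_commute)
  have i: "((\<lambda>u. trunc_power s u y) has_integral (trunc_power (Suc s) z y - trunc_power (Suc s) x y)) {x..z}"
    using trunc_power_integral[of "-z" "-x" s "-y"] assms unfolding e
    using has_integral_reflect_real[of "\<lambda>u. trunc_power s u y" "trunc_power (Suc s) z y - trunc_power (Suc s) x y" z x]
    by simp
  have mono: "trunc_power s u y \<le> trunc_power s v y" if "u \<le> v" for u v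
    using that by (auto simp: trunc_power_def intro!: divide_right_mono power_mono)
  have c: "((\<lambda>u. c) has_integral (z - x) * c) {x..z}" for c :: real
    using has_integral_const_real[of c x z] assms by simp
  show "(z - x) * trunc_power s x y \<le> trunc_power (Suc s) z y - trunc_power (Suc s) x y"
    by (rule has_integral_le[OF c i]) (use mono in auto)
  show "trunc_power (Suc s) z y - trunc_power (Suc s) x y \<le> (z - x) * trunc_power s z y"
    by (rule has_integral_le[OF i c]) (use mono in auto)
qed

text \<open>The representing function \<open>g\<close> need not be continuous; boundedness of \<open>g\<close> makes the
  remainder of the difference quotient quadratic.\<close>

lemma trunc_power_convolution_derivative:
  fixes g :: "real \<Rightarrow> real"
  assumes int: "\<And>s x. x \<in> {-1..1} \<Longrightarrow> ((\<lambda>y. trunc_power s x y * g y) has_integral G s x) {-1..1}"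
    and B: "\<And>y. y \<in> {-1..1} \<Longrightarrow> \<bar>g y\<bar> \<le> B" and x: "x \<in> {-1..1}"
  shows "(G (Suc s) has_real_derivative G s x) (at x within {-1..1})"
proof -
  have B0: "B \<ge> 0" using B[of 0] by simp
  define D where "D u v y = trunc_power (Suc s) v y - trunc_power (Suc s) u y" for u v y
  \<comment> \<open>Both choices of w are needed because the point of differentiation may be
    approached from either side, while the segment is always written with
    \<open>u \<le> v\<close>.\<close>
  have quad: "\<bar>G (Suc s) v - G (Suc s) u - (v - u) * G s w\<bar> \<le> B * 2 ^ s * (v - u)\<^sup>2"
    if uv: "u \<in> {-1..1}" "v \<in> {-1..1}" "u \<le> v" and w: "w = u \<or> w = v" for u v w
  proof -
    have w1: "w \<in> {-1..1}" using uv w by auto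
    have i1: "((\<lambda>y. trunc_power (Suc s) v y * g y - trunc_power (Suc s) u y * g y
          - (v - u) * (trunc_power s w y * g y)) has_integral (G (Suc s) v - G (Suc s) u - (v - u) * G s w)) {-1..1}"
      by (intro has_integral_diff has_integral_mult_right int uv w1)
    have tp: "((trunc_power s a) has_integral trunc_power (Suc s) a (-1)) {-1..1}" if "a \<in> {-1..1}" for a
      using trunc_power_integral[of "-1" 1 s a] that by (simp add: trunc_power_def)
    \<comment> \<open>For \<open>s = 0\<close> the difference of the truncated powers is 1 on a
      whole segment, however small v - u is. Its integral is still of order v - u, and this supplies
      the second factor of the quadratic bound.\<close>
    have i2: "((\<lambda>y. B * ((v - u) * (trunc_power s v y - trunc_power s u y))) has_integral
        (B * ((v - u) * (trunc_power (Suc s) v (-1) - trunc_power (Suc s) u (-1))))) {-1..1}"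
      by (intro has_integral_mult_right has_integral_diff tp uv)
    have pw: "norm (trunc_power (Suc s) v y * g y - trunc_power (Suc s) u y * g y
          - (v - u) * (trunc_power s w y * g y)) \<le> B * ((v - u) * (trunc_power s v y - trunc_power s u y))"
      if y: "y \<in> {-1..1}" for y
    proof -
      have "\<bar>D u v y - (v - u) * trunc_power s w y\<bar> \<le> (v - u) * (trunc_power s v y - trunc_power s u y)"
        using trunc_power_increment[OF uv(3), of s y] w by (auto simp: D_def right_diff_distrib abs_le_iff)
      then have "\<bar>D u v y - (v - u) * trunc_power s w y\<bar> * \<bar>g y\<bar>
          \<le> (v - u) * (trunc_power s v y - trunc_power s u y) * B"
        using B[OF y] by (intro mult_mono) auto
      moreover have "trunc_power (Suc s) v y * g y - trunc_power (Suc s) u y * g y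
          - (v - u) * (trunc_power s w y * g y) = (D u v y - (v - u) * trunc_power s w y) * g y"
        by (simp add: D_def algebra_simps)
      ultimately show ?thesis by (simp add: abs_mult mult_ac)
    qed
    have "norm (G (Suc s) v - G (Suc s) u - (v - u) * G s w)
        \<le> B * ((v - u) * (trunc_power (Suc s) v (-1) - trunc_power (Suc s) u (-1)))"
      using integral_norm_bound_integral[OF has_integral_integrable[OF i1] has_integral_integrable[OF i2] pw]
      unfolding integral_unique[OF i1] integral_unique[OF i2] .
    also have "\<dots> \<le> B * ((v - u) * ((v - u) * 2 ^ s))"
    proof -
      have "trunc_power (Suc s) v (-1) - trunc_power (Suc s) u (-1) \<le> (v - u) * trunc_power s v (-1)"
        by (rule trunc_power_increment(2)[OF uv(3)])
      also have "\<dots> \<le> (v - u) * 2 ^ s"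
      proof -
        have "(v + 1) ^ s / fact s \<le> 2 ^ s / 1"
          using uv by (intro frac_le power_mono) auto
        then have "trunc_power s v (-1) \<le> 2 ^ s" by (simp add: trunc_power_def)
        then show ?thesis using uv by (intro mult_left_mono) auto
      qed
      finally show ?thesis using uv B0 by (intro mult_left_mono) auto
    qed
    finally show ?thesis by (simp add: power2_eq_square mult_ac)
  qed
  have q2: "\<bar>G (Suc s) z - G (Suc s) x - (z - x) * G s x\<bar> \<le> B * 2 ^ s * (z - x)\<^sup>2" if z: "z \<in> {-1..1}" for z
  proof (cases "x \<le> z")
    case True
    then show ?thesis using quad[OF x z] by blast
  next
    case False
    then have "\<bar>G (Suc s) x - G (Suc s) z - (x - z) * G s x\<bar> \<le> B * 2 ^ s * (x - z)\<^sup>2"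
      using quad[OF z x] by simp
    moreover have "G (Suc s) x - G (Suc s) z - (x - z) * G s x = - (G (Suc s) z - G (Suc s) x - (z - x) * G s x)"
      by (simp add: algebra_simps)
    ultimately show ?thesis by (simp add: power2_commute)
  qed
  have "((\<lambda>z. (G (Suc s) z - G (Suc s) x) / (z - x) - G s x) \<longlongrightarrow> 0) (at x within {-1..1})"
  proof (rule Lim_null_comparison)
    show "\<forall>\<^sub>F z in at x within {-1..1}. norm ((G (Suc s) z - G (Suc s) x) / (z - x) - G s x) \<le> B * 2 ^ s * \<bar>z - x\<bar>"
      unfolding eventually_at_filter
    proof (intro always_eventually allI impI)
      fix z assume z: "z \<noteq> x" "z \<in> {-1..1}"
      then have e: "(G (Suc s) z - G (Suc s) x) / (z - x) - G s x
          = (G (Suc s) z - G (Suc s) x - (z - x) * G s x) / (z - x)" by (simp add: field_simps)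
      show "norm ((G (Suc s) z - G (Suc s) x) / (z - x) - G s x) \<le> B * 2 ^ s * \<bar>z - x\<bar>"
        unfolding e using q2[OF z(2)] z(1) by (simp add: divide_le_eq power2_eq_square abs_mult mult.assoc)
    qed
    have "((\<lambda>z. B * 2 ^ s * \<bar>z - x\<bar>) \<longlongrightarrow> B * 2 ^ s * \<bar>x - x\<bar>) (at x within {-1..1})"
      by (intro tendsto_intros)
    then show "((\<lambda>z. B * 2 ^ s * \<bar>z - x\<bar>) \<longlongrightarrow> 0) (at x within {-1..1})" by simp
  qed
  then show ?thesis unfolding has_field_derivative_iff by (simp add: LIM_zero_iff)
qed

text \<open>Integration from the highest derivative downwards: with \<open>pderiv R = q\<close>, the
  function \<open>D - R - G (Suc j)\<close> has derivative 0 relative to the interval, hence is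
  constant, and the constant is absorbed into the polynomial.\<close>

lemma taylor_integral_representation:
  fixes f g :: "real \<Rightarrow> real"
  assumes int: "\<And>s x. x \<in> {-1..1} \<Longrightarrow> ((\<lambda>y. trunc_power s x y * g y) has_integral G s x) {-1..1}"
    and B: "\<And>y. y \<in> {-1..1} \<Longrightarrow> \<bar>g y\<bar> \<le> B"
    and diff: "times_differentiable_on m f {-1..1}"
    and rep: "\<And>t. t \<in> {-1..1} \<Longrightarrow> nth_deriv_on {-1..1} m f t = c + integral {-1..t} g"
  shows "\<exists>q. degree q \<le> m \<and> (\<forall>x\<in>{-1..1}. f x = poly q x + G m x)"
proof -
  have "\<exists>q. degree q \<le> j \<and> (\<forall>x\<in>{-1..1}. nth_deriv_on {-1..1} (m - j) f x = poly q x + G j x)" if "j \<le> m" for j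
    using that
  proof (induction j)
    case 0
    have "integral {-1..t} g = G 0 t" if t: "t \<in> {-1..1}" for t
    proof -
      have on: "(\<lambda>y. trunc_power 0 t y * g y) integrable_on {-1..1}" using int[OF t, of 0] by blast
      have "G 0 t = integral {-1..1} (\<lambda>y. trunc_power 0 t y * g y)" using int[OF t, of 0] by (simp add: integral_unique)
      also have "\<dots> = integral {-1..t} (\<lambda>y. trunc_power 0 t y * g y) + integral {t..1} (\<lambda>y. trunc_power 0 t y * g y)"
        using Henstock_Kurzweil_Integration.integral_combine[OF _ _ on, of t] t by simp
      also have "integral {t..1} (\<lambda>y. trunc_power 0 t y * g y) = integral {t..1} (\<lambda>y. 0)"
        by (rule integral_cong) (simp add: trunc_power_def)
      also have "integral {-1..t} (\<lambda>y. trunc_power 0 t y * g y) = integral {-1..t} g"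
        by (rule integral_spike[of "{t}"]) (auto simp: trunc_power_def)
      finally show ?thesis by simp
    qed
    then show ?case using rep by (intro exI[of _ "[:c:]"]) auto
  next
    case (Suc j)
    then obtain q where q: "degree q \<le> j"
      "\<And>x. x \<in> {-1..1} \<Longrightarrow> nth_deriv_on {-1..1} (m - j) f x = poly q x + G j x" by auto
    define D where "D = nth_deriv_on {-1..1} (m - Suc j) f"
    have mj: "m - j = Suc (m - Suc j)" using Suc.prems by simp
    have dD: "(D has_vector_derivative poly q x + G j x) (at x within {-1..1})" if x: "x \<in> {-1..1}" for x
    proof -
      have "D differentiable (at x within {-1..1})"
        using diff x Suc.prems unfolding times_differentiable_on_def D_def differentiable_on_def by simp
      then have "(D has_vector_derivative vector_derivative D (at x within {-1..1})) (at x within {-1..1})"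
        by (simp add: vector_derivative_works)
      moreover have "vector_derivative D (at x within {-1..1}) = poly q x + G j x"
        using q(2)[OF x] unfolding mj by (simp add: D_def)
      ultimately show ?thesis by simp
    qed
    obtain R where R: "pderiv R = q" "degree R \<le> Suc (degree q)" using poly_antiderivative_exists by blast
    define h where "h x = D x - poly R x - G (Suc j) x" for x
    have "(h has_vector_derivative 0) (at x within {-1..1})" if x: "x \<in> {-1..1}" for x
    proof -
      have "(poly R has_vector_derivative poly q x) (at x within {-1..1})"
        using poly_DERIV[of R x] R(1)
        by (simp add: has_real_derivative_iff_has_vector_derivative has_vector_derivative_at_within)
      moreover have "(G (Suc j) has_vector_derivative G j x) (at x within {-1..1})"
        using trunc_power_convolution_derivative[OF int B x] by (simp add: has_real_derivative_iff_has_vector_derivative)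
      ultimately have "((\<lambda>x. D x - poly R x - G (Suc j) x) has_vector_derivative
          (poly q x + G j x) - poly q x - G j x) (at x within {-1..1})"
        by (intro has_vector_derivative_diff dD x)
      then show ?thesis by (simp add: h_def[abs_def])
    qed
    then obtain k where k: "\<And>x. x \<in> {-1..1} \<Longrightarrow> h x = k"
      using has_vector_derivative_zero_constant[of "{-1..1::real}" h] by auto
    have "degree (R + [:k:]) \<le> Suc j" using R(2) q(1) by (intro degree_add_le) auto
    moreover have "D x = poly (R + [:k:]) x + G (Suc j) x" if "x \<in> {-1..1}" for x
      using k[OF that] by (simp add: h_def algebra_simps)
    ultimately show ?case unfolding D_def by blast
  qed
  from this[of m] show ?thesis by simp
qed

text \<open>The constant is fixed before the nodes: their position enters through \<Lambda> alone,
  so all knowledge about Jacobi polynomials can be confined to a bound for the fundamental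
  polynomials.\<close>

lemma lagrange_error_bound:
  fixes f g :: "real \<Rightarrow> real"
  assumes r: "r \<ge> 1"
    and diff: "times_differentiable_on (r - 1) f {-1..1}"
    and bv: "bounded_variation_on {-1..1} g"
    and rep: "\<And>t. t \<in> {-1..1} \<Longrightarrow> nth_deriv_on {-1..1} (r - 1) f t = c + integral {-1..t} g"
  obtains C where "C \<ge> 0" "\<And>X n t \<Lambda>. n \<ge> r + 1 \<Longrightarrow> finite X \<Longrightarrow> X \<subseteq> {-1..1} \<Longrightarrow> card X = n + 2 \<Longrightarrow>
    t \<in> {-1..1} \<Longrightarrow> (\<And>x. x \<in> X \<Longrightarrow> \<bar>lagrange_basis X x t\<bar> \<le> \<Lambda>) \<Longrightarrow>
    \<bar>lagrange_error X f t\<bar> \<le> C * (1 / real n) ^ r * \<Lambda>"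
proof -
  obtain C where C: "C \<ge> 0" "\<And>f. f integrable_on {-1..1} \<Longrightarrow> (\<lambda>x. f x * g x) integrable_on {-1..1}"
    "\<And>f M. f integrable_on {-1..1} \<Longrightarrow>
    (\<And>c. c \<in> {-1..1} \<Longrightarrow> \<bar>integral {-1..c} f\<bar> \<le> M) \<Longrightarrow>
    (\<And>c. c \<in> {-1..1} \<Longrightarrow> \<bar>integral {c..1} f\<bar> \<le> M) \<Longrightarrow>
    \<bar>integral {-1..1} (\<lambda>x. f x * g x)\<bar> \<le> C * M"
    by (rule bounded_variation_integral_bound[OF bv]) (simp, blast)
  obtain v where v: "\<And>x y. -1 \<le> x \<Longrightarrow> x \<le> y \<Longrightarrow> y \<le> 1 \<Longrightarrow> \<bar>g y - g x\<bar> \<le> v y - v x"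
    using bounded_variation_mono_majorant[OF bv] by blast
  have B: "\<bar>g y\<bar> \<le> \<bar>g (-1)\<bar> + (v 1 - v (-1))" if "y \<in> {-1..1}" for y
    using v[of "-1" y] v[of y 1] that by auto
  define G where "G s x = integral {-1..1} (\<lambda>y. trunc_power s x y * g y)" for s x
  have int: "((\<lambda>y. trunc_power s x y * g y) has_integral G s x) {-1..1}" for s x
    unfolding G_def
    by (intro integrable_integral C(2) has_integral_integrable[OF trunc_power_integral]) simp
  obtain q where q: "degree q \<le> r - 1" "\<And>x. x \<in> {-1..1} \<Longrightarrow> f x = poly q x + G (r - 1) x"
    using taylor_integral_representation[OF int B diff rep] by blast
  define A where "A = ((4 + 256 * pi) * (2 * real r)) ^ r"
  have A0: "A \<ge> 0" unfolding A_def
    by (rule zero_le_power, rule mult_nonneg_nonneg) (use pi_ge_zero in linarith, simp)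
  have main: "\<bar>lagrange_error X f t\<bar> \<le> C * 2 * A * (1 / real n) ^ r * \<Lambda>"
    if n: "n \<ge> r + 1" and X: "finite X" "X \<subseteq> {-1..1}" "card X = n + 2" and t: "t \<in> {-1..1}"
      and bd: "\<And>x. x \<in> X \<Longrightarrow> \<bar>lagrange_basis X x t\<bar> \<le> \<Lambda>" for X n t \<Lambda>
  proof -
    define M where "M = A * (1 / real n) ^ r * \<Lambda>"
    have K: "\<bar>peano_kernel X r t y\<bar> \<le> M" if "y \<in> {-1..1}" for y
    proof -
      have e: "(a / b) ^ r = a ^ r * (1 / b) ^ r" for a b :: real
        by (simp add: power_divide)
      show ?thesis unfolding M_def A_def e[symmetric]
        by (rule peano_kernel_bound[OF X t bd r n order_refl that])
    qed
    have KI: "(peano_kernel X (r - 1) t has_integral (peano_kernel X r t a - peano_kernel X r t b)) {a..b}"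
      if "a \<le> b" for a b
    proof -
      have "Suc (r - 1) = r" using r by simp
      then show ?thesis using peano_kernel_integral[OF X(1) that, of "r - 1" t] by metis
    qed
    \<comment> \<open>A pointwise bound for \<open>peano_kernel X (r - 1) t\<close> would provide r
      - 1 factors \<open>1 / n\<close> only. The r-th one comes from these differences, which are
      the integrals of that kernel.\<close>
    have Kb: "\<bar>peano_kernel X r t a - peano_kernel X r t b\<bar> \<le> 2 * M" if "a \<in> {-1..1}" "b \<in> {-1..1}" for a b
      using K[OF that(1)] K[OF that(2)] by linarith
    have "lagrange_error X f t = lagrange_error X (poly q) t + lagrange_error X (G (r - 1)) t"
    proof -
      have "(\<Sum>x\<in>X. f x * lagrange_basis X x t) = (\<Sum>x\<in>X. (poly q x + G (r - 1) x) * lagrange_basis X x t)"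
        using q(2) X(2) by (intro sum.cong) auto
      then show ?thesis using q(2)[OF t] by (simp add: lagrange_error_def distrib_right sum.distrib)
    qed
    also have "lagrange_error X (poly q) t = 0"
      by (rule lagrange_error_poly[OF X(1)]) (use q(1) n X(3) in auto)
    also have "lagrange_error X (G (r - 1)) t = integral {-1..1} (\<lambda>y. peano_kernel X (r - 1) t y * g y)"
    proof -
      have "((\<lambda>y. lagrange_error X (\<lambda>x. trunc_power (r - 1) x y * g y) t) has_integral
          lagrange_error X (G (r - 1)) t) {-1..1}"
        by (rule lagrange_error_has_integral[where S = UNIV]) (use X int in auto)
      moreover have "lagrange_error X (\<lambda>x. trunc_power (r - 1) x y * g y) t = peano_kernel X (r - 1) t y * g y" for y
        unfolding peano_kernel_def lagrange_error_def left_diff_distrib sum_distrib_right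
        by (simp add: mult.assoc mult.commute[of "g y"])
      ultimately show ?thesis by (simp add: integral_unique)
    qed
    finally have "\<bar>lagrange_error X f t\<bar> = \<bar>integral {-1..1} (\<lambda>y. peano_kernel X (r - 1) t y * g y)\<bar>" by simp
    also have "\<dots> \<le> C * (2 * M)"
    proof (rule C(3))
      show "peano_kernel X (r - 1) t integrable_on {-1..1}" using KI[of "-1" 1] by auto
      show "\<bar>integral {-1..c} (peano_kernel X (r - 1) t)\<bar> \<le> 2 * M" if "c \<in> {-1..1}" for c
        using integral_unique[OF KI[of "-1" c]] Kb[of "-1" c] that by simp
      show "\<bar>integral {c..1} (peano_kernel X (r - 1) t)\<bar> \<le> 2 * M" if "c \<in> {-1..1}" for c
        using integral_unique[OF KI[of c 1]] Kb[of c 1] that by simp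
    qed
    finally show ?thesis by (simp add: M_def mult_ac)
  qed
  have "C * 2 * A \<ge> 0" using C(1) A0 by simp
  then show thesis using main by (rule that)
qed

section \<open>The Jacobi differential equation\<close>

text \<open>A predicate on functions with their two derivatives rather than on polynomials, stable
  under \<open>x \<mapsto> - x\<close> with \<alpha> and \<beta> exchanged. Estimates near 1 thereby
  yield those near -1.\<close>

definition jacobi_ode :: "real \<Rightarrow> real \<Rightarrow> nat \<Rightarrow> (real \<Rightarrow> real) \<Rightarrow> (real \<Rightarrow> real) \<Rightarrow> (real \<Rightarrow> real) \<Rightarrow> bool" where
  "jacobi_ode \<alpha> \<beta> n y y1 y2 \<longleftrightarrow>
     (\<forall>x. (y has_real_derivative y1 x) (at x) \<and> (y1 has_real_derivative y2 x) (at x) \<and>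
          (1 - x\<^sup>2) * y2 x + (\<beta> - \<alpha> - (\<alpha> + \<beta> + 2) * x) * y1 x
            + real n * (real n + \<alpha> + \<beta> + 1) * y x = 0)"

definition jacobi_operator :: "real \<Rightarrow> real \<Rightarrow> real poly \<Rightarrow> real poly" where
  "jacobi_operator \<alpha> \<beta> p =
     pderiv (pderiv p) - pCons 0 (pCons 0 (pderiv (pderiv p)))
       + smult (\<beta> - \<alpha>) (pderiv p) - smult (\<alpha> + \<beta> + 2) (pCons 0 (pderiv p))"

lemma poly_jacobi_operator:
  "poly (jacobi_operator \<alpha> \<beta> p) x =
     (1 - x\<^sup>2) * poly (pderiv (pderiv p)) x + (\<beta> - \<alpha> - (\<alpha> + \<beta> + 2) * x) * poly (pderiv p) x"
  by (simp add: jacobi_operator_def algebra_simps power2_eq_square)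

text \<open>Only the coefficients of index i, i + 1 and i + 2 occur, so the operator does not raise
  the degree; its diagonal entries \<open>- i * (i + \<alpha> + \<beta> + 1)\<close> are the
  eigenvalues.\<close>

lemma coeff_jacobi_operator:
  "coeff (jacobi_operator \<alpha> \<beta> p) i =
     (real i + 1) * (real i + 2) * coeff p (i + 2) + (\<beta> - \<alpha>) * (real i + 1) * coeff p (i + 1)
       - real i * (real i + \<alpha> + \<beta> + 1) * coeff p i"
proof -
  have "coeff (pCons 0 (pderiv p)) i = real i * coeff p i"
    by (cases i) (simp_all add: coeff_pderiv)
  moreover have "coeff (pCons 0 (pCons 0 (pderiv (pderiv p)))) i = real i * (real i - 1) * coeff p i"
  proof (cases i)
    case (Suc j)
    then show ?thesis by (cases j) (simp_all add: coeff_pderiv algebra_simps)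
  qed simp
  ultimately show ?thesis
    unfolding jacobi_operator_def coeff_add coeff_diff coeff_smult
    by (simp add: coeff_pderiv algebra_simps)
qed

text \<open>The difference of the two integrands is the derivative of \<open>(1 - t) powr (\<alpha>
  + 1) * (1 + t) powr (\<beta> + 1) * (p' * q - p * q')\<close>, which vanishes at both end points
  because \<alpha> and \<beta> exceed -1.\<close>

lemma jacobi_operator_selfadjoint:
  assumes ab: "\<alpha> > -1" "\<beta> > -1"
  shows "integral {-1..1} (\<lambda>t. poly (jacobi_operator \<alpha> \<beta> p * q) t * jacobi_weight \<alpha> \<beta> t)
       = integral {-1..1} (\<lambda>t. poly (p * jacobi_operator \<alpha> \<beta> q) t * jacobi_weight \<alpha> \<beta> t)"
proof -
  define u where "u = pderiv p * q - p * pderiv q"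
  define h where "h t = (1 - t) powr (\<alpha> + 1) * (1 + t) powr (\<beta> + 1) * poly u t" for t
  define D where "D = jacobi_operator \<alpha> \<beta> p * q - p * jacobi_operator \<alpha> \<beta> q"
  have pd: "pderiv u = pderiv (pderiv p) * q - p * pderiv (pderiv q)"
    by (simp add: u_def pderiv_diff pderiv_mult)
  have "((\<lambda>t. poly D t * jacobi_weight \<alpha> \<beta> t) has_integral (h 1 - h (-1))) {-1..1}"
  proof (rule fundamental_theorem_of_calculus_interior)
    show "continuous_on {-1..1} h"
      unfolding h_def[abs_def] by (intro continuous_intros continuous_on_powr') (use ab in auto)
    fix t :: real assume t: "t \<in> {-1<..<1}"
    then have pos: "1 - t > 0" "1 + t > 0" by auto
    have d1: "((\<lambda>t. (1 - t) powr (\<alpha> + 1)) has_real_derivative (- (\<alpha> + 1) * (1 - t) powr \<alpha>)) (at t)"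
      using pos by (auto intro!: derivative_eq_intros simp: algebra_simps)
    have d2: "((\<lambda>t. (1 + t) powr (\<beta> + 1)) has_real_derivative ((\<beta> + 1) * (1 + t) powr \<beta>)) (at t)"
      using pos by (auto intro!: derivative_eq_intros)
    have p1: "(1 - t) powr (\<alpha> + 1) = (1 - t) * (1 - t) powr \<alpha>" "(1 + t) powr (\<beta> + 1) = (1 + t) * (1 + t) powr \<beta>"
      using pos by (simp_all add: powr_add)
    have "(h has_real_derivative
        (((- (\<alpha> + 1) * (1 - t) powr \<alpha>) * (1 + t) powr (\<beta> + 1) + (\<beta> + 1) * (1 + t) powr \<beta> * (1 - t) powr (\<alpha> + 1)) * poly u t
        + poly (pderiv u) t * ((1 - t) powr (\<alpha> + 1) * (1 + t) powr (\<beta> + 1)))) (at t)"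
      unfolding h_def[abs_def] by (intro DERIV_mult d1 d2 poly_DERIV)
    moreover have "((- (\<alpha> + 1) * (1 - t) powr \<alpha>) * (1 + t) powr (\<beta> + 1) + (\<beta> + 1) * (1 + t) powr \<beta> * (1 - t) powr (\<alpha> + 1)) * poly u t
        + poly (pderiv u) t * ((1 - t) powr (\<alpha> + 1) * (1 + t) powr (\<beta> + 1)) = poly D t * jacobi_weight \<alpha> \<beta> t"
      unfolding p1 pd unfolding D_def u_def jacobi_weight_def poly_diff poly_mult poly_jacobi_operator
      by (simp add: power2_eq_square algebra_simps)
    ultimately show "(h has_vector_derivative poly D t * jacobi_weight \<alpha> \<beta> t) (at t)"
      by (simp add: has_real_derivative_iff_has_vector_derivative)
  qed simp
  moreover have "h 1 = 0" "h (-1) = 0" by (simp_all add: h_def)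
  ultimately have "integral {-1..1} (\<lambda>t. poly D t * jacobi_weight \<alpha> \<beta> t) = 0"
    by (simp add: integral_unique)
  then show ?thesis
    using integral_diff[OF poly_jacobi_weight_integrable[OF ab, of "jacobi_operator \<alpha> \<beta> p * q"]
        poly_jacobi_weight_integrable[OF ab, of "p * jacobi_operator \<alpha> \<beta> q"]]
    by (simp add: D_def left_diff_distrib)
qed

text \<open>With L the Jacobi operator, \<open>R = L P + c P\<close> has degree below n, since c
  cancels the leading coefficient. If nonzero, it is orthogonal to itself: P is orthogonal to R, and
  by self-adjointness so is \<open>L P\<close>, because \<open>L R\<close> has degree below n as
  well.\<close>

lemma jacobi_poly_ode:
  assumes ab: "\<alpha> > -1" "\<beta> > -1"
  shows "jacobi_ode \<alpha> \<beta> n (poly (jacobi_poly \<alpha> \<beta> n)) (poly (pderiv (jacobi_poly \<alpha> \<beta> n)))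
    (poly (pderiv (pderiv (jacobi_poly \<alpha> \<beta> n))))"
proof -
  define P where "P = jacobi_poly \<alpha> \<beta> n"
  define I where "I p = integral {-1..1} (\<lambda>t. poly p t * jacobi_weight \<alpha> \<beta> t)" for p
  have P: "degree P = n" "\<And>q. degree q < n \<Longrightarrow> I (P * q) = 0"
    using is_jacobi_poly_jacobi_poly[OF ab, of n] by (auto simp: is_jacobi_poly_def P_def I_def)
  define c where "c = real n * (real n + \<alpha> + \<beta> + 1)"
  define R where "R = jacobi_operator \<alpha> \<beta> P + smult c P"
  have cR: "coeff R i = 0" if "i \<ge> n" for i
  proof -
    have "coeff P (i + 1) = 0" "coeff P (i + 2) = 0" using that P(1) by (auto intro: coeff_eq_0)
    moreover have "coeff P i = 0" if "i > n" using that P(1) by (auto intro: coeff_eq_0)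
    ultimately show ?thesis using that by (cases "i = n") (auto simp: R_def c_def coeff_jacobi_operator)
  qed
  have "R = 0"
  proof (rule ccontr)
    assume R0: "R \<noteq> 0"
    have dR: "degree R < n"
      using cR R0 leading_coeff_neq_0 by (metis not_less)
    have "degree (jacobi_operator \<alpha> \<beta> R) \<le> degree R"
      by (rule degree_le) (auto simp: coeff_jacobi_operator coeff_eq_0)
    then have "I (P * jacobi_operator \<alpha> \<beta> R) = 0" using P(2) dR by simp
    then have "I (jacobi_operator \<alpha> \<beta> P * R) = 0"
      using jacobi_operator_selfadjoint[OF ab] by (simp add: I_def)
    moreover have "I (R * R) = I (jacobi_operator \<alpha> \<beta> P * R) + c * I (P * R)"
    proof -
      have "I (R * R) = integral {-1..1} (\<lambda>t. poly (jacobi_operator \<alpha> \<beta> P * R) t * jacobi_weight \<alpha> \<beta> t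
          + c * (poly (P * R) t * jacobi_weight \<alpha> \<beta> t))"
        unfolding I_def by (rule integral_cong) (simp add: R_def algebra_simps)
      also have "\<dots> = I (jacobi_operator \<alpha> \<beta> P * R) + c * I (P * R)"
        unfolding I_def
        by (subst integral_add) (auto intro!: poly_jacobi_weight_integrable ab integrable_on_mult_right simp del: poly_mult)
      finally show ?thesis .
    qed
    ultimately have "I (R * R) = 0" using P(2)[OF dR] by simp
    moreover have "I (R * R) > 0"
      unfolding I_def by (rule jacobi_integral_pos[OF ab]) (use R0 in auto)
    ultimately show False by simp
  qed
  then have "poly R x = 0" for x by simp
  then show ?thesis
    unfolding jacobi_ode_def P_def[symmetric]
    by (auto simp: R_def poly_jacobi_operator c_def intro: poly_DERIV)
qed

lemma jacobi_ode_reflect: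
  assumes "jacobi_ode \<alpha> \<beta> n y y1 y2"
  shows "jacobi_ode \<beta> \<alpha> n (\<lambda>x. y (- x)) (\<lambda>x. - y1 (- x)) (\<lambda>x. y2 (- x))"
  unfolding jacobi_ode_def
proof (intro allI conjI)
  fix x :: real
  have o: "(y has_real_derivative y1 (- x)) (at (- x))" "(y1 has_real_derivative y2 (- x)) (at (- x))"
    "(1 - x\<^sup>2) * y2 (- x) + (\<beta> - \<alpha> - (\<alpha> + \<beta> + 2) * (- x)) * y1 (- x)
            + real n * (real n + \<alpha> + \<beta> + 1) * y (- x) = 0"
    using assms[unfolded jacobi_ode_def, rule_format, of "- x"] by auto
  have m: "((\<lambda>x. - x) has_real_derivative - 1) (at x)" by (auto intro!: derivative_eq_intros)
  show "((\<lambda>x. y (- x)) has_real_derivative - y1 (- x)) (at x)"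
    using DERIV_chain2[OF o(1) m] by simp
  show "((\<lambda>x. - y1 (- x)) has_real_derivative y2 (- x)) (at x)"
    using DERIV_minus[OF DERIV_chain2[OF o(2) m]] by simp
  show "(1 - x\<^sup>2) * y2 (- x) + (\<alpha> - \<beta> - (\<beta> + \<alpha> + 2) * x) * - y1 (- x)
     + real n * (real n + \<beta> + \<alpha> + 1) * y (- x) = 0"
    using o(3) by (simp add: algebra_simps)
qed

section \<open>Energy estimates\<close>

text \<open>The frequency N of the normal form \<open>u'' + (N^2 + W) u = 0\<close> in the angle,
  where W depends on \<alpha>, \<beta> and the angle but not on n.\<close>

definition jacobi_shift :: "real \<Rightarrow> real \<Rightarrow> nat \<Rightarrow> real" where
  "jacobi_shift \<alpha> \<beta> n = real n + (\<alpha> + \<beta> + 1) / 2"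

text \<open>With \<open>a = \<alpha> + 1/2\<close>, \<open>b = \<beta> + 1/2\<close>, \<open>\<mu>\<close> is the logarithmic derivative of
  \<open>(1 - x)\<^bsup>a/2\<^esup> (1 + x)\<^bsup>b/2\<^esup>\<close>, and \<open>jacobi_energy\<close> is \<open>u\<^sup>2 + u'(\<theta>)\<^sup>2 / N\<^sup>2\<close> for the Liouville form
  \<open>u(\<theta>) = (1 - x)\<^bsup>a/2\<^esup> (1 + x)\<^bsup>b/2\<^esup> y(x)\<close>, \<open>x = cos \<theta>\<close>.\<close>

definition liouville_mu :: "real \<Rightarrow> real \<Rightarrow> real \<Rightarrow> real" where
  "liouville_mu \<alpha> \<beta> x = (\<beta> + 1/2) / (2 * (1 + x)) - (\<alpha> + 1/2) / (2 * (1 - x))"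

definition jacobi_energy :: "real \<Rightarrow> real \<Rightarrow> nat \<Rightarrow> (real \<Rightarrow> real) \<Rightarrow> (real \<Rightarrow> real) \<Rightarrow> real \<Rightarrow> real" where
  "jacobi_energy \<alpha> \<beta> n y y1 x =
     (1 - x) powr (\<alpha> + 1/2) * (1 + x) powr (\<beta> + 1/2) *
       ((y x)\<^sup>2 + (1 - x\<^sup>2) * (liouville_mu \<alpha> \<beta> x * y x + y1 x)\<^sup>2 / (jacobi_shift \<alpha> \<beta> n)\<^sup>2)"

text \<open>A bound for \<open>(1 - x\<^sup>2) * \<bar>W\<bar> / 2\<close>, where W measures the
  deviation of the normal form from a harmonic oscillator. It is 0 for parameters of modulus 1/2,
  the Chebyshev cases, in which the energy is constant.\<close>

definition liouville_defect :: "real \<Rightarrow> real \<Rightarrow> real" where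
  "liouville_defect \<alpha> \<beta> = \<bar>1/4 - \<alpha>\<^sup>2\<bar> / 2 + \<bar>1/4 - \<beta>\<^sup>2\<bar> / 2"

lemma jacobi_shift_pos:
  assumes "\<alpha> > -1" "\<beta> > -1" "n \<ge> 1"
  shows "jacobi_shift \<alpha> \<beta> n > 1/2"
proof -
  have "real n \<ge> 1" using assms(3) by simp
  then show ?thesis using assms(1,2) by (simp add: jacobi_shift_def add_divide_distrib)
qed

text \<open>The normal form \<open>u'' + N^2 u = - W u\<close>, divided by the weight of the
  Liouville form and written in x. The derivative of u in the angle is
  \<open>- sqrt (1 - x^2)\<close> times the weight times \<open>\<mu> y + y'\<close>;
  differentiating once more produces the factors \<open>\<mu> (1 - x^2) - x\<close> and
  \<open>1 - x^2\<close>.\<close>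

lemma liouville_identity:
  fixes x :: real
  assumes x: "1 - x \<noteq> 0" "1 + x \<noteq> 0"
    and ode: "(1 - x\<^sup>2) * Y2 + (\<beta> - \<alpha> - (\<alpha> + \<beta> + 2) * x) * Y1 + real n * (real n + \<alpha> + \<beta> + 1) * Y = 0"
  shows "(jacobi_shift \<alpha> \<beta> n)\<^sup>2 * Y + (liouville_mu \<alpha> \<beta> x * (1 - x\<^sup>2) - x) * (liouville_mu \<alpha> \<beta> x * Y + Y1)
    + (1 - x\<^sup>2) * ((- (\<beta> + 1/2) / (2 * (1 + x)\<^sup>2) - (\<alpha> + 1/2) / (2 * (1 - x)\<^sup>2)) * Y + liouville_mu \<alpha> \<beta> x * Y1 + Y2)
    = - Y * ((1/4 - \<alpha>\<^sup>2) / (2 * (1 - x)) + (1/4 - \<beta>\<^sup>2) / (2 * (1 + x)))"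
proof -
  define p q where "p = 1 - x" and "q = 1 + x"
  have pq: "p \<noteq> 0" "q \<noteq> 0" "x = (q - p) / 2" "1 - x\<^sup>2 = p * q" "p + q = 2" "x = 1 - p" "x = q - 1"
    using x by (auto simp: p_def q_def power2_eq_square algebra_simps)
  define a b where "a = \<alpha> + 1/2" and "b = \<beta> + 1/2"
  define \<mu> where "\<mu> = liouville_mu \<alpha> \<beta> x"
  define l where "l = real n * (real n + \<alpha> + \<beta> + 1)"
  have \<mu>: "\<mu> = b / (2 * q) - a / (2 * p)" by (simp add: \<mu>_def liouville_mu_def a_def b_def p_def q_def)
  have mpq: "2 * \<mu> * (1 - x\<^sup>2) = b * p - a * q"
    unfolding \<mu> pq(4) using pq(1,2) by (simp add: field_simps)
  \<comment> \<open>The coefficient of Y1 agrees with that of the differential equation: the weight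
    is the one that removes the first-order term.\<close>
  have c1: "\<mu> * (1 - x\<^sup>2) - x + (1 - x\<^sup>2) * \<mu> = \<beta> - \<alpha> - (\<alpha> + \<beta> + 2) * x"
    using mpq by (simp add: a_def b_def p_def q_def field_simps)
  \<comment> \<open>The coefficient of Y. The degree n drops out because \<open>N\<^sup>2\<close>
    exceeds the eigenvalue l by the constant \<open>((a + b) / 2)\<^sup>2\<close>.\<close>
  have c0: "(jacobi_shift \<alpha> \<beta> n)\<^sup>2 - l + (\<mu> * (1 - x\<^sup>2) - x) * \<mu> + (1 - x\<^sup>2) * (- b / (2 * q\<^sup>2) - a / (2 * p\<^sup>2))
      = - ((1/4 - \<alpha>\<^sup>2) / (2 * p) + (1/4 - \<beta>\<^sup>2) / (2 * q))"
  proof -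
    have e1: "(jacobi_shift \<alpha> \<beta> n)\<^sup>2 - l = (a + b)\<^sup>2 / 4"
      by (simp add: jacobi_shift_def l_def a_def b_def power2_eq_square field_simps)
    have e2: "\<mu> * (1 - x\<^sup>2) - x = (b + 1) * p / 2 - (a + 1) * q / 2"
    proof -
      have S: "\<mu> * (1 - x\<^sup>2) = (b * p - a * q) / 2" 
      proof -
        have "2 * s = t \<Longrightarrow> s = t / 2" for s t :: real by simp
        then show ?thesis using mpq[unfolded mult.assoc] by blast
      qed
      show ?thesis unfolding S using pq(3) by (simp add: field_simps)
    qed
    have e4: "(1/4 - \<alpha>\<^sup>2) = a - a\<^sup>2" "(1/4 - \<beta>\<^sup>2) = b - b\<^sup>2"
      by (simp_all add: a_def b_def power2_eq_square field_simps)
    have e5: "(a + b)\<^sup>2 / 4 + ((b + 1) * p / 2 - (a + 1) * q / 2) * (b / (2 * q) - a / (2 * p)) + p * q * (- b / (2 * q\<^sup>2) - a / (2 * p\<^sup>2))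
       = - ((a - a\<^sup>2) / (2 * p) + (b - b\<^sup>2) / (2 * q))"
    proof -
      have "(a + b)\<^sup>2 * (p * q) + ((b + 1) * p - (a + 1) * q) * (b * p - a * q) - 2 * b * p\<^sup>2 - 2 * a * q\<^sup>2
          = - ((p + q) * ((a - a\<^sup>2) * q + (b - b\<^sup>2) * p))"
        by (simp add: power2_eq_square algebra_simps)
      also have "\<dots> = - (2 * ((a - a\<^sup>2) * q + (b - b\<^sup>2) * p))" unfolding pq(5) ..
      finally have id: "(a + b)\<^sup>2 * (p * q) + ((b + 1) * p - (a + 1) * q) * (b * p - a * q) - 2 * b * p\<^sup>2 - 2 * a * q\<^sup>2
          = - (2 * ((a - a\<^sup>2) * q + (b - b\<^sup>2) * p))" .
      have "(a + b)\<^sup>2 / 4 + ((b + 1) * p / 2 - (a + 1) * q / 2) * (b / (2 * q) - a / (2 * p)) + p * q * (- b / (2 * q\<^sup>2) - a / (2 * p\<^sup>2))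
        = ((a + b)\<^sup>2 * (p * q) + ((b + 1) * p - (a + 1) * q) * (b * p - a * q) - 2 * b * p\<^sup>2 - 2 * a * q\<^sup>2) / (4 * p * q)"
        using pq(1,2) by (simp add: field_simps power2_eq_square)
      also have "\<dots> = - ((a - a\<^sup>2) / (2 * p) + (b - b\<^sup>2) / (2 * q))"
        unfolding id using pq(1,2) by (simp add: field_simps)
      finally show ?thesis .
    qed
    show ?thesis unfolding e1 e2 e4 unfolding \<mu> pq(4) by (rule e5)
  qed
  have "(1 - x\<^sup>2) * Y2 = - (\<beta> - \<alpha> - (\<alpha> + \<beta> + 2) * x) * Y1 - l * Y" using ode by (simp add: l_def algebra_simps)
  then have "(jacobi_shift \<alpha> \<beta> n)\<^sup>2 * Y + (\<mu> * (1 - x\<^sup>2) - x) * (\<mu> * Y + Y1)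
    + (1 - x\<^sup>2) * ((- b / (2 * q\<^sup>2) - a / (2 * p\<^sup>2)) * Y + \<mu> * Y1 + Y2)
    = ((jacobi_shift \<alpha> \<beta> n)\<^sup>2 - l + (\<mu> * (1 - x\<^sup>2) - x) * \<mu> + (1 - x\<^sup>2) * (- b / (2 * q\<^sup>2) - a / (2 * p\<^sup>2))) * Y
      + (\<mu> * (1 - x\<^sup>2) - x + (1 - x\<^sup>2) * \<mu> - (\<beta> - \<alpha> - (\<alpha> + \<beta> + 2) * x)) * Y1"
    by (simp only: distrib_left distrib_right left_diff_distrib right_diff_distrib mult_minus_left mult.assoc)
  also have "\<dots> = - Y * ((1/4 - \<alpha>\<^sup>2) / (2 * p) + (1/4 - \<beta>\<^sup>2) / (2 * q))"
    unfolding c1 c0 by (simp only: mult_minus_left mult.commute diff_self mult_zero_left add_0_right mult_zero_right)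
  finally show ?thesis unfolding \<mu>_def a_def b_def p_def q_def .
qed

text \<open>In the angle, \<open>u^2 + u'^2 / N^2\<close> has derivative
  \<open>2 u' (u + u'' / N^2)\<close>, and by the normal form this is
  \<open>- 2 W u u' / N^2\<close>: the main oscillation cancels and only the defect remains.\<close>

lemma jacobi_energy_deriv:
  assumes ode: "jacobi_ode \<alpha> \<beta> n y y1 y2" and x: "-1 < x" "x < 1" and N: "jacobi_shift \<alpha> \<beta> n \<noteq> 0"
  shows "(jacobi_energy \<alpha> \<beta> n y y1 has_real_derivative
    - 2 / (jacobi_shift \<alpha> \<beta> n)\<^sup>2 * ((1 - x) powr (\<alpha> + 1/2) * (1 + x) powr (\<beta> + 1/2)) * y x
      * (liouville_mu \<alpha> \<beta> x * y x + y1 x)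
      * ((1/4 - \<alpha>\<^sup>2) / (2 * (1 - x)) + (1/4 - \<beta>\<^sup>2) / (2 * (1 + x)))) (at x)"
proof -
  have pos: "1 - x > 0" "1 + x > 0" using x by auto
  define N2 where "N2 = (jacobi_shift \<alpha> \<beta> n)\<^sup>2"
  have N20: "N2 \<noteq> 0" using N by (simp add: N2_def)
  define a b where "a = \<alpha> + 1/2" and "b = \<beta> + 1/2"
  define \<mu> where "\<mu> = liouville_mu \<alpha> \<beta>"
  define \<mu>' where "\<mu>' = - b / (2 * (1 + x)\<^sup>2) - a / (2 * (1 - x)\<^sup>2)"
  define m where "m = (1 - x) powr a * (1 + x) powr b"
  define v where "v = \<mu> x * y x + y1 x"
  define W where "W = (1/4 - \<alpha>\<^sup>2) / (2 * (1 - x)) + (1/4 - \<beta>\<^sup>2) / (2 * (1 + x))"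
  have dy: "(y has_real_derivative y1 x) (at x)" "(y1 has_real_derivative y2 x) (at x)"
    and eq: "(1 - x\<^sup>2) * y2 x + (\<beta> - \<alpha> - (\<alpha> + \<beta> + 2) * x) * y1 x + real n * (real n + \<alpha> + \<beta> + 1) * y x = 0"
    using ode by (auto simp: jacobi_ode_def)
  have dm1: "((\<lambda>x. (1 - x) powr a) has_real_derivative (- a / (1 - x)) * (1 - x) powr a) (at x)"
    using pos by (auto intro!: derivative_eq_intros simp: powr_diff field_simps)
  have dm2: "((\<lambda>x. (1 + x) powr b) has_real_derivative (b / (1 + x)) * (1 + x) powr b) (at x)"
    using pos by (auto intro!: derivative_eq_intros simp: powr_diff field_simps)
  have "((\<lambda>x. (1 - x) powr a * (1 + x) powr b) has_real_derivative
      (- a / (1 - x)) * (1 - x) powr a * (1 + x) powr b + (b / (1 + x)) * (1 + x) powr b * (1 - x) powr a) (at x)"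
    by (rule DERIV_mult[OF dm1 dm2])
  moreover have "(- a / (1 - x)) * (1 - x) powr a * (1 + x) powr b + (b / (1 + x)) * (1 + x) powr b * (1 - x) powr a
      = 2 * \<mu> x * m"
  proof -
    have "2 * \<mu> x = b / (1 + x) - a / (1 - x)"
    proof -
      have e: "2 * (c / (2 * d)) = c / d" for c d :: real by simp
      have "2 * (c - d) = 2 * c - 2 * d" for c d :: real by simp
      from this[of "b / (2 * (1 + x))" "a / (2 * (1 - x))"] show ?thesis
        unfolding e \<mu>_def liouville_mu_def a_def[symmetric] b_def[symmetric] .
    qed
    moreover have "(- a / P) * A * B + (b / Q) * B * A = (b / Q - a / P) * (A * B)" for A B P Q :: real
      by (simp add: algebra_simps)
    ultimately show ?thesis unfolding m_def by simp
  qed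
  ultimately have dm: "((\<lambda>x. (1 - x) powr a * (1 + x) powr b) has_real_derivative 2 * \<mu> x * m) (at x)" by simp
  have d\<mu>: "(\<mu> has_real_derivative \<mu>') (at x)"
    unfolding \<mu>_def liouville_mu_def[abs_def] a_def[symmetric] b_def[symmetric] \<mu>'_def
  proof -
    have "((\<lambda>x. b / (2 * (1 + x))) has_real_derivative (0 * (2 * (1 + x)) - b * 2) / ((2 * (1 + x)) * (2 * (1 + x)))) (at x)"
      "((\<lambda>x. a / (2 * (1 - x))) has_real_derivative (0 * (2 * (1 - x)) - a * (- 2)) / ((2 * (1 - x)) * (2 * (1 - x)))) (at x)"
      using pos by (auto intro!: derivative_eq_intros)
    from DERIV_diff[OF this]
    have "((\<lambda>x. b / (2 * (1 + x)) - a / (2 * (1 - x))) has_real_derivative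
       (0 * (2 * (1 + x)) - b * 2) / ((2 * (1 + x)) * (2 * (1 + x))) - (0 * (2 * (1 - x)) - a * (- 2)) / ((2 * (1 - x)) * (2 * (1 - x)))) (at x)" .
    moreover have "(0 * (2 * P) - b * 2) / ((2 * P) * (2 * P)) - (0 * (2 * Q) - a * (- 2)) / ((2 * Q) * (2 * Q))
        = - b / (2 * P\<^sup>2) - a / (2 * Q\<^sup>2)" for P Q :: real
      by (simp add: power2_eq_square)
    ultimately show "((\<lambda>x. b / (2 * (1 + x)) - a / (2 * (1 - x))) has_real_derivative - b / (2 * (1 + x)\<^sup>2) - a / (2 * (1 - x)\<^sup>2)) (at x)"
      by metis
  qed
  have dv: "((\<lambda>x. \<mu> x * y x + y1 x) has_real_derivative \<mu>' * y x + \<mu> x * y1 x + y2 x) (at x)"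
    using d\<mu> dy by (auto intro!: derivative_eq_intros)
  have dE: "((\<lambda>x. (y x)\<^sup>2 + (1 - x\<^sup>2) * (\<mu> x * y x + y1 x)\<^sup>2 / N2) has_real_derivative
      2 * y x * y1 x + ((1 - x\<^sup>2) * (2 * v * (\<mu>' * y x + \<mu> x * y1 x + y2 x)) - 2 * x * v\<^sup>2) / N2) (at x)"
  proof -
    define V where "V = (\<lambda>x. \<mu> x * y x + y1 x)"
    define V' where "V' = \<mu>' * y x + \<mu> x * y1 x + y2 x"
    have dV: "(V has_real_derivative V') (at x)" using dv by (simp add: V_def V'_def)
    have "((\<lambda>x. (y x)\<^sup>2 + (1 - x\<^sup>2) * (V x)\<^sup>2 / N2) has_real_derivative
        2 * y x * y1 x + ((1 - x\<^sup>2) * (2 * V x * V') - 2 * x * (V x)\<^sup>2) / N2) (at x)"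
      using dy(1) dV N20 by (auto intro!: derivative_eq_intros simp: field_simps)
    then show ?thesis by (simp add: V_def V'_def v_def)
  qed
  have "((\<lambda>x. (1 - x) powr a * (1 + x) powr b * ((y x)\<^sup>2 + (1 - x\<^sup>2) * (\<mu> x * y x + y1 x)\<^sup>2 / N2)) has_real_derivative
      (2 * \<mu> x * m) * ((y x)\<^sup>2 + (1 - x\<^sup>2) * v\<^sup>2 / N2)
      + (2 * y x * y1 x + ((1 - x\<^sup>2) * (2 * v * (\<mu>' * y x + \<mu> x * y1 x + y2 x)) - 2 * x * v\<^sup>2) / N2) * m) (at x)"
    unfolding v_def m_def using DERIV_mult[OF dm dE] by (simp add: m_def v_def)
  moreover have "(2 * \<mu> x * m) * ((y x)\<^sup>2 + (1 - x\<^sup>2) * v\<^sup>2 / N2)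
      + (2 * y x * y1 x + ((1 - x\<^sup>2) * (2 * v * (\<mu>' * y x + \<mu> x * y1 x + y2 x)) - 2 * x * v\<^sup>2) / N2) * m
     = 2 / N2 * m * v * (N2 * y x + (\<mu> x * (1 - x\<^sup>2) - x) * v + (1 - x\<^sup>2) * (\<mu>' * y x + \<mu> x * y1 x + y2 x))"
  proof -
    \<comment> \<open>After this substitution \<open>\<mu> * y\<^sup>2 + y * y1\<close> becomes
      \<open>y * v\<close>, so that v factors out of the whole expression.\<close>
    have y1: "y1 x = v - \<mu> x * y x" by (simp add: v_def)
    define z where "z = \<mu>' * y x + \<mu> x * y1 x + y2 x"
    define s where "s = 1 - x\<^sup>2"
    show ?thesis unfolding z_def[symmetric] s_def[symmetric] unfolding y1 using N20
      by (simp add: field_simps power2_eq_square)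
  qed
  moreover have "N2 * y x + (\<mu> x * (1 - x\<^sup>2) - x) * v + (1 - x\<^sup>2) * (\<mu>' * y x + \<mu> x * y1 x + y2 x) = - y x * W"
    using liouville_identity[OF _ _ eq] pos
    by (simp add: N2_def \<mu>_def \<mu>'_def a_def b_def v_def W_def)
  ultimately have "((\<lambda>x. (1 - x) powr a * (1 + x) powr b * ((y x)\<^sup>2 + (1 - x\<^sup>2) * (\<mu> x * y x + y1 x)\<^sup>2 / N2))
      has_real_derivative 2 / N2 * m * v * (- y x * W)) (at x)" by simp
  then show ?thesis
    unfolding jacobi_energy_def[abs_def] a_def[symmetric] b_def[symmetric] N2_def[symmetric] \<mu>_def[symmetric]
      m_def[symmetric] v_def[symmetric] W_def[symmetric]
    by (simp add: mult_ac)
qed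

lemma jacobi_energy_nonneg:
  assumes "-1 \<le> x" "x \<le> 1"
  shows "jacobi_energy \<alpha> \<beta> n y y1 x \<ge> 0"
proof -
  have "1 - x\<^sup>2 \<ge> 0" using assms by (simp add: abs_square_le_1)
  then show ?thesis unfolding jacobi_energy_def
    by (intro mult_nonneg_nonneg add_nonneg_nonneg divide_nonneg_nonneg) auto
qed

text \<open>By the inequality of arithmetic and geometric means the product u u' is at most N / 2
  times the energy. This spends one factor of \<open>1 / N^2\<close>, and the logarithmic derivative
  of the energy remains O(1 / N).\<close>

lemma jacobi_energy_deriv_bound:
  assumes ode: "jacobi_ode \<alpha> \<beta> n y y1 y2" and x: "-1 < x" "x < 1" and N: "jacobi_shift \<alpha> \<beta> n > 0"
  obtains D where "(jacobi_energy \<alpha> \<beta> n y y1 has_real_derivative D) (at x)"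
    "\<bar>D\<bar> \<le> liouville_defect \<alpha> \<beta> / jacobi_shift \<alpha> \<beta> n * (2 / (sqrt (1 - x\<^sup>2)) ^ 3) * jacobi_energy \<alpha> \<beta> n y y1 x"
proof -
  define N where "N = jacobi_shift \<alpha> \<beta> n"
  define K where "K = liouville_defect \<alpha> \<beta>"
  define s where "s = sqrt (1 - x\<^sup>2)"
  define m where "m = (1 - x) powr (\<alpha> + 1/2) * (1 + x) powr (\<beta> + 1/2)"
  define v where "v = liouville_mu \<alpha> \<beta> x * y x + y1 x"
  define W where "W = (1/4 - \<alpha>\<^sup>2) / (2 * (1 - x)) + (1/4 - \<beta>\<^sup>2) / (2 * (1 + x))"
  have N0: "N > 0" using N by (simp add: N_def)
  have pos: "1 - x > 0" "1 + x > 0" using x by auto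
  have pq: "1 - x\<^sup>2 = (1 - x) * (1 + x)" by (simp add: power2_eq_square algebra_simps)
  then have s2: "s\<^sup>2 = (1 - x) * (1 + x)" and s0: "s > 0" using pos by (simp_all add: s_def)
  have E: "jacobi_energy \<alpha> \<beta> n y y1 x = m * ((y x)\<^sup>2 + s\<^sup>2 * v\<^sup>2 / N\<^sup>2)"
    by (simp add: jacobi_energy_def m_def v_def N_def s2 pq)
  have m0: "m \<ge> 0" by (simp add: m_def)
  have W: "\<bar>W\<bar> \<le> K * (2 / s\<^sup>2)"
  proof -
    have "\<bar>W\<bar> \<le> \<bar>1/4 - \<alpha>\<^sup>2\<bar> / 2 * (1 / (1 - x)) + \<bar>1/4 - \<beta>\<^sup>2\<bar> / 2 * (1 / (1 + x))"
      unfolding W_def using pos by (intro order_trans[OF abs_triangle_ineq]) (simp add: abs_mult)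
    also have "\<dots> \<le> \<bar>1/4 - \<alpha>\<^sup>2\<bar> / 2 * (2 / s\<^sup>2) + \<bar>1/4 - \<beta>\<^sup>2\<bar> / 2 * (2 / s\<^sup>2)"
    proof -
      have "1 / (1 - x) = (1 + x) / s\<^sup>2" "1 / (1 + x) = (1 - x) / s\<^sup>2"
        unfolding s2 using pos by simp_all
      then have "1 / (1 - x) \<le> 2 / s\<^sup>2" "1 / (1 + x) \<le> 2 / s\<^sup>2"
        using x by (auto intro: divide_right_mono)
      then show ?thesis by (intro add_mono mult_left_mono) auto
    qed
    finally show ?thesis unfolding K_def liouville_defect_def distrib_right .
  qed
  have amgm: "2 * \<bar>y x\<bar> * \<bar>v\<bar> \<le> N / s * ((y x)\<^sup>2 + s\<^sup>2 * v\<^sup>2 / N\<^sup>2)"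
  proof -
    have "0 \<le> (\<bar>y x\<bar> - s * \<bar>v\<bar> / N)\<^sup>2" by simp
    then have "2 * \<bar>y x\<bar> * (s * \<bar>v\<bar> / N) \<le> (y x)\<^sup>2 + s\<^sup>2 * v\<^sup>2 / N\<^sup>2"
      by (simp add: power2_diff power_divide power_mult_distrib)
    then have "N / s * (2 * \<bar>y x\<bar> * (s * \<bar>v\<bar> / N)) \<le> N / s * ((y x)\<^sup>2 + s\<^sup>2 * v\<^sup>2 / N\<^sup>2)"
      using N0 s0 by (intro mult_left_mono) auto
    moreover have "N / s * (2 * \<bar>y x\<bar> * (s * \<bar>v\<bar> / N)) = 2 * \<bar>y x\<bar> * \<bar>v\<bar>"
      using N0 s0 by simp
    ultimately show ?thesis by simp
  qed
  define D where "D = - 2 / N\<^sup>2 * m * y x * v * W"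
  have "(jacobi_energy \<alpha> \<beta> n y y1 has_real_derivative D) (at x)"
    using jacobi_energy_deriv[OF ode x] N0 unfolding D_def N_def m_def v_def W_def by simp
  moreover have "\<bar>D\<bar> \<le> K / N * (2 / s ^ 3) * jacobi_energy \<alpha> \<beta> n y y1 x"
  proof -
    have "\<bar>D\<bar> = 1 / N\<^sup>2 * m * (2 * \<bar>y x\<bar> * \<bar>v\<bar>) * \<bar>W\<bar>"
      using m0 by (simp add: D_def abs_mult)
    also have "\<dots> \<le> 1 / N\<^sup>2 * m * (N / s * ((y x)\<^sup>2 + s\<^sup>2 * v\<^sup>2 / N\<^sup>2)) * (K * (2 / s\<^sup>2))"
      by (rule mult_mono[OF mult_left_mono[OF amgm] W])
        (use m0 N0 s0 in \<open>auto intro!: mult_nonneg_nonneg add_nonneg_nonneg\<close>)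
    also have "\<dots> = K / N * (2 / s ^ 3) * jacobi_energy \<alpha> \<beta> n y y1 x"
    proof -
      have "1 / N\<^sup>2 * m * (N / s * e) * (K * (2 / s\<^sup>2)) = K / N * (2 / s ^ 3) * (m * e)" for e
        using N0 s0 by (simp add: power2_eq_square power3_eq_cube mult_ac)
      then show ?thesis unfolding E .
    qed
    finally show ?thesis .
  qed
  ultimately show ?thesis using that by (simp add: N_def K_def s_def)
qed

text \<open>Gronwall with \<open>2 x / sqrt (1 - x\<^sup>2)\<close>, an antiderivative of the logarithmic growth rate.\<close>

lemma jacobi_energy_compare:
  assumes ode: "jacobi_ode \<alpha> \<beta> n y y1 y2" and N: "jacobi_shift \<alpha> \<beta> n > 0"
    and e: "e > 0" "1 - x\<^sup>2 \<ge> e" "1 - z\<^sup>2 \<ge> e"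
  shows "jacobi_energy \<alpha> \<beta> n y y1 x \<le>
    exp (4 * liouville_defect \<alpha> \<beta> / (jacobi_shift \<alpha> \<beta> n * sqrt e)) * jacobi_energy \<alpha> \<beta> n y y1 z"
proof -
  define N where "N = jacobi_shift \<alpha> \<beta> n"
  define \<kappa> where "\<kappa> = liouville_defect \<alpha> \<beta> / N"
  define G where "G = jacobi_energy \<alpha> \<beta> n y y1"
  define D where "D x = 2 * x / sqrt (1 - x\<^sup>2)" for x :: real
  have N0: "N > 0" using N by (simp add: N_def)
  have \<kappa>0: "\<kappa> \<ge> 0" using N0 by (simp add: \<kappa>_def liouville_defect_def)
  have in1: "-1 < u \<and> u < 1" if "1 - u\<^sup>2 \<ge> e" for u
  proof -
    have "u\<^sup>2 < 1" using that e(1) by linarith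
    then have "\<bar>u\<bar> < 1" by (simp add: abs_square_less_1)
    then show ?thesis by auto
  qed
  have dD: "(D has_real_derivative 2 / (sqrt (1 - u\<^sup>2)) ^ 3) (at u)" if "-1 < u" "u < 1" for u
  proof -
    have "1 - u\<^sup>2 > 0" using that by (simp add: abs_square_less_1)
    define s where "s = sqrt (1 - u\<^sup>2)"
    have s: "s > 0" "s\<^sup>2 = 1 - u\<^sup>2" using \<open>1 - u\<^sup>2 > 0\<close> by (auto simp: s_def)
    have "((\<lambda>x. 2 * x / sqrt (1 - x\<^sup>2)) has_real_derivative
        (2 * s - 2 * u * (- 2 * u * (inverse s / 2))) / (s * s)) (at u)"
      unfolding s_def using \<open>1 - u\<^sup>2 > 0\<close> by (auto intro!: derivative_eq_intros)
    moreover have "(2 * s - 2 * u * (- 2 * u * (inverse s / 2))) / (s * s) = 2 / s ^ 3"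
    proof -
      have "(2 * s - 2 * u * (- 2 * u * (inverse s / 2))) = (2 * s\<^sup>2 + 2 * u\<^sup>2) / s"
        using s(1) by (simp add: field_simps power2_eq_square)
      then show ?thesis using s by (simp add: power3_eq_cube)
    qed
    ultimately show ?thesis unfolding D_def[abs_def] s_def by simp
  qed
  \<comment> \<open>Gronwall in both directions: \<open>\<sigma> = 1\<close> says that
    \<open>G * exp (\<kappa> * D)\<close> is nondecreasing, \<open>\<sigma> = -1\<close> that
    \<open>G * exp (- \<kappa> * D)\<close> is nonincreasing.\<close>
  have mono: "\<sigma> * (G u * exp (\<sigma> * \<kappa> * D u)) \<le> \<sigma> * (G w * exp (\<sigma> * \<kappa> * D w))"
    if uw: "-1 < u" "u \<le> w" "w < 1" and \<sigma>: "\<sigma> = 1 \<or> \<sigma> = -1" for u w \<sigma>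
  proof (rule DERIV_nonneg_imp_nondecreasing[OF uw(2)])
    fix t assume t: "u \<le> t" "t \<le> w"
    then have t1: "-1 < t" "t < 1" using uw by auto
    obtain d where d: "(G has_real_derivative d) (at t)"
      "\<bar>d\<bar> \<le> \<kappa> * (2 / (sqrt (1 - t\<^sup>2)) ^ 3) * G t"
      using jacobi_energy_deriv_bound[OF ode t1 N] unfolding G_def \<kappa>_def N_def by blast
    have der: "((\<lambda>t. \<sigma> * (G t * exp (\<sigma> * \<kappa> * D t))) has_real_derivative
        \<sigma> * (d * exp (\<sigma> * \<kappa> * D t) + exp (\<sigma> * \<kappa> * D t) * (\<sigma> * \<kappa> * (2 / (sqrt (1 - t\<^sup>2)) ^ 3)) * G t)) (at t)"
      by (intro DERIV_cmult DERIV_mult d(1) DERIV_fun_exp dD[OF t1])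
    have alg: "\<sigma> * (d * e + e * (\<sigma> * \<kappa> * w) * g) = e * (\<sigma> * d + \<kappa> * w * g)" for e w g
      using \<sigma> by (elim disjE) (simp_all add: algebra_simps)
    have "\<sigma> * d + \<kappa> * (2 / (sqrt (1 - t\<^sup>2)) ^ 3) * G t \<ge> 0"
    proof -
      have "- (\<sigma> * d) \<le> \<bar>d\<bar>" using \<sigma> by (elim disjE) simp_all
      then show ?thesis using d(2) by linarith
    qed
    then have "exp (\<sigma> * \<kappa> * D t) * (\<sigma> * d + \<kappa> * (2 / (sqrt (1 - t\<^sup>2)) ^ 3) * G t) \<ge> 0"
      by (rule mult_nonneg_nonneg[OF exp_ge_zero])
    then show "\<exists>y. ((\<lambda>t. \<sigma> * (G t * exp (\<sigma> * \<kappa> * D t))) has_real_derivative y) (at t) \<and> 0 \<le> y"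
      using der[unfolded alg] by blast
  qed
  have Db: "\<bar>D u\<bar> \<le> 2 / sqrt e" if "1 - u\<^sup>2 \<ge> e" for u
  proof -
    have "sqrt e \<le> sqrt (1 - u\<^sup>2)" "sqrt e > 0" using that e(1) by auto
    moreover have "\<bar>u\<bar> \<le> 1" using in1[OF that] by auto
    ultimately show ?thesis unfolding D_def
      unfolding abs_divide by (intro frac_le) (auto simp: abs_mult)
  qed
  have Dd: "\<bar>\<kappa> * (D u - D w)\<bar> \<le> \<kappa> * (4 / sqrt e)" if "1 - u\<^sup>2 \<ge> e" "1 - w\<^sup>2 \<ge> e" for u w
  proof -
    have "4 / sqrt e = 2 / sqrt e + 2 / sqrt e" by simp
    then have "\<bar>D u - D w\<bar> \<le> 4 / sqrt e" using Db[OF that(1)] Db[OF that(2)] by linarith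
    then show ?thesis using \<kappa>0 by (simp only: abs_mult abs_of_nonneg) (rule mult_left_mono)
  qed
  have "\<exists>c. \<bar>c\<bar> \<le> \<kappa> * (4 / sqrt e) \<and> G x \<le> exp c * G z"
  proof (cases "x \<le> z")
    case True
    have "G x * exp (\<kappa> * D x) \<le> G z * exp (\<kappa> * D z)"
      using mono[of x z 1] True in1[OF e(2)] in1[OF e(3)] by simp
    then have "G x \<le> exp (\<kappa> * (D z - D x)) * G z"
      by (simp add: right_diff_distrib exp_diff field_simps)
    moreover have "\<bar>\<kappa> * (D z - D x)\<bar> \<le> \<kappa> * (4 / sqrt e)"
      using Dd e by blast
    ultimately show ?thesis by blast
  next
    case False
    have "G x * exp (- \<kappa> * D x) \<le> G z * exp (- \<kappa> * D z)"
      using mono[of z x "-1"] False in1[OF e(2)] in1[OF e(3)] by simp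
    then have "G x \<le> exp (\<kappa> * (D x - D z)) * G z"
      by (simp add: right_diff_distrib exp_diff exp_minus field_simps)
    moreover have "\<bar>\<kappa> * (D x - D z)\<bar> \<le> \<kappa> * (4 / sqrt e)"
      using Dd e by blast
    ultimately show ?thesis by blast
  qed
  then obtain c where c: "\<bar>c\<bar> \<le> \<kappa> * (4 / sqrt e)" "G x \<le> exp c * G z" by blast
  have "G z \<ge> 0" unfolding G_def using in1[OF e(3)] by (intro jacobi_energy_nonneg) auto
  then have "exp c * G z \<le> exp (\<kappa> * (4 / sqrt e)) * G z" using c(1) by (intro mult_right_mono) auto
  then have "G x \<le> exp (\<kappa> * (4 / sqrt e)) * G z" using c(2) by linarith
  then show ?thesis by (simp add: G_def \<kappa>_def N_def mult_ac)
qed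

section \<open>Behaviour at the end points\<close>

text \<open>The bound 1/4 keeps \<open>1 - c / N\<^sup>2\<close> nonnegative, as
  \<open>N > 1/2\<close>. The other one makes a solution vary by at most a third of its maximum over
  the distance \<open>c / N\<^sup>2\<close> from 1; see \<open>jacobi_near_endpoint\<close>.\<close>

definition endpoint_scale :: "real \<Rightarrow> real \<Rightarrow> real" where
  "endpoint_scale \<alpha> \<beta> = min (1/4) ((\<alpha> + 1) / (3 * max 1 (2 powr \<beta>)))"

lemma endpoint_scale_pos: "\<alpha> > -1 \<Longrightarrow> endpoint_scale \<alpha> \<beta> > 0"
  by (simp add: endpoint_scale_def less_max_iff_disj)

lemma powr_le_max:
  fixes q b :: real
  assumes "1 \<le> q" "q \<le> 2"
  shows "q powr b \<le> max 1 (2 powr b)" "min 1 (2 powr b) \<le> q powr b"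
proof -
  have "q powr b \<le> max 1 (2 powr b) \<and> min 1 (2 powr b) \<le> q powr b"
  proof (cases "b \<ge> 0")
    case True
    then have "q powr b \<le> 2 powr b" "1 \<le> q powr b"
      using assms by (auto intro: powr_mono2 ge_one_powr_ge_zero)
    then show ?thesis by auto
  next
    case False
    then have "2 powr b \<le> q powr b" "q powr b \<le> 1 powr b"
      using assms powr_mono2'[of b q 2] powr_mono2'[of b 1 q] by simp_all
    then show ?thesis by auto
  qed
  then show "q powr b \<le> max 1 (2 powr b)" "min 1 (2 powr b) \<le> q powr b" by auto
qed

lemma jacobi_eigenvalue_bounds:
  assumes "\<alpha> > -1" "\<beta> > -1" "n \<ge> 1"
  shows "real n * (real n + \<alpha> + \<beta> + 1) \<ge> 0"
    and "real n * (real n + \<alpha> + \<beta> + 1) \<le> (jacobi_shift \<alpha> \<beta> n)\<^sup>2"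
proof -
  have "real n \<ge> 1" using assms(3) by simp
  then show "real n * (real n + \<alpha> + \<beta> + 1) \<ge> 0" using assms by (intro mult_nonneg_nonneg) auto
  have "(jacobi_shift \<alpha> \<beta> n)\<^sup>2 = real n * (real n + \<alpha> + \<beta> + 1) + ((\<alpha> + \<beta> + 1) / 2)\<^sup>2"
    by (simp add: jacobi_shift_def power2_eq_square field_simps)
  then show "real n * (real n + \<alpha> + \<beta> + 1) \<le> (jacobi_shift \<alpha> \<beta> n)\<^sup>2" by simp
qed

lemma endpoint_width:
  assumes "\<alpha> > -1" "\<beta> > -1" "n \<ge> 1" "0 < c" "c \<le> 1/4"
  shows "0 < c / (jacobi_shift \<alpha> \<beta> n)\<^sup>2" "c / (jacobi_shift \<alpha> \<beta> n)\<^sup>2 \<le> 1"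
proof -
  have N: "jacobi_shift \<alpha> \<beta> n > 1/2" by (rule jacobi_shift_pos) (use assms in auto)
  then have "(1/2)\<^sup>2 \<le> (jacobi_shift \<alpha> \<beta> n)\<^sup>2" by (intro power_mono) auto
  then have N2: "1/4 \<le> (jacobi_shift \<alpha> \<beta> n)\<^sup>2" by (simp add: power2_eq_square)
  then show "0 < c / (jacobi_shift \<alpha> \<beta> n)\<^sup>2" "c / (jacobi_shift \<alpha> \<beta> n)\<^sup>2 \<le> 1"
    using assms N by auto
qed

text \<open>In divergence form, h has derivative
  \<open>- l (1 - t)^\<alpha> (1 + t)^\<beta> y\<close> with the eigenvalue l, and h vanishes at 1.
  Integration over \<open>{x..1}\<close> therefore bounds \<open>h x\<close> by a multiple of
  \<open>(1 - x) powr (\<alpha> + 1)\<close>, and this power cancels against the one in h.\<close>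

lemma jacobi_near_endpoint_deriv:
  assumes ab: "\<alpha> > -1" "\<beta> > -1" and ode: "jacobi_ode \<alpha> \<beta> n y y1 y2"
    and l: "0 \<le> real n * (real n + \<alpha> + \<beta> + 1)"
    and x: "0 \<le> x" "x < 1" and M: "\<And>z. x \<le> z \<Longrightarrow> z \<le> 1 \<Longrightarrow> \<bar>y z\<bar> \<le> M"
  shows "\<bar>y1 x\<bar> \<le> real n * (real n + \<alpha> + \<beta> + 1) * max 1 (2 powr \<beta>) * M / (\<alpha> + 1)"
proof -
  define l where "l = real n * (real n + \<alpha> + \<beta> + 1)"
  define K where "K = max 1 (2 powr \<beta>)"
  have l0: "l \<ge> 0" using l by (simp add: l_def)
  have "\<bar>y 1\<bar> \<le> M" using M[of 1] x by simp
  then have M0: "M \<ge> 0" by linarith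
  have K0: "K \<ge> 0" by (simp add: K_def le_max_iff_disj)
  define h where "h t = (1 - t) powr (\<alpha> + 1) * (1 + t) powr (\<beta> + 1) * y1 t" for t
  define B where "B = l * K * M / (\<alpha> + 1)"
  have dy: "\<And>t. (y has_real_derivative y1 t) (at t)" "\<And>t. (y1 has_real_derivative y2 t) (at t)"
    "\<And>t. (1 - t\<^sup>2) * y2 t + (\<beta> - \<alpha> - (\<alpha> + \<beta> + 2) * t) * y1 t + l * y t = 0"
    using ode by (auto simp: jacobi_ode_def l_def)
  have cy: "continuous_on S y1" for S
    by (rule DERIV_continuous_on) (auto intro: has_field_derivative_at_within dy(2))
  have key: "\<sigma> * h x \<le> B * (1 - x) powr (\<alpha> + 1)" if \<sigma>: "\<sigma> = 1 \<or> \<sigma> = -1" for \<sigma>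
  proof -
    \<comment> \<open>Monotonicity of F, together with \<open>F 1 = 0\<close>, replaces the
      integration of \<open>(1 - t) powr \<alpha>\<close>, which is singular at 1 for negative
      \<alpha>.\<close>
    define F where "F t = \<sigma> * h t - B * (1 - t) powr (\<alpha> + 1)" for t
    have "F x \<le> F 1"
    proof (rule DERIV_nonneg_imp_increasing_open[where f = F])
      have "continuous_on {x..1} (\<lambda>t. (1 - t) powr (\<alpha> + 1))"
        by (rule continuous_on_powr') (use ab in \<open>auto intro!: continuous_intros\<close>)
      moreover have "continuous_on {x..1} (\<lambda>t. (1 + t) powr (\<beta> + 1))"
        by (rule continuous_on_powr') (use x in \<open>auto intro!: continuous_intros\<close>)
      ultimately show "continuous_on {x..1} F"
        unfolding F_def[abs_def] h_def
        by (intro continuous_on_diff continuous_on_mult continuous_on_const cy)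
      fix t assume t: "x < t" "t < 1"
      then have pos: "1 - t > 0" "1 + t > 0" "1 \<le> 1 + t" "1 + t \<le> 2" using x by auto
      have d1: "((\<lambda>t. (1 - t) powr (\<alpha> + 1)) has_real_derivative (- (\<alpha> + 1) * (1 - t) powr \<alpha>)) (at t)"
        using pos by (auto intro!: derivative_eq_intros simp: algebra_simps)
      have d2: "((\<lambda>t. (1 + t) powr (\<beta> + 1)) has_real_derivative ((\<beta> + 1) * (1 + t) powr \<beta>)) (at t)"
        using pos by (auto intro!: derivative_eq_intros)
      have p1: "(1 - t) powr (\<alpha> + 1) = (1 - t) * (1 - t) powr \<alpha>" "(1 + t) powr (\<beta> + 1) = (1 + t) * (1 + t) powr \<beta>"
        using pos by (simp_all add: powr_add)
      define A where "A = (1 - t) powr \<alpha>"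
      define Q where "Q = (1 + t) powr \<beta>"
      have dF: "(F has_real_derivative
        \<sigma> * (((- (\<alpha> + 1) * A) * (1 + t) powr (\<beta> + 1) + (\<beta> + 1) * Q * (1 - t) powr (\<alpha> + 1)) * y1 t
        + y2 t * ((1 - t) powr (\<alpha> + 1) * (1 + t) powr (\<beta> + 1))) - B * (- (\<alpha> + 1) * A)) (at t)"
        unfolding F_def[abs_def] h_def A_def Q_def
        by (intro DERIV_diff DERIV_cmult DERIV_mult d1 d2 dy)
      have E1: "((- (\<alpha> + 1) * A) * (1 + t) powr (\<beta> + 1) + (\<beta> + 1) * Q * (1 - t) powr (\<alpha> + 1)) * y1 t
        + y2 t * ((1 - t) powr (\<alpha> + 1) * (1 + t) powr (\<beta> + 1)) = - (l * A * Q * y t)"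
      proof -
        have "((- (\<alpha> + 1) * A) * ((1 + t) * Q) + (\<beta> + 1) * Q * ((1 - t) * A)) * y1 t + y2 t * ((1 - t) * A * ((1 + t) * Q))
            = A * Q * ((1 - t\<^sup>2) * y2 t + (\<beta> - \<alpha> - (\<alpha> + \<beta> + 2) * t) * y1 t)"
          by (simp add: power2_eq_square algebra_simps)
        also have "(1 - t\<^sup>2) * y2 t + (\<beta> - \<alpha> - (\<alpha> + \<beta> + 2) * t) * y1 t = - (l * y t)" using dy(3)[of t] by linarith
        finally show ?thesis unfolding p1 A_def[symmetric] Q_def[symmetric] by (simp add: mult_ac)
      qed
      have E2: "B * (- (\<alpha> + 1) * A) = - (l * A * (K * M))"
      proof -
        have "B * (\<alpha> + 1) = l * K * M" using ab by (simp add: B_def)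
        moreover have "B * (- (\<alpha> + 1) * A) = - (B * (\<alpha> + 1)) * A" by (simp only: mult_minus_left mult_minus_right mult.assoc)
        ultimately show ?thesis by (simp add: mult_ac)
      qed
      have E3: "\<sigma> * - (l * A * Q * y t) - - (l * A * (K * M)) = l * A * (K * M - Q * (\<sigma> * y t))"
        by (simp add: algebra_simps)
      have "(F has_real_derivative l * A * (K * M - Q * (\<sigma> * y t))) (at t)"
        using dF unfolding E1 E2 E3 .
      moreover have QK: "Q * (\<sigma> * y t) \<le> K * M"
      proof -
        have "\<sigma> * y t \<le> M" using M[of t] t \<sigma> by auto
        then have "Q * (\<sigma> * y t) \<le> Q * M" by (intro mult_left_mono) (auto simp: Q_def)
        also have "\<dots> \<le> K * M" using powr_le_max(1)[OF pos(3,4)] M0 by (intro mult_right_mono) (auto simp: Q_def K_def)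
        finally show ?thesis .
      qed
      have "l * A * (K * M - Q * (\<sigma> * y t)) \<ge> 0"
        using l0 QK by (intro mult_nonneg_nonneg) (auto simp: A_def)
      ultimately show "\<exists>d. (F has_real_derivative d) (at t) \<and> d \<ge> 0" by blast
    qed (use x in auto)
    then show ?thesis by (simp add: F_def h_def)
  qed
  have pp: "(1 - x) powr (\<alpha> + 1) > 0" using x by simp
  have "\<bar>h x\<bar> \<le> B * (1 - x) powr (\<alpha> + 1)" using key[of 1] key[of "-1"] by (auto simp: abs_le_iff)
  moreover have "\<bar>h x\<bar> \<ge> (1 - x) powr (\<alpha> + 1) * \<bar>y1 x\<bar>"
  proof -
    have "1 \<le> (1 + x) powr (\<beta> + 1)" using x ab by (intro ge_one_powr_ge_zero) auto
    then have "(1 - x) powr (\<alpha> + 1) * 1 * \<bar>y1 x\<bar> \<le> (1 - x) powr (\<alpha> + 1) * (1 + x) powr (\<beta> + 1) * \<bar>y1 x\<bar>"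
      by (intro mult_right_mono mult_left_mono) auto
    then show ?thesis by (simp add: h_def abs_mult)
  qed
  ultimately have "(1 - x) powr (\<alpha> + 1) * \<bar>y1 x\<bar> \<le> (1 - x) powr (\<alpha> + 1) * B" by (simp add: mult.commute)
  then have "\<bar>y1 x\<bar> \<le> B" using pp by simp
  then show ?thesis by (simp add: B_def l_def K_def)
qed

text \<open>With M the maximum of the modulus of y over the interval of length
  \<open>c / N\<^sup>2\<close>, the derivative is O(N^2 M) there. By the choice of c the deviation
  from \<open>y 1\<close> is at most M / 3; hence M is at most \<open>3/2 * \<bar>y 1\<bar>\<close>,
  and the deviation at most half of \<open>\<bar>y 1\<bar>\<close>.\<close>

lemma jacobi_near_endpoint:
  assumes ab: "\<alpha> > -1" "\<beta> > -1" and ode: "jacobi_ode \<alpha> \<beta> n y y1 y2" and n: "n \<ge> 1"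
    and c: "0 < c" "c \<le> endpoint_scale \<alpha> \<beta>"
    and x: "1 - c / (jacobi_shift \<alpha> \<beta> n)\<^sup>2 \<le> x" "x \<le> 1"
  shows "\<bar>y x - y 1\<bar> \<le> \<bar>y 1\<bar> / 2"
    and "x < 1 \<Longrightarrow> \<bar>y1 x\<bar> \<le> 2 * max 1 (2 powr \<beta>) / (\<alpha> + 1) * (jacobi_shift \<alpha> \<beta> n)\<^sup>2 * \<bar>y 1\<bar>"
proof -
  define N2 where "N2 = (jacobi_shift \<alpha> \<beta> n)\<^sup>2"
  define K where "K = max 1 (2 powr \<beta>) / (\<alpha> + 1)"
  define l where "l = real n * (real n + \<alpha> + \<beta> + 1)"
  have K1: "max 1 (2 powr \<beta>) \<ge> 1" by simp
  have K0: "K > 0" unfolding K_def using ab K1 by (intro divide_pos_pos) linarith+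
  have l: "0 \<le> l" "l \<le> N2" unfolding l_def N2_def using jacobi_eigenvalue_bounds[OF ab n] by auto
  have c4: "c \<le> 1/4" "c * K \<le> 1/3"
  proof -
    show "c \<le> 1/4" using c by (simp add: endpoint_scale_def)
    have "c \<le> (\<alpha> + 1) / (3 * max 1 (2 powr \<beta>))" using c by (simp add: endpoint_scale_def)
    then have "c * K \<le> (\<alpha> + 1) / (3 * max 1 (2 powr \<beta>)) * K" using K0 by (intro mult_right_mono) auto
    also have "\<dots> = 1/3" using ab K1 by (simp add: K_def del: le_max_iff_disj)
    finally show "c * K \<le> 1/3" .
  qed
  define x0 where "x0 = 1 - c / N2"
  have e: "0 < c / N2" "c / N2 \<le> 1" unfolding N2_def using endpoint_width[OF ab n c(1) c4(1)] by auto
  have x0: "0 \<le> x0" "x0 < 1" using e by (auto simp: x0_def)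
  have N20: "N2 > 0" using e(1) c(1) by (simp add: zero_less_divide_iff)
  have dy: "\<And>t. (y has_real_derivative y1 t) (at t)" using ode by (auto simp: jacobi_ode_def)
  have "continuous_on {x0..1} (\<lambda>t. \<bar>y t\<bar>)"
    by (intro continuous_intros DERIV_continuous_on) (auto intro: has_field_derivative_at_within dy)
  from continuous_attains_sup[OF _ _ this] x0 obtain xm where xm: "xm \<in> {x0..1}"
    "\<And>t. t \<in> {x0..1} \<Longrightarrow> \<bar>y t\<bar> \<le> \<bar>y xm\<bar>" by auto
  define M where "M = \<bar>y xm\<bar>"
  have d: "\<bar>y1 t\<bar> \<le> N2 * K * M" if "x0 \<le> t" "t < 1" for t
  proof -
    have "\<bar>y1 t\<bar> \<le> l * max 1 (2 powr \<beta>) * M / (\<alpha> + 1)"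
      unfolding l_def
      by (rule jacobi_near_endpoint_deriv[OF ab ode _ _ that(2)])
        (use l xm that x0 in \<open>auto simp: l_def M_def\<close>)
    also have "\<dots> = l * (K * M)" by (simp add: K_def)
    also have "\<dots> \<le> N2 * (K * M)" using l K0 by (intro mult_right_mono mult_nonneg_nonneg) (auto simp: M_def)
    finally show ?thesis by (simp add: mult_ac)
  qed
  have yd: "\<bar>y t - y 1\<bar> \<le> M / 3" if t: "x0 \<le> t" "t \<le> 1" for t
  proof (cases "t = 1")
    case True then show ?thesis by (simp add: M_def)
  next
    case False
    then have t1: "t < 1" using t by simp
    obtain z where z: "z > t" "z < 1" "y 1 - y t = (1 - t) * y1 z"
      using MVT2[OF t1, of y y1] dy by blast
    have "\<bar>y t - y 1\<bar> = (1 - t) * \<bar>y1 z\<bar>" using z(3) t1 by (simp add: abs_minus_commute[of "y t"] abs_mult)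
    also have "\<dots> \<le> (c / N2) * (N2 * K * M)"
      using d[of z] z t t1 e by (intro mult_mono) (auto simp: x0_def)
    also have "\<dots> = c * K * M" using N20 by simp
    also have "\<dots> \<le> 1/3 * M" using c4(2) by (intro mult_right_mono) (auto simp: M_def)
    finally show ?thesis by simp
  qed
  have "\<bar>y xm - y 1\<bar> \<le> M / 3" using yd[of xm] xm(1) by simp
  then have "M \<le> \<bar>y 1\<bar> + M / 3" unfolding M_def by linarith
  then have M: "M \<le> 3/2 * \<bar>y 1\<bar>" by simp
  have xx: "x0 \<le> x" using x by (simp add: x0_def N2_def)
  show "\<bar>y x - y 1\<bar> \<le> \<bar>y 1\<bar> / 2" using yd[OF xx x(2)] M by linarith
  show "\<bar>y1 x\<bar> \<le> 2 * max 1 (2 powr \<beta>) / (\<alpha> + 1) * (jacobi_shift \<alpha> \<beta> n)\<^sup>2 * \<bar>y 1\<bar>" if "x < 1"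
  proof -
    have "\<bar>y1 x\<bar> \<le> N2 * K * M" by (rule d[OF xx that])
    also have "\<dots> \<le> N2 * K * (2 * \<bar>y 1\<bar>)" using M N20 K0 by (intro mult_left_mono) auto
    finally show ?thesis by (simp add: K_def N2_def mult_ac)
  qed
qed

lemma jacobi_energy_factor:
  assumes "c > 0" "N > 0" "K \<ge> 0" "c / N\<^sup>2 \<le> e"
  shows "exp (4 * K / (N * sqrt e)) \<le> exp (4 * K / sqrt c)"
proof -
  have "sqrt c = N * sqrt (c / N\<^sup>2)" using assms by (simp add: real_sqrt_divide)
  also have "\<dots> \<le> N * sqrt e" using assms by (intro mult_left_mono real_sqrt_le_mono) auto
  finally have le: "sqrt c \<le> N * sqrt e" .
  have "sqrt c > 0" using assms by simp
  with le have "N * sqrt e > 0" by linarith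
  with \<open>sqrt c > 0\<close> have "N * sqrt e * sqrt c > 0" by (simp only: mult_pos_pos)
  then have "4 * K / (N * sqrt e) \<le> 4 * K / sqrt c" using le assms by (intro divide_left_mono) auto
  then show ?thesis by simp
qed

text \<open>The exponent in \<open>jacobi_energy_compare\<close> is of order
  \<open>1 / (N * sqrt e)\<close>, so \<open>c / N\<^sup>2\<close> is the smallest order of e for
  which it stays bounded independently of n.\<close>

lemma jacobi_energy_compare':
  assumes ab: "\<alpha> > -1" "\<beta> > -1" and n: "n \<ge> 1" and ode: "jacobi_ode \<alpha> \<beta> n y y1 y2" and c: "c > 0"
    and xz: "1 - x\<^sup>2 \<ge> c / (jacobi_shift \<alpha> \<beta> n)\<^sup>2" "1 - z\<^sup>2 \<ge> c / (jacobi_shift \<alpha> \<beta> n)\<^sup>2"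
  shows "jacobi_energy \<alpha> \<beta> n y y1 x \<le> exp (4 * liouville_defect \<alpha> \<beta> / sqrt c) * jacobi_energy \<alpha> \<beta> n y y1 z"
proof -
  define e where "e = c / (jacobi_shift \<alpha> \<beta> n)\<^sup>2"
  have N: "jacobi_shift \<alpha> \<beta> n > 0" using jacobi_shift_pos[OF ab n] by simp
  have e: "e > 0" using N c by (simp add: e_def)
  have "z\<^sup>2 \<le> 1" using xz(2) e unfolding e_def by linarith
  then have z: "-1 \<le> z" "z \<le> 1" by (auto simp: abs_square_le_1 abs_le_iff)
  have "jacobi_energy \<alpha> \<beta> n y y1 x \<le>
      exp (4 * liouville_defect \<alpha> \<beta> / (jacobi_shift \<alpha> \<beta> n * sqrt e)) * jacobi_energy \<alpha> \<beta> n y y1 z"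
    by (rule jacobi_energy_compare[OF ode N e]) (use xz in \<open>auto simp: e_def\<close>)
  also have "\<dots> \<le> exp (4 * liouville_defect \<alpha> \<beta> / sqrt c) * jacobi_energy \<alpha> \<beta> n y y1 z"
    by (intro mult_right_mono jacobi_energy_factor jacobi_energy_nonneg z c N)
      (auto simp: e_def liouville_defect_def)
  finally show ?thesis .
qed

lemma one_minus_square_ge:
  fixes x e :: real
  assumes "0 \<le> x" "e \<le> 1 - x" "0 \<le> e"
  shows "e \<le> 1 - x\<^sup>2"
proof -
  have "1 - x\<^sup>2 = (1 - x) * (1 + x)" by (simp add: power2_eq_square algebra_simps)
  also have "\<dots> \<ge> (1 - x) * 1" using assms by (intro mult_left_mono) auto
  finally show ?thesis using assms by simp
qed

lemma jacobi_value_le_energy: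
  assumes "-1 < x" "x < 1"
  shows "(1 - x) powr (\<alpha> + 1/2) * (1 + x) powr (\<beta> + 1/2) * (y x)\<^sup>2 \<le> jacobi_energy \<alpha> \<beta> n y y1 x"
proof -
  have "1 - x\<^sup>2 \<ge> 0" using assms by (simp add: abs_square_le_1)
  then show ?thesis unfolding jacobi_energy_def by (intro mult_left_mono) auto
qed

text \<open>Up to a constant, \<open>c / N\<^sup>2\<close> is the squared angular distance from the end point \<open>1\<close> within which
  \<open>y\<close> is comparable to \<open>y 1\<close>.\<close>

lemma jacobi_value_bound:
  assumes ab: "\<alpha> > -1" "\<beta> > -1" and c: "0 < c" "c \<le> endpoint_scale \<alpha> \<beta>"
  obtains C where "C > 0" "\<And>n y y1 y2 t. n \<ge> 1 \<Longrightarrow> jacobi_ode \<alpha> \<beta> n y y1 y2 \<Longrightarrow> 0 \<le> t \<Longrightarrow> t \<le> 1 \<Longrightarrow>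
     (y t)\<^sup>2 * max (1 - t) (c / (jacobi_shift \<alpha> \<beta> n)\<^sup>2) powr (\<alpha> + 1/2) \<le> C * jacobi_energy \<alpha> \<beta> n y y1 0"
proof -
  define X where "X = exp (4 * liouville_defect \<alpha> \<beta> / sqrt c)"
  define cb where "cb = min 1 (2 powr (\<beta> + 1/2))"
  have X0: "X > 0" by (simp add: X_def)
  have cb0: "cb > 0" by (simp add: cb_def)
  \<comment> \<open>The 9 is for points closer to 1 than \<open>c / N\<^sup>2\<close>. There the
    modulus of y is at most 3/2 of its value at 1, and at the border of that range at least 1/2 of
    it: a ratio of 3, squared.\<close>
  define C where "C = 9 * (X / cb)"
  have C0: "C > 0" using X0 cb0 by (simp add: C_def)
  have "(y t)\<^sup>2 * max (1 - t) (c / (jacobi_shift \<alpha> \<beta> n)\<^sup>2) powr (\<alpha> + 1/2) \<le> C * jacobi_energy \<alpha> \<beta> n y y1 0"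
    if n: "n \<ge> 1" and ode: "jacobi_ode \<alpha> \<beta> n y y1 y2" and t: "0 \<le> t" "t \<le> 1" for n y y1 y2 t
  proof -
    define e where "e = c / (jacobi_shift \<alpha> \<beta> n)\<^sup>2"
    define G where "G = jacobi_energy \<alpha> \<beta> n y y1"
    have c4: "c \<le> 1/4" using c by (simp add: endpoint_scale_def)
    have e: "0 < e" "e \<le> 1" unfolding e_def using endpoint_width[OF ab n c(1) c4] by auto
    have G0: "G 0 \<ge> 0" unfolding G_def by (rule jacobi_energy_nonneg) auto
    have far: "(y z)\<^sup>2 * (1 - z) powr (\<alpha> + 1/2) \<le> X / cb * G 0" if z: "0 \<le> z" "e \<le> 1 - z" for z
    proof -
      have "G z \<le> X * G 0"
        unfolding G_def X_def
        by (rule jacobi_energy_compare'[OF ab n ode c(1)])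
          (use one_minus_square_ge[OF z] e in \<open>auto simp: e_def[symmetric]\<close>)
      moreover have "(1 - z) powr (\<alpha> + 1/2) * (1 + z) powr (\<beta> + 1/2) * (y z)\<^sup>2 \<le> G z"
        unfolding G_def by (rule jacobi_value_le_energy) (use z e in auto)
      moreover have "(1 - z) powr (\<alpha> + 1/2) * cb * (y z)\<^sup>2
          \<le> (1 - z) powr (\<alpha> + 1/2) * (1 + z) powr (\<beta> + 1/2) * (y z)\<^sup>2"
        unfolding cb_def by (intro mult_right_mono mult_left_mono powr_le_max) (use z e in auto)
      ultimately have "cb * ((y z)\<^sup>2 * (1 - z) powr (\<alpha> + 1/2)) \<le> X * G 0" by (simp add: mult_ac)
      then show ?thesis using cb0 by (simp add: field_simps)
    qed
    show ?thesis
    proof (cases "e \<le> 1 - t")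
      case True
      then have "(y t)\<^sup>2 * max (1 - t) e powr (\<alpha> + 1/2) \<le> X / cb * G 0"
        using far[OF t(1) True] by (simp add: max_def)
      also have "\<dots> \<le> C * G 0"
      proof -
        have "X / cb > 0" using X0 cb0 by simp
        then have "X / cb \<le> C" unfolding C_def by linarith
        then show ?thesis using G0 by (rule mult_right_mono)
      qed
      finally show ?thesis by (simp add: e_def G_def)
    next
      case False
      have "\<bar>y t - y 1\<bar> \<le> \<bar>y 1\<bar> / 2"
        by (rule jacobi_near_endpoint(1)[OF ab ode n c]) (use False t in \<open>auto simp: e_def\<close>)
      moreover have "\<bar>y (1 - e) - y 1\<bar> \<le> \<bar>y 1\<bar> / 2"
        by (rule jacobi_near_endpoint(1)[OF ab ode n c]) (use e in \<open>auto simp: e_def\<close>)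
      ultimately have "\<bar>y t\<bar> \<le> 3 * \<bar>y (1 - e)\<bar>" by linarith
      then have "\<bar>y t\<bar>\<^sup>2 \<le> (3 * \<bar>y (1 - e)\<bar>)\<^sup>2" by (intro power_mono) auto
      then have y2: "(y t)\<^sup>2 \<le> 9 * (y (1 - e))\<^sup>2" by (simp add: power_mult_distrib)
      have "max (1 - t) e = e" using False by simp
      then have "(y t)\<^sup>2 * max (1 - t) e powr (\<alpha> + 1/2) \<le> 9 * ((y (1 - e))\<^sup>2 * e powr (\<alpha> + 1/2))"
        using mult_right_mono[OF y2, of "e powr (\<alpha> + 1/2)"] by (simp add: mult_ac)
      also have "\<dots> \<le> 9 * (X / cb * G 0)" using far[of "1 - e"] e by simp
      finally show ?thesis by (simp add: e_def G_def C_def)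
    qed
  qed
  then show thesis by (rule that[OF C0])
qed

text \<open>At distance \<open>e = c / N\<^sup>2\<close> from 1 the estimates of
  \<open>jacobi_near_endpoint\<close> still apply: y is O(y 1), while y1 and
  \<open>liouville_mu\<close> times y are O(y 1 / e). Since \<open>1 - x\<^sup>2\<close> is O(e) and
  \<open>N\<^sup>2 = c / e\<close>, both parts of the energy are bounded by the same order, and
  comparison carries this over to the point 0.\<close>

lemma jacobi_endpoint_value_lower:
  assumes ab: "\<alpha> > -1" "\<beta> > -1" and c: "0 < c" "c \<le> endpoint_scale \<alpha> \<beta>"
  obtains C where "C > 0" "\<And>n y y1 y2. n \<ge> 1 \<Longrightarrow> jacobi_ode \<alpha> \<beta> n y y1 y2 \<Longrightarrow>
     jacobi_energy \<alpha> \<beta> n y y1 0 \<le> C * (c / (jacobi_shift \<alpha> \<beta> n)\<^sup>2) powr (\<alpha> + 1/2) * (y 1)\<^sup>2"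
proof -
  define X where "X = exp (4 * liouville_defect \<alpha> \<beta> / sqrt c)"
  define Cb where "Cb = max 1 (2 powr (\<beta> + 1/2))"
  define C1 where "C1 = 2 * max 1 (2 powr \<beta>) / (\<alpha> + 1)"
  define C2 where "C2 = \<bar>\<alpha> + 1/2\<bar> + \<bar>\<beta> + 1/2\<bar> + C1 * c"
  have C1: "C1 > 0" unfolding C1_def using ab by (intro divide_pos_pos) (auto simp: less_max_iff_disj)
  have C20: "C2 \<ge> 0" using C1 c by (simp add: C2_def)
  have Cb: "Cb \<ge> 1" by (simp add: Cb_def)
  define C where "C = X * (Cb * (3 + 2 * C2\<^sup>2 / c))"
  have C0: "C > 0" unfolding C_def using Cb c by (intro mult_pos_pos add_pos_nonneg) (auto simp: X_def)
  have "jacobi_energy \<alpha> \<beta> n y y1 0 \<le> C * (c / (jacobi_shift \<alpha> \<beta> n)\<^sup>2) powr (\<alpha> + 1/2) * (y 1)\<^sup>2"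
    if n: "n \<ge> 1" and ode: "jacobi_ode \<alpha> \<beta> n y y1 y2" for n y y1 y2
  proof -
    define N where "N = jacobi_shift \<alpha> \<beta> n"
    define e where "e = c / N\<^sup>2"
    define G where "G = jacobi_energy \<alpha> \<beta> n y y1"
    have N0: "N > 0" unfolding N_def using jacobi_shift_pos[OF ab n] by simp
    have c4: "c \<le> 1/4" using c by (simp add: endpoint_scale_def)
    have e: "0 < e" "e \<le> 1" unfolding e_def N_def using endpoint_width[OF ab n c(1) c4] by auto
    define x where "x = 1 - e"
    have x: "0 \<le> x" "x < 1" "1 - x = e" using e by (auto simp: x_def)
    have "\<bar>y x - y 1\<bar> \<le> \<bar>y 1\<bar> / 2"
      by (rule jacobi_near_endpoint(1)[OF ab ode n c]) (use x in \<open>auto simp: x_def e_def N_def\<close>)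
    then have yx: "\<bar>y x\<bar> \<le> 3/2 * \<bar>y 1\<bar>" by linarith
    have y1x: "\<bar>y1 x\<bar> \<le> C1 * N\<^sup>2 * \<bar>y 1\<bar>"
      unfolding C1_def N_def
      by (rule jacobi_near_endpoint(2)[OF ab ode n c]) (use x in \<open>auto simp: x_def e_def N_def\<close>)
    have N2: "N\<^sup>2 = c / e" using e N0 c by (simp add: e_def)
    have mu: "\<bar>liouville_mu \<alpha> \<beta> x\<bar> \<le> (\<bar>\<alpha> + 1/2\<bar> + \<bar>\<beta> + 1/2\<bar>) / (2 * e)"
    proof -
      have "\<bar>liouville_mu \<alpha> \<beta> x\<bar> \<le> \<bar>\<beta> + 1/2\<bar> / (2 * (1 + x)) + \<bar>\<alpha> + 1/2\<bar> / (2 * e)"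
        unfolding liouville_mu_def x(3) using x e
        by (intro order_trans[OF abs_triangle_ineq4]) (simp add: abs_divide abs_mult)
      also have "\<bar>\<beta> + 1/2\<bar> / (2 * (1 + x)) \<le> \<bar>\<beta> + 1/2\<bar> / (2 * e)"
        using x e by (intro divide_left_mono) auto
      finally show ?thesis by (simp add: add_divide_distrib)
    qed
    have v: "\<bar>liouville_mu \<alpha> \<beta> x * y x + y1 x\<bar> \<le> C2 / e * \<bar>y 1\<bar>"
    proof -
      have "\<bar>liouville_mu \<alpha> \<beta> x * y x + y1 x\<bar> \<le> \<bar>liouville_mu \<alpha> \<beta> x\<bar> * \<bar>y x\<bar> + \<bar>y1 x\<bar>"
        by (metis abs_mult abs_triangle_ineq)
      also have "\<dots> \<le> (\<bar>\<alpha> + 1/2\<bar> + \<bar>\<beta> + 1/2\<bar>) / (2 * e) * (2 * \<bar>y 1\<bar>) + C1 * N\<^sup>2 * \<bar>y 1\<bar>"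
        using mu yx y1x e by (intro add_mono mult_mono) auto
      finally have le: "\<bar>liouville_mu \<alpha> \<beta> x * y x + y1 x\<bar>
        \<le> (\<bar>\<alpha> + 1/2\<bar> + \<bar>\<beta> + 1/2\<bar>) / (2 * e) * (2 * \<bar>y 1\<bar>) + C1 * N\<^sup>2 * \<bar>y 1\<bar>" .
      have "S / (2 * e) * (2 * z) + C1 * (c / e) * z = (S + C1 * c) / e * z" for S z
        using e by (simp add: field_simps)
      from this[of "\<bar>\<alpha> + 1/2\<bar> + \<bar>\<beta> + 1/2\<bar>" "\<bar>y 1\<bar>"]
      have "(\<bar>\<alpha> + 1/2\<bar> + \<bar>\<beta> + 1/2\<bar>) / (2 * e) * (2 * \<bar>y 1\<bar>) + C1 * N\<^sup>2 * \<bar>y 1\<bar> = C2 / e * \<bar>y 1\<bar>"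
        unfolding N2 C2_def .
      then show ?thesis using le by simp
    qed
    have Gx: "G x \<le> Cb * (3 + 2 * C2\<^sup>2 / c) * (e powr (\<alpha> + 1/2) * (y 1)\<^sup>2)"
    proof -
      have a1: "(y x)\<^sup>2 \<le> 3 * (y 1)\<^sup>2"
      proof -
        have "\<bar>y x\<bar>\<^sup>2 \<le> (3/2 * \<bar>y 1\<bar>)\<^sup>2" using yx by (intro power_mono) auto
        also have "\<dots> \<le> 3 * (y 1)\<^sup>2" by (simp add: power_mult_distrib power2_eq_square)
        finally show ?thesis by simp
      qed
      have a2: "(1 - x\<^sup>2) * (liouville_mu \<alpha> \<beta> x * y x + y1 x)\<^sup>2 / N\<^sup>2 \<le> 2 * C2\<^sup>2 / c * (y 1)\<^sup>2"
      proof -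
        have "1 - x\<^sup>2 = e * (2 - e)" by (simp add: x_def power2_eq_square algebra_simps)
        also have "\<dots> \<le> e * 2" using e by (intro mult_left_mono) auto
        finally have b1: "1 - x\<^sup>2 \<le> 2 * e" by simp
        have b2: "(liouville_mu \<alpha> \<beta> x * y x + y1 x)\<^sup>2 \<le> (C2 / e * \<bar>y 1\<bar>)\<^sup>2"
          using v power_mono[OF v abs_ge_zero, of 2] by simp
        have "(1 - x\<^sup>2) * (liouville_mu \<alpha> \<beta> x * y x + y1 x)\<^sup>2 / N\<^sup>2 \<le> (2 * e) * (C2 / e * \<bar>y 1\<bar>)\<^sup>2 / N\<^sup>2"
          using b1 b2 e N0 by (intro divide_right_mono mult_mono) auto
        also have "\<dots> = 2 * C2\<^sup>2 / c * (y 1)\<^sup>2"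
          unfolding N2 using e c by (simp add: power_mult_distrib power_divide power2_eq_square)
        finally show ?thesis .
      qed
      have "G x = e powr (\<alpha> + 1/2) * (1 + x) powr (\<beta> + 1/2) *
          ((y x)\<^sup>2 + (1 - x\<^sup>2) * (liouville_mu \<alpha> \<beta> x * y x + y1 x)\<^sup>2 / N\<^sup>2)"
        by (simp add: G_def jacobi_energy_def N_def x(3))
      also have "\<dots> \<le> e powr (\<alpha> + 1/2) * Cb * (3 * (y 1)\<^sup>2 + 2 * C2\<^sup>2 / c * (y 1)\<^sup>2)"
      proof (intro mult_mono add_mono a1 a2 order_refl)
        show "(1 + x) powr (\<beta> + 1/2) \<le> Cb" unfolding Cb_def by (rule powr_le_max) (use x in auto)
        have "1 - x\<^sup>2 \<ge> 0" using one_minus_square_ge[of x 0] x by simp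
        then show "0 \<le> (y x)\<^sup>2 + (1 - x\<^sup>2) * (liouville_mu \<alpha> \<beta> x * y x + y1 x)\<^sup>2 / N\<^sup>2"
          by (intro add_nonneg_nonneg divide_nonneg_nonneg mult_nonneg_nonneg) auto
      qed (use Cb in auto)
      finally show ?thesis by (simp add: algebra_simps)
    qed
    have "G 0 \<le> X * G x"
      unfolding G_def X_def
      by (rule jacobi_energy_compare'[OF ab n ode c(1)])
        (use one_minus_square_ge[of x e] x e in \<open>auto simp: e_def[symmetric] N_def[symmetric]\<close>)
    also have "\<dots> \<le> X * (Cb * (3 + 2 * C2\<^sup>2 / c) * (e powr (\<alpha> + 1/2) * (y 1)\<^sup>2))"
      using Gx by (intro mult_left_mono) (auto simp: X_def)
    finally show ?thesis by (simp add: G_def C_def e_def N_def mult_ac)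
  qed
  then show thesis by (rule that[OF C0])
qed

text \<open>At a root only the derivative term of the energy is present, so comparison with the
  point 0 bounds y1 from below. The comparison is admissible because y cannot vanish within
  \<open>c / N\<^sup>2\<close> of 1, where it is comparable to its nonzero value at 1.\<close>

lemma jacobi_root_deriv_lower:
  assumes ab: "\<alpha> > -1" "\<beta> > -1" and c: "0 < c" "c \<le> endpoint_scale \<alpha> \<beta>"
  obtains C where "C > 0" "\<And>n y y1 y2 \<xi>. n \<ge> 1 \<Longrightarrow> jacobi_ode \<alpha> \<beta> n y y1 y2 \<Longrightarrow> y 1 \<noteq> 0 \<Longrightarrow>
     0 \<le> \<xi> \<Longrightarrow> \<xi> < 1 \<Longrightarrow> y \<xi> = 0 \<Longrightarrow>
     c / (jacobi_shift \<alpha> \<beta> n)\<^sup>2 \<le> 1 - \<xi> \<and>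
     jacobi_energy \<alpha> \<beta> n y y1 0
       \<le> C * (1 - \<xi>) powr (\<alpha> + 3/2) * (y1 \<xi>)\<^sup>2 * (c / (jacobi_shift \<alpha> \<beta> n)\<^sup>2)"
proof -
  define X where "X = exp (4 * liouville_defect \<alpha> \<beta> / sqrt c)"
  define C where "C = X * 2 powr (\<beta> + 3/2) / c"
  have C0: "C > 0" using c by (simp add: C_def X_def)
  have "c / (jacobi_shift \<alpha> \<beta> n)\<^sup>2 \<le> 1 - \<xi> \<and>
     jacobi_energy \<alpha> \<beta> n y y1 0
       \<le> C * (1 - \<xi>) powr (\<alpha> + 3/2) * (y1 \<xi>)\<^sup>2 * (c / (jacobi_shift \<alpha> \<beta> n)\<^sup>2)"
    if n: "n \<ge> 1" and ode: "jacobi_ode \<alpha> \<beta> n y y1 y2" and y1n: "y 1 \<noteq> 0"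
      and xi: "0 \<le> \<xi>" "\<xi> < 1" "y \<xi> = 0" for n y y1 y2 \<xi>
  proof -
    define N where "N = jacobi_shift \<alpha> \<beta> n"
    define e where "e = c / N\<^sup>2"
    define G where "G = jacobi_energy \<alpha> \<beta> n y y1"
    have N0: "N > 0" unfolding N_def using jacobi_shift_pos[OF ab n] by simp
    have c4: "c \<le> 1/4" using c by (simp add: endpoint_scale_def)
    have e: "0 < e" "e \<le> 1" unfolding e_def N_def using endpoint_width[OF ab n c(1) c4] by auto
    have xe: "e \<le> 1 - \<xi>"
    proof (rule ccontr)
      assume "\<not> ?thesis"
      then have "\<bar>y \<xi> - y 1\<bar> \<le> \<bar>y 1\<bar> / 2"
        by (intro jacobi_near_endpoint(1)[OF ab ode n c]) (use xi in \<open>auto simp: e_def N_def\<close>)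
      then show False using xi(3) y1n by simp
    qed
    have "G 0 \<le> X * G \<xi>"
      unfolding G_def X_def
      by (rule jacobi_energy_compare'[OF ab n ode c(1)])
        (use one_minus_square_ge[OF xi(1) xe] e in \<open>auto simp: e_def[symmetric] N_def[symmetric]\<close>)
    also have "G \<xi> \<le> (1 - \<xi>) powr (\<alpha> + 3/2) * 2 powr (\<beta> + 3/2) * ((y1 \<xi>)\<^sup>2 / N\<^sup>2)"
    proof -
      have p: "(1 - \<xi>) powr (\<alpha> + 3/2) = (1 - \<xi>) powr (\<alpha> + 1/2) * (1 - \<xi>)"
        using xi powr_add[of "1 - \<xi>" "\<alpha> + 1/2" 1] by (simp add: add.assoc)
      have q: "(1 + \<xi>) powr (\<beta> + 3/2) = (1 + \<xi>) powr (\<beta> + 1/2) * (1 + \<xi>)"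
        using xi powr_add[of "1 + \<xi>" "\<beta> + 1/2" 1] by (simp add: add.assoc)
      have "1 - \<xi>\<^sup>2 = (1 - \<xi>) * (1 + \<xi>)" by (simp add: power2_eq_square algebra_simps)
      then have "G \<xi> = (1 - \<xi>) powr (\<alpha> + 3/2) * (1 + \<xi>) powr (\<beta> + 3/2) * ((y1 \<xi>)\<^sup>2 / N\<^sup>2)"
        unfolding p q by (simp add: G_def jacobi_energy_def N_def xi(3) mult_ac)
      also have "\<dots> \<le> (1 - \<xi>) powr (\<alpha> + 3/2) * 2 powr (\<beta> + 3/2) * ((y1 \<xi>)\<^sup>2 / N\<^sup>2)"
        using xi ab by (intro mult_right_mono mult_left_mono powr_mono2) auto
      finally show ?thesis .
    qed
    finally have "G 0 \<le> X * ((1 - \<xi>) powr (\<alpha> + 3/2) * 2 powr (\<beta> + 3/2) * ((y1 \<xi>)\<^sup>2 / N\<^sup>2))"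
      by (simp add: X_def)
    also have "\<dots> = C * (1 - \<xi>) powr (\<alpha> + 3/2) * (y1 \<xi>)\<^sup>2 * e"
      using c N0 by (simp add: C_def e_def)
    finally show ?thesis using xe by (simp add: G_def e_def N_def)
  qed
  then show thesis by (rule that[OF C0])
qed

section \<open>Size of the fundamental polynomials\<close>

lemma powr_le_of_ratio:
  fixes p S s :: real
  assumes "S > 0" "S / 2 \<le> p" "p \<le> 2 * S"
  shows "p powr s \<le> 2 powr \<bar>s\<bar> * S powr s"
proof -
  have p: "p > 0" using assms by linarith
  show ?thesis
  proof (cases "s \<ge> 0")
    case True
    have "p powr s \<le> (2 * S) powr s" using p assms True by (intro powr_mono2) auto
    then show ?thesis using True assms by (simp add: powr_mult)
  next
    case False
    have "p powr s \<le> (S / 2) powr s" using assms False by (intro powr_mono2') auto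
    also have "\<dots> = 2 powr \<bar>s\<bar> * S powr s" using False assms by (simp add: powr_divide powr_minus field_simps)
    finally show ?thesis .
  qed
qed

lemma powr_le_of_bounds:
  fixes P e s :: real
  assumes "0 < e" "e \<le> P" "P \<le> 2"
  shows "P powr s \<le> 2 powr \<bar>s\<bar> * max 1 (e powr s)"
proof (cases "s \<ge> 0")
  case True
  have "P powr s \<le> 2 powr s" using assms True by (intro powr_mono2) auto
  also have "\<dots> \<le> 2 powr s * max 1 (e powr s)" by simp
  finally show ?thesis using True by simp
next
  case False
  have "P powr s \<le> e powr s" using assms False by (intro powr_mono2') auto
  also have "\<dots> \<le> 1 * max 1 (e powr s)" by simp
  also have "\<dots> \<le> 2 powr \<bar>s\<bar> * max 1 (e powr s)"
    by (intro mult_right_mono ge_one_powr_ge_zero) (auto simp: le_max_iff_disj)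
  finally show ?thesis .
qed

text \<open>To be read with P and S as the distances of the argument and of a root from 1, cut off
  at e, with \<open>a = \<alpha> + 1/2\<close>, and with P + S in place of their mutual distance.
  After division by the square of the larger one, the extreme cases are S = e with negative a, of
  order \<open>e powr a\<close>, and P = e with a > 3, of order
  \<open>e powr (3 - a)\<close>.\<close>

lemma powr_ratio_bound_near:
  fixes e P S a \<rho> :: real
  assumes e: "0 < e" "e \<le> 1" and P: "e \<le> P" "P \<le> 2" and S: "e \<le> S" "S \<le> 2"
    and \<rho>: "\<rho> \<ge> 0" "\<rho> \<ge> - a" "\<rho> \<ge> a - 3"
  shows "P powr (2 - a) * S powr (a - 1) * e \<le> 2 powr (\<bar>a\<bar> + \<bar>a - 3\<bar>) * e powr (- \<rho>) * (P + S)\<^sup>2"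
proof -
  have pos: "P > 0" "S > 0" using e P S by auto
  have e\<rho>: "e powr u \<le> e powr (- \<rho>)" if "u \<ge> - \<rho>" for u using e that by (intro powr_mono') auto
  have e1: "1 \<le> e powr (- \<rho>)" using e\<rho>[of 0] \<rho>(1) e by simp
  have two: "1 \<le> 2 powr (\<bar>a\<bar> + \<bar>a - 3\<bar>)" by (intro ge_one_powr_ge_zero) auto
  have Sinv: "S powr u * S powr v * e = e / S" if "u + v = -1" for u v
  proof -
    have "S powr u * S powr v = S powr (- 1)" unfolding that[symmetric] by (simp only: powr_add)
    also have "\<dots> = 1 / S" using pos by (simp add: powr_minus divide_inverse)
    finally show ?thesis by simp
  qed
  have tw: "2 powr s \<le> 2 powr (\<bar>a\<bar> + \<bar>a - 3\<bar>)" if "s \<le> \<bar>a\<bar> + \<bar>a - 3\<bar>" for s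
    using that by (intro powr_mono) auto
  define R where "R = 2 powr (\<bar>a\<bar> + \<bar>a - 3\<bar>) * e powr (- \<rho>)"
  have R1: "1 \<le> R" unfolding R_def using mult_mono[OF two e1] by simp
  show ?thesis
  proof (cases "S \<le> P")
    case True
    have "P powr (- a) * S powr (a - 1) * e \<le> R"
    proof (cases "a \<ge> 0")
      case True
      then have "P powr (- a) \<le> S powr (- a)" using \<open>S \<le> P\<close> pos by (intro powr_mono2') auto
      then have "P powr (- a) * S powr (a - 1) * e \<le> S powr (- a) * S powr (a - 1) * e"
        using e by (intro mult_right_mono) auto
      also have "\<dots> = e / S" by (rule Sinv) simp
      also have "\<dots> \<le> 1" using S pos by simp
      finally show ?thesis using R1 by linarith
    next
      case False
      have "P powr (- a) \<le> 2 powr (- a)" using False pos P by (intro powr_mono2) auto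
      moreover have "S powr (a - 1) \<le> e powr (a - 1)" using False S e by (intro powr_mono2') auto
      ultimately have "P powr (- a) * S powr (a - 1) * e \<le> 2 powr (- a) * e powr (a - 1) * e"
        using e by (intro mult_right_mono mult_mono) auto
      also have "\<dots> = 2 powr (- a) * e powr a" using e powr_add[of e "a - 1" 1] by simp
      also have "\<dots> \<le> R" unfolding R_def using \<rho> False by (intro mult_mono tw e\<rho>) auto
      finally show ?thesis .
    qed
    then have "P\<^sup>2 * (P powr (- a) * S powr (a - 1) * e) \<le> P\<^sup>2 * R" by (intro mult_left_mono) auto
    also have "\<dots> \<le> (P + S)\<^sup>2 * R" using pos R1 by (intro mult_right_mono power_mono) auto
    also have "P\<^sup>2 * (P powr (- a) * S powr (a - 1) * e) = P powr (2 - a) * S powr (a - 1) * e"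
    proof -
      have "P powr (2 - a) = P\<^sup>2 * P powr (- a)" using pos powr_add[of P 2 "- a"] by simp
      then show ?thesis by simp
    qed
    finally show ?thesis by (simp add: R_def mult_ac)
  next
    case False
    have "P powr (2 - a) * S powr (a - 3) * e \<le> R"
    proof (cases "a \<le> 2")
      case True
      then have "P powr (2 - a) \<le> S powr (2 - a)" using False pos by (intro powr_mono2) auto
      then have "P powr (2 - a) * S powr (a - 3) * e \<le> S powr (2 - a) * S powr (a - 3) * e"
        using e by (intro mult_right_mono) auto
      also have "\<dots> = e / S" by (rule Sinv) simp
      also have "\<dots> \<le> 1" using S pos by simp
      finally show ?thesis using R1 by linarith
    next
      case a2: False
      have "P powr (2 - a) \<le> e powr (2 - a)" using a2 P e by (intro powr_mono2') auto
      moreover have "S powr (a - 3) \<le> 2 powr \<bar>a - 3\<bar> * max 1 (e powr (a - 3))"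
        by (rule powr_le_of_bounds) (use e S in auto)
      ultimately have "P powr (2 - a) * S powr (a - 3) * e \<le> e powr (2 - a) * (2 powr \<bar>a - 3\<bar> * max 1 (e powr (a - 3))) * e"
        using e by (intro mult_right_mono mult_mono) auto
      also have "\<dots> = 2 powr \<bar>a - 3\<bar> * max (e powr (3 - a)) 1"
      proof -
        have e3: "e powr (2 - a) * e = e powr (3 - a)" using e powr_add[of e "2 - a" 1] by simp
        have "e powr (3 - a) * max 1 (e powr (a - 3)) = max (e powr (3 - a) * 1) (e powr (3 - a) * e powr (a - 3))"
          by (rule max_mult_distrib_left[THEN trans]) simp
        also have "e powr (3 - a) * e powr (a - 3) = 1" using e by (simp add: powr_add[symmetric])
        finally have m: "e powr (3 - a) * max 1 (e powr (a - 3)) = max (e powr (3 - a)) 1" by simp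
        have "e powr (2 - a) * (T * M) * e = T * (e powr (2 - a) * e * M)" for T M by (simp only: mult_ac)
        then show ?thesis by (simp only: e3 m)
      qed
      also have "\<dots> \<le> R" unfolding R_def using \<rho> e1 by (intro mult_mono tw) (auto intro: e\<rho> simp: le_max_iff_disj)
      finally show ?thesis .
    qed
    then have "S\<^sup>2 * (P powr (2 - a) * S powr (a - 3) * e) \<le> S\<^sup>2 * R" by (intro mult_left_mono) auto
    also have "\<dots> \<le> (P + S)\<^sup>2 * R" using pos R1 by (intro mult_right_mono power_mono) auto
    also have "S\<^sup>2 * (P powr (2 - a) * S powr (a - 3) * e) = P powr (2 - a) * S powr (a - 1) * e"
    proof -
      have "S powr (a - 1) = S\<^sup>2 * S powr (a - 3)" using pos powr_add[of S 2 "a - 3"] by simp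
      then show ?thesis by simp
    qed
    finally show ?thesis by (simp add: R_def mult_ac)
  qed
qed

text \<open>Up to constants each of the two powers is largest at an end of \<open>{e..2}\<close>;
  the four combinations of ends are the four conditions on \<rho>.\<close>

lemma powr_product_bound:
  fixes e P S u v w \<rho> :: real
  assumes e: "0 < e" "e \<le> 1" and P: "e \<le> P" "P \<le> 2" and S: "e \<le> S" "S \<le> 2"
    and \<rho>: "w \<ge> - \<rho>" "u + w \<ge> - \<rho>" "v + w \<ge> - \<rho>" "u + v + w \<ge> - \<rho>"
  shows "P powr u * S powr v * e powr w \<le> 2 powr (\<bar>u\<bar> + \<bar>v\<bar>) * e powr (- \<rho>)"
proof -
  have e\<rho>: "e powr z \<le> e powr (- \<rho>)" if "z \<ge> - \<rho>" for z using e that by (intro powr_mono') auto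
  have "P powr u * S powr v * e powr w
      \<le> (2 powr \<bar>u\<bar> * max 1 (e powr u)) * (2 powr \<bar>v\<bar> * max 1 (e powr v)) * e powr w"
    by (intro mult_right_mono mult_mono powr_le_of_bounds) (use e P S in auto)
  also have "\<dots> = 2 powr (\<bar>u\<bar> + \<bar>v\<bar>) * (max 1 (e powr u) * max 1 (e powr v) * e powr w)"
    by (simp add: powr_add)
  also have "max 1 (e powr u) * max 1 (e powr v) * e powr w \<le> e powr (- \<rho>)"
    using e\<rho>[OF \<rho>(1)] e\<rho>[OF \<rho>(2)] e\<rho>[OF \<rho>(3)] e\<rho>[OF \<rho>(4)] e
    by (auto simp: max_def powr_add)
  finally show ?thesis by (simp add: mult_left_mono)
qed

section \<open>Fundamental polynomials in terms of solutions of the equation\<close>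

lemma jacobi_shift_commute: "jacobi_shift \<beta> \<alpha> n = jacobi_shift \<alpha> \<beta> n"
  by (simp add: jacobi_shift_def add.commute)

text \<open>The reflection fixes 0, so the energy there is a common unit for both halves of the
  interval.\<close>

lemma jacobi_energy_reflect_0:
  "jacobi_energy \<beta> \<alpha> n (\<lambda>x. y (- x)) (\<lambda>x. - y1 (- x)) 0 = jacobi_energy \<alpha> \<beta> n y y1 0"
proof -
  have "liouville_mu \<beta> \<alpha> 0 * y 0 - y1 0 = - (liouville_mu \<alpha> \<beta> 0 * y 0 + y1 0)"
    by (simp add: liouville_mu_def algebra_simps)
  then have "(liouville_mu \<beta> \<alpha> 0 * y 0 - y1 0)\<^sup>2 = (liouville_mu \<alpha> \<beta> 0 * y 0 + y1 0)\<^sup>2"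
    by (simp only: power2_minus)
  then show ?thesis by (simp add: jacobi_energy_def jacobi_shift_commute[of \<beta> \<alpha>])
qed

lemma jacobi_value_bound_both:
  assumes ab: "\<alpha> > -1" "\<beta> > -1"
    and c: "0 < c" "c \<le> endpoint_scale \<alpha> \<beta>" "c \<le> endpoint_scale \<beta> \<alpha>"
  obtains C where "C > 0"
    "\<And>n y y1 y2 t. n \<ge> 1 \<Longrightarrow> jacobi_ode \<alpha> \<beta> n y y1 y2 \<Longrightarrow> 0 \<le> t \<Longrightarrow> t \<le> 1 \<Longrightarrow>
     (y t)\<^sup>2 * max (1 - t) (c / (jacobi_shift \<alpha> \<beta> n)\<^sup>2) powr (\<alpha> + 1/2) \<le> C * jacobi_energy \<alpha> \<beta> n y y1 0"
    "\<And>n y y1 y2 t. n \<ge> 1 \<Longrightarrow> jacobi_ode \<alpha> \<beta> n y y1 y2 \<Longrightarrow> -1 \<le> t \<Longrightarrow> t \<le> 0 \<Longrightarrow>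
     (y t)\<^sup>2 * max (1 + t) (c / (jacobi_shift \<alpha> \<beta> n)\<^sup>2) powr (\<beta> + 1/2) \<le> C * jacobi_energy \<alpha> \<beta> n y y1 0"
proof -
  obtain C1 where C1: "C1 > 0"
    "\<And>n y y1 y2 t. n \<ge> 1 \<Longrightarrow> jacobi_ode \<alpha> \<beta> n y y1 y2 \<Longrightarrow> 0 \<le> t \<Longrightarrow> t \<le> 1 \<Longrightarrow>
     (y t)\<^sup>2 * max (1 - t) (c / (jacobi_shift \<alpha> \<beta> n)\<^sup>2) powr (\<alpha> + 1/2) \<le> C1 * jacobi_energy \<alpha> \<beta> n y y1 0"
    by (rule jacobi_value_bound[OF ab c(1,2)]) blast
  obtain C2 where C2: "C2 > 0"
    "\<And>n y y1 y2 t. n \<ge> 1 \<Longrightarrow> jacobi_ode \<beta> \<alpha> n y y1 y2 \<Longrightarrow> 0 \<le> t \<Longrightarrow> t \<le> 1 \<Longrightarrow>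
     (y t)\<^sup>2 * max (1 - t) (c / (jacobi_shift \<beta> \<alpha> n)\<^sup>2) powr (\<beta> + 1/2) \<le> C2 * jacobi_energy \<beta> \<alpha> n y y1 0"
    by (rule jacobi_value_bound[OF ab(2,1) c(1,3)]) blast
  have E: "jacobi_energy \<alpha> \<beta> n y y1 0 \<ge> 0" for n y y1 by (rule jacobi_energy_nonneg) auto
  show thesis
  proof (rule that[of "C1 + C2"])
    show "C1 + C2 > 0" using C1 C2 by simp
    fix n :: nat and y y1 y2 :: "real \<Rightarrow> real" and t :: real
    assume n: "n \<ge> 1" and ode: "jacobi_ode \<alpha> \<beta> n y y1 y2"
    have le: "C1 * jacobi_energy \<alpha> \<beta> n y y1 0 \<le> (C1 + C2) * jacobi_energy \<alpha> \<beta> n y y1 0"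
        "C2 * jacobi_energy \<alpha> \<beta> n y y1 0 \<le> (C1 + C2) * jacobi_energy \<alpha> \<beta> n y y1 0"
      using C1(1) C2(1) E by (auto intro!: mult_right_mono)
    show "(y t)\<^sup>2 * max (1 - t) (c / (jacobi_shift \<alpha> \<beta> n)\<^sup>2) powr (\<alpha> + 1/2) \<le> (C1 + C2) * jacobi_energy \<alpha> \<beta> n y y1 0"
      if "0 \<le> t" "t \<le> 1"
      using C1(2)[OF n ode that] le by linarith
    show "(y t)\<^sup>2 * max (1 + t) (c / (jacobi_shift \<alpha> \<beta> n)\<^sup>2) powr (\<beta> + 1/2) \<le> (C1 + C2) * jacobi_energy \<alpha> \<beta> n y y1 0"
      if "-1 \<le> t" "t \<le> 0"
      using C2(2)[OF n jacobi_ode_reflect[OF ode], of "- t"] that le(2)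
      unfolding jacobi_energy_reflect_0 jacobi_shift_commute[of \<beta> \<alpha>] by simp
  qed
qed

text \<open>Twice the fundamental polynomial of the node 1 is \<open>(1 + t) * y t / y 1\<close>.
  With a and b the parameters increased by 1/2, and P the cut-off distance of t from the nearer end
  point, its square has at most the order \<open>P powr (- a) * e powr a\<close> for
  \<open>t \<ge> 0\<close> and \<open>P powr (2 - b) * e powr a\<close> for negative t. The value P
  = e in the latter is the source of \<open>\<beta> - \<alpha> - 2\<close>.\<close>

lemma jacobi_endpoint_basis_bound:
  assumes ab: "\<alpha> > -1" "\<beta> > -1"
    and c: "0 < c" "c \<le> endpoint_scale \<alpha> \<beta>" "c \<le> endpoint_scale \<beta> \<alpha>"
    and \<rho>: "\<rho> \<ge> 0" "\<rho> \<ge> - (\<alpha> + 1/2)" "\<rho> \<ge> \<beta> - \<alpha> - 2"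
  obtains C where "C > 0" "\<And>n y y1 y2 t. n \<ge> 1 \<Longrightarrow> jacobi_ode \<alpha> \<beta> n y y1 y2 \<Longrightarrow> -1 \<le> t \<Longrightarrow> t \<le> 1 \<Longrightarrow>
     ((1 + t) * y t)\<^sup>2 \<le> C * (c / (jacobi_shift \<alpha> \<beta> n)\<^sup>2) powr (- \<rho>) * (y 1)\<^sup>2"
proof -
  obtain C1 where C1: "C1 > 0"
    "\<And>n y y1 y2 t. n \<ge> 1 \<Longrightarrow> jacobi_ode \<alpha> \<beta> n y y1 y2 \<Longrightarrow> 0 \<le> t \<Longrightarrow> t \<le> 1 \<Longrightarrow>
     (y t)\<^sup>2 * max (1 - t) (c / (jacobi_shift \<alpha> \<beta> n)\<^sup>2) powr (\<alpha> + 1/2) \<le> C1 * jacobi_energy \<alpha> \<beta> n y y1 0"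
    "\<And>n y y1 y2 t. n \<ge> 1 \<Longrightarrow> jacobi_ode \<alpha> \<beta> n y y1 y2 \<Longrightarrow> -1 \<le> t \<Longrightarrow> t \<le> 0 \<Longrightarrow>
     (y t)\<^sup>2 * max (1 + t) (c / (jacobi_shift \<alpha> \<beta> n)\<^sup>2) powr (\<beta> + 1/2) \<le> C1 * jacobi_energy \<alpha> \<beta> n y y1 0"
    by (rule jacobi_value_bound_both[OF ab c]) blast
  obtain C3 where C3: "C3 > 0" "\<And>n y y1 y2. n \<ge> 1 \<Longrightarrow> jacobi_ode \<alpha> \<beta> n y y1 y2 \<Longrightarrow>
     jacobi_energy \<alpha> \<beta> n y y1 0 \<le> C3 * (c / (jacobi_shift \<alpha> \<beta> n)\<^sup>2) powr (\<alpha> + 1/2) * (y 1)\<^sup>2"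
    by (rule jacobi_endpoint_value_lower[OF ab c(1,2)]) blast
  define a b where "a = \<alpha> + 1/2" and "b = \<beta> + 1/2"
  define C where "C = 4 * (C1 * C3) * (2 powr \<bar>a\<bar> + 2 powr \<bar>2 - b\<bar>)"
  have C0: "C > 0" using C1(1) C3(1) by (simp add: C_def add_pos_pos)
  have "((1 + t) * y t)\<^sup>2 \<le> C * (c / (jacobi_shift \<alpha> \<beta> n)\<^sup>2) powr (- \<rho>) * (y 1)\<^sup>2"
    if n: "n \<ge> 1" and ode: "jacobi_ode \<alpha> \<beta> n y y1 y2" and t: "-1 \<le> t" "t \<le> 1" for n y y1 y2 t
  proof -
    define e where "e = c / (jacobi_shift \<alpha> \<beta> n)\<^sup>2"
    define G0 where "G0 = jacobi_energy \<alpha> \<beta> n y y1 0"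
    have c4: "c \<le> 1/4" using c by (simp add: endpoint_scale_def)
    have e: "0 < e" "e \<le> 1" unfolding e_def using endpoint_width[OF ab n c(1) c4] by auto
    have G0: "C1 * G0 \<le> C1 * C3 * (e powr a * (y 1)\<^sup>2)"
      using mult_left_mono[OF C3(2)[OF n ode], of C1] C1(1) by (simp add: G0_def e_def a_def mult_ac)
    have fin: "4 * (C1 * C3) * X * (e powr (- \<rho>) * (y 1)\<^sup>2) \<le> C * e powr (- \<rho>) * (y 1)\<^sup>2"
      if "X \<le> 2 powr \<bar>a\<bar> + 2 powr \<bar>2 - b\<bar>" for X
    proof -
      have "4 * (C1 * C3) * X * (e powr (- \<rho>) * (y 1)\<^sup>2) \<le> C * (e powr (- \<rho>) * (y 1)\<^sup>2)"
        unfolding C_def using that C1(1) C3(1) by (intro mult_right_mono mult_left_mono) auto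
      then show ?thesis by (simp add: mult_ac)
    qed
    show ?thesis
    proof (cases "t \<ge> 0")
      case True
      define P where "P = max (1 - t) e"
      have P: "e \<le> P" "P \<le> 2" "P > 0" using e t True by (auto simp: P_def)
      have "((1 + t) * y t)\<^sup>2 \<le> 4 * (y t)\<^sup>2"
      proof -
        have "(1 + t)\<^sup>2 \<le> 2\<^sup>2" using t True by (intro power_mono) auto
        then show ?thesis unfolding power_mult_distrib by (intro mult_right_mono) auto
      qed
      also have "4 * (y t)\<^sup>2 = 4 * P powr (- a) * ((y t)\<^sup>2 * P powr a)"
        using P by (simp add: powr_minus)
      also have "\<dots> \<le> 4 * P powr (- a) * (C1 * G0)"
        using C1(2)[OF n ode True t(2)] by (intro mult_left_mono) (auto simp: P_def e_def G0_def a_def)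
      also have "\<dots> \<le> 4 * P powr (- a) * (C1 * C3 * (e powr a * (y 1)\<^sup>2))"
        using G0 by (intro mult_left_mono) auto
      \<comment> \<open>The factor \<open>1 powr 0\<close> fills the slot of the second base in
        \<open>powr_product_bound\<close>.\<close>
      also have "\<dots> = 4 * (C1 * C3) * (P powr (- a) * 1 powr 0 * e powr a) * (y 1)\<^sup>2" by simp
      also have "\<dots> \<le> 4 * (C1 * C3) * (2 powr (\<bar>- a\<bar> + \<bar>0\<bar>) * e powr (- \<rho>)) * (y 1)\<^sup>2"
        using C1(1) C3(1) \<rho> e P
        by (intro mult_left_mono mult_right_mono powr_product_bound) (auto simp: a_def)
      also have "\<dots> = 4 * (C1 * C3) * 2 powr \<bar>a\<bar> * (e powr (- \<rho>) * (y 1)\<^sup>2)" by simp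
      also have "\<dots> \<le> C * e powr (- \<rho>) * (y 1)\<^sup>2" by (rule fin) simp
      finally show ?thesis by (simp add: e_def)
    next
      case False
      define P where "P = max (1 + t) e"
      have P: "e \<le> P" "P \<le> 2" "P > 0" using e t False by (auto simp: P_def)
      have "((1 + t) * y t)\<^sup>2 \<le> P\<^sup>2 * (y t)\<^sup>2"
        unfolding power_mult_distrib using t by (intro mult_right_mono power_mono) (auto simp: P_def)
      also have "P\<^sup>2 * (y t)\<^sup>2 = P powr (2 - b) * ((y t)\<^sup>2 * P powr b)"
        using P powr_add[of P "2 - b" b] by simp
      also have "\<dots> \<le> P powr (2 - b) * (C1 * G0)"
        using C1(3)[OF n ode t(1)] False by (intro mult_left_mono) (auto simp: P_def e_def G0_def b_def)
      also have "\<dots> \<le> P powr (2 - b) * (C1 * C3 * (e powr a * (y 1)\<^sup>2))"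
        using G0 by (intro mult_left_mono) auto
      also have "\<dots> = (C1 * C3) * (P powr (2 - b) * 1 powr 0 * e powr a) * (y 1)\<^sup>2" by simp
      also have "\<dots> \<le> (C1 * C3) * (2 powr (\<bar>2 - b\<bar> + \<bar>0\<bar>) * e powr (- \<rho>)) * (y 1)\<^sup>2"
        using C1(1) C3(1) \<rho> e P
        by (intro mult_left_mono mult_right_mono powr_product_bound) (auto simp: a_def b_def)
      also have "\<dots> \<le> 4 * ((C1 * C3) * (2 powr (\<bar>2 - b\<bar> + \<bar>0\<bar>) * e powr (- \<rho>)) * (y 1)\<^sup>2)"
        using C1(1) C3(1) by (simp add: mult_nonneg_nonneg)
      also have "\<dots> = 4 * (C1 * C3) * 2 powr \<bar>2 - b\<bar> * (e powr (- \<rho>) * (y 1)\<^sup>2)" by simp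
      also have "\<dots> \<le> C * e powr (- \<rho>) * (y 1)\<^sup>2" by (rule fin) simp
      finally show ?thesis by (simp add: e_def)
    qed
  qed
  then show thesis by (rule that[OF C0])
qed

text \<open>For t within half the distance from \<xi> to 1 no power of n is lost. The Liouville
  function u vanishes at \<xi>, so \<open>u t\<close> is \<open>t - \<xi>\<close> times some value
  of u'; that value is controlled by the energy, hence by y1 at \<xi>, and the weights at t and
  \<xi> are comparable.\<close>

lemma jacobi_near_root_bound:
  assumes ab: "\<alpha> > -1" "\<beta> > -1" and c: "0 < c" "c \<le> endpoint_scale \<alpha> \<beta>"
  obtains C where "C > 0" "\<And>n y y1 y2 \<xi> t. n \<ge> 1 \<Longrightarrow> jacobi_ode \<alpha> \<beta> n y y1 y2 \<Longrightarrow> y 1 \<noteq> 0 \<Longrightarrow>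
     0 \<le> \<xi> \<Longrightarrow> \<xi> < 1 \<Longrightarrow> y \<xi> = 0 \<Longrightarrow> \<bar>t - \<xi>\<bar> \<le> (1 - \<xi>) / 2 \<Longrightarrow>
     ((1 - t\<^sup>2) * y t)\<^sup>2 \<le> C * ((1 - \<xi>) * y1 \<xi> * (t - \<xi>))\<^sup>2"
proof -
  obtain C2 where C2: "C2 > 0" "\<And>n y y1 y2 \<xi>. n \<ge> 1 \<Longrightarrow> jacobi_ode \<alpha> \<beta> n y y1 y2 \<Longrightarrow> y 1 \<noteq> 0 \<Longrightarrow>
     0 \<le> \<xi> \<Longrightarrow> \<xi> < 1 \<Longrightarrow> y \<xi> = 0 \<Longrightarrow>
     c / (jacobi_shift \<alpha> \<beta> n)\<^sup>2 \<le> 1 - \<xi> \<and>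
     jacobi_energy \<alpha> \<beta> n y y1 0
       \<le> C2 * (1 - \<xi>) powr (\<alpha> + 3/2) * (y1 \<xi>)\<^sup>2 * (c / (jacobi_shift \<alpha> \<beta> n)\<^sup>2)"
    by (rule jacobi_root_deriv_lower[OF ab c]) blast
  define a b where "a = \<alpha> + 1/2" and "b = \<beta> + 1/2"
  define X where "X = exp (4 * liouville_defect \<alpha> \<beta> / sqrt (c / 4))"
  define C where "C = 4 * c * (X * C2) * (2 powr \<bar>2 - a\<bar> * 2 powr \<bar>2 - b\<bar>)"
  have X0: "X > 0" by (simp add: X_def)
  have C0: "C > 0" using C2(1) c by (simp add: C_def X_def)
  have "((1 - t\<^sup>2) * y t)\<^sup>2 \<le> C * ((1 - \<xi>) * y1 \<xi> * (t - \<xi>))\<^sup>2"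
    if n: "n \<ge> 1" and ode: "jacobi_ode \<alpha> \<beta> n y y1 y2" and y1n: "y 1 \<noteq> 0"
      and xi: "0 \<le> \<xi>" "\<xi> < 1" "y \<xi> = 0" and t: "\<bar>t - \<xi>\<bar> \<le> (1 - \<xi>) / 2" for n y y1 y2 \<xi> t
  proof -
    define N where "N = jacobi_shift \<alpha> \<beta> n"
    define e where "e = c / N\<^sup>2"
    define G where "G = jacobi_energy \<alpha> \<beta> n y y1"
    define S where "S = 1 - \<xi>"
    have N0: "N > 0" unfolding N_def using jacobi_shift_pos[OF ab n] by simp
    have c4: "c \<le> 1/4" using c by (simp add: endpoint_scale_def)
    have e: "0 < e" "e \<le> 1" unfolding e_def N_def using endpoint_width[OF ab n c(1) c4] by auto
    have S: "0 < S" "S \<le> 1" "e \<le> S"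
      using xi C2(2)[OF n ode y1n xi] by (auto simp: S_def e_def N_def)
    have low: "G 0 \<le> C2 * S powr (a + 1) * (y1 \<xi>)\<^sup>2 * e"
      using C2(2)[OF n ode y1n xi] by (simp add: G_def S_def e_def N_def a_def add.assoc)
    define u where "u x = (1 - x) powr (a/2) * (1 + x) powr (b/2) * y x" for x
    \<comment> \<open>The derivative of u in x, not in the angle; the energy contains
      \<open>(1 - x\<^sup>2) * (u' x)\<^sup>2 / N\<^sup>2\<close>.\<close>
    define u' where "u' x = (1 - x) powr (a/2) * (1 + x) powr (b/2) * (liouville_mu \<alpha> \<beta> x * y x + y1 x)" for x
    have near: "S / 2 \<le> 1 - x" "1 - x \<le> 3/2 * S" "1/2 \<le> 1 + x" "1 + x \<le> 2" if "\<bar>x - \<xi>\<bar> \<le> S / 2" for x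
    proof -
      have "x - \<xi> \<le> S / 2" "\<xi> - x \<le> S / 2" using that by linarith+
      then show "S / 2 \<le> 1 - x" "1 - x \<le> 3/2 * S" "1/2 \<le> 1 + x" "1 + x \<le> 2"
        using S(1,2) xi(1) by (simp_all add: S_def)
    qed
    have du: "(u has_real_derivative u' x) (at x)" if "\<bar>x - \<xi>\<bar> \<le> S / 2" for x
    proof -
      have pos: "1 - x > 0" "1 + x > 0" using near[OF that] S by auto
      have dy: "(y has_real_derivative y1 x) (at x)" using ode by (simp add: jacobi_ode_def)
      have d1: "((\<lambda>x. (1 - x) powr s) has_real_derivative (- s / (1 - x)) * (1 - x) powr s) (at x)" for s
        using pos by (auto intro!: derivative_eq_intros simp: powr_diff field_simps)
      have d2: "((\<lambda>x. (1 + x) powr s) has_real_derivative (s / (1 + x)) * (1 + x) powr s) (at x)" for s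
        using pos by (auto intro!: derivative_eq_intros simp: powr_diff field_simps)
      have mu: "liouville_mu \<alpha> \<beta> x = (b/2) / (1 + x) - (a/2) / (1 - x)"
        unfolding liouville_mu_def a_def[symmetric] b_def[symmetric] by (simp add: divide_divide_eq_left)
      have alg: "(- (a/2) / P * A * B + (b/2) / Q * B * A) * z + w * (A * B)
          = A * B * (((b/2) / Q - (a/2) / P) * z + w)" for A B P Q z w :: real
        by (simp add: algebra_simps)
      have "((\<lambda>x. (1 - x) powr (a/2) * (1 + x) powr (b/2) * y x) has_real_derivative
          (- (a/2) / (1 - x) * (1 - x) powr (a/2) * (1 + x) powr (b/2)
            + (b/2) / (1 + x) * (1 + x) powr (b/2) * (1 - x) powr (a/2)) * y x
          + y1 x * ((1 - x) powr (a/2) * (1 + x) powr (b/2))) (at x)"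
        by (rule DERIV_mult[OF DERIV_mult[OF d1 d2] dy])
      moreover have "(- (a/2) / (1 - x) * (1 - x) powr (a/2) * (1 + x) powr (b/2)
            + (b/2) / (1 + x) * (1 + x) powr (b/2) * (1 - x) powr (a/2)) * y x
          + y1 x * ((1 - x) powr (a/2) * (1 + x) powr (b/2)) = u' x"
        unfolding u'_def mu by (rule alg)
      ultimately show ?thesis unfolding u_def[abs_def] by (simp only:)
    qed
    have u'b: "(u' x)\<^sup>2 \<le> 4 * c * X * G 0 / (e * S)" if x: "\<bar>x - \<xi>\<bar> \<le> S / 2" for x
    proof -
      note nx = near[OF x]
      have pq: "1 - x\<^sup>2 = (1 - x) * (1 + x)" by (simp add: power2_eq_square algebra_simps)
      have "S / 2 * (1/2) \<le> (1 - x) * (1 + x)" using nx S by (intro mult_mono) auto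
      then have s4: "S / 4 \<le> 1 - x\<^sup>2" unfolding pq by simp
      \<comment> \<open>On this segment only \<open>1 - x\<^sup>2 \<ge> S / 4\<close> is guaranteed,
        so the comparison is made with \<open>c / 4\<close> in place of c.\<close>
      have Gx: "G x \<le> X * G 0"
        unfolding G_def X_def
      proof (rule jacobi_energy_compare'[OF ab n ode])
        have e4: "c / 4 / N\<^sup>2 = e / 4" by (simp add: e_def)
        show "c / 4 > 0" using c by simp
        show "c / 4 / (jacobi_shift \<alpha> \<beta> n)\<^sup>2 \<le> 1 - x\<^sup>2"
          unfolding N_def[symmetric] e4 using s4 S by linarith
        show "c / 4 / (jacobi_shift \<alpha> \<beta> n)\<^sup>2 \<le> 1 - 0\<^sup>2"
          unfolding N_def[symmetric] e4 using e by simp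
      qed
      have sq: "((1 - x) powr (a/2))\<^sup>2 = (1 - x) powr a" "((1 + x) powr (b/2))\<^sup>2 = (1 + x) powr b"
        by (simp_all add: power2_eq_square powr_add[symmetric])
      have "(u' x)\<^sup>2 * ((1 - x\<^sup>2) / N\<^sup>2)
          = (1 - x) powr a * (1 + x) powr b * ((1 - x\<^sup>2) * (liouville_mu \<alpha> \<beta> x * y x + y1 x)\<^sup>2 / N\<^sup>2)"
        by (simp add: u'_def power_mult_distrib sq)
      also have "\<dots> \<le> (1 - x) powr a * (1 + x) powr b * ((y x)\<^sup>2 + (1 - x\<^sup>2) * (liouville_mu \<alpha> \<beta> x * y x + y1 x)\<^sup>2 / N\<^sup>2)"
        by (intro mult_left_mono) auto
      also have "\<dots> = G x" by (simp add: G_def jacobi_energy_def a_def b_def N_def)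
      finally have "(u' x)\<^sup>2 * ((1 - x\<^sup>2) / N\<^sup>2) \<le> X * G 0" using Gx by linarith
      moreover have "(u' x)\<^sup>2 * ((S / 4) / N\<^sup>2) \<le> (u' x)\<^sup>2 * ((1 - x\<^sup>2) / N\<^sup>2)"
        using s4 by (intro mult_left_mono divide_right_mono) auto
      ultimately have "(u' x)\<^sup>2 * ((S / 4) / N\<^sup>2) \<le> X * G 0" by linarith
      moreover have "(u' x)\<^sup>2 * ((S / 4) / N\<^sup>2) = (u' x)\<^sup>2 * (e * S) / (4 * c)"
        using c by (simp add: e_def)
      ultimately have "(u' x)\<^sup>2 * (e * S) / (4 * c) \<le> X * G 0" by (simp only:)
      then have "(u' x)\<^sup>2 * (e * S) \<le> X * G 0 * (4 * c)" using c by (subst (asm) pos_divide_le_eq) auto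
      then have "(u' x)\<^sup>2 \<le> X * G 0 * (4 * c) / (e * S)" using e S by (subst pos_le_divide_eq) auto
      then show ?thesis by (simp only: mult_ac)
    qed
    have ut: "(u t)\<^sup>2 \<le> 4 * c * X * G 0 / (e * S) * (t - \<xi>)\<^sup>2"
    proof (cases "t = \<xi>")
      case True then show ?thesis using xi(3) by (simp add: u_def)
    next
      case False
      define l r where "l = min t \<xi>" and "r = max t \<xi>"
      have lr: "l < r" using False by (auto simp: l_def r_def)
      have seg: "\<bar>x - \<xi>\<bar> \<le> S / 2" if "l \<le> x" "x \<le> r" for x
        using that t unfolding l_def r_def S_def by (auto simp: abs_le_iff min_def max_def split: if_splits)
      obtain z where z: "z > l" "z < r" "u r - u l = (r - l) * u' z"
        using MVT2[OF lr, of u u'] du seg by blast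
      have u0: "u \<xi> = 0" using xi(3) by (simp add: u_def)
      have "(u t)\<^sup>2 = (u r - u l)\<^sup>2"
        unfolding l_def r_def using u0 by (cases "t \<le> \<xi>") auto
      also have "\<dots> = (u' z)\<^sup>2 * (t - \<xi>)\<^sup>2"
        unfolding z(3) unfolding l_def r_def by (cases "t \<le> \<xi>") (auto simp: power_mult_distrib power2_commute)
      also have "\<dots> \<le> 4 * c * X * G 0 / (e * S) * (t - \<xi>)\<^sup>2"
        using seg[of z] z by (intro mult_right_mono u'b) auto
      finally show ?thesis .
    qed
    have "4 * c * X * G 0 / (e * S) \<le> 4 * c * X * (C2 * S powr (a + 1) * (y1 \<xi>)\<^sup>2 * e) / (e * S)"
      using low c X0 e S by (intro divide_right_mono mult_left_mono) auto
    also have "\<dots> = 4 * c * (X * C2) * (S powr a * (y1 \<xi>)\<^sup>2)"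
      using e S by (simp add: powr_add)
    finally have "4 * c * X * G 0 / (e * S) * (t - \<xi>)\<^sup>2 \<le> 4 * c * (X * C2) * (S powr a * (y1 \<xi>)\<^sup>2) * (t - \<xi>)\<^sup>2"
      by (intro mult_right_mono) auto
    with ut have ut2: "(u t)\<^sup>2 \<le> 4 * c * (X * C2) * (S powr a * (y1 \<xi>)\<^sup>2) * (t - \<xi>)\<^sup>2" by linarith
    note nt = near[OF t[folded S_def]]
    define p q where "p = 1 - t" and "q = 1 + t"
    have pq0: "p > 0" "q > 0" using nt S by (auto simp: p_def q_def)
    have "((1 - t\<^sup>2) * y t)\<^sup>2 = p powr (2 - a) * q powr (2 - b) * (u t)\<^sup>2"
    proof -
      have "1 - t\<^sup>2 = p * q" by (simp add: p_def q_def power2_eq_square algebra_simps)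
      moreover have "(u t)\<^sup>2 = p powr a * q powr b * (y t)\<^sup>2"
        by (simp add: u_def p_def q_def power_mult_distrib) (simp add: power2_eq_square powr_add[symmetric])
      moreover have "p powr (2 - a) * p powr a = p\<^sup>2" "q powr (2 - b) * q powr b = q\<^sup>2"
        using pq0 powr_add[of p "2 - a" a] powr_add[of q "2 - b" b] by simp_all
      then have "p\<^sup>2 * q\<^sup>2 * z = p powr (2 - a) * q powr (2 - b) * (p powr a * q powr b * z)" for z
        by (metis mult.assoc mult.left_commute)
      ultimately show ?thesis by (simp add: power_mult_distrib)
    qed
    also have "\<dots> \<le> (2 powr \<bar>2 - a\<bar> * S powr (2 - a)) * (2 powr \<bar>2 - b\<bar> * 1 powr (2 - b))
        * (4 * c * (X * C2) * (S powr a * (y1 \<xi>)\<^sup>2) * (t - \<xi>)\<^sup>2)"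
      by (intro mult_mono powr_le_of_ratio ut2) (use nt S in \<open>auto simp: p_def q_def\<close>)
    also have "\<dots> = C * ((S powr (2 - a) * S powr a) * (y1 \<xi>)\<^sup>2 * (t - \<xi>)\<^sup>2)"
      by (simp add: C_def mult_ac)
    also have "S powr (2 - a) * S powr a = S\<^sup>2" using S powr_add[of S "2 - a" a] by simp
    also have "C * (S\<^sup>2 * (y1 \<xi>)\<^sup>2 * (t - \<xi>)\<^sup>2) = C * ((1 - \<xi>) * y1 \<xi> * (t - \<xi>))\<^sup>2"
      by (simp add: S_def power_mult_distrib)
    finally show ?thesis .
  qed
  then show thesis by (rule that[OF C0])
qed

text \<open>The general bound for y is divided by the lower bound for y1 at \<xi>. With a and b the
  parameters increased by 1/2, S the distance of \<xi> from 1 and P the cut-off distance of t from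
  the nearer end point, this gives \<open>P powr (2 - a) * S powr (a - 1) * e\<close> for
  \<open>t \<ge> 0\<close>, and b in place of the first a for negative t, still to be compared with
  \<open>(t - \<xi>)\<^sup>2\<close>. The first is the source of \<open>\<alpha> - 5/2\<close>, the
  second of \<open>\<beta> - 5/2\<close> and \<open>\<beta> - \<alpha> - 2\<close>.\<close>

lemma jacobi_far_root_bound:
  assumes ab: "\<alpha> > -1" "\<beta> > -1"
    and c: "0 < c" "c \<le> endpoint_scale \<alpha> \<beta>" "c \<le> endpoint_scale \<beta> \<alpha>"
    and \<rho>: "\<rho> \<ge> 0" "\<rho> \<ge> - (\<alpha> + 1/2)" "\<rho> \<ge> \<alpha> - 5/2" "\<rho> \<ge> \<beta> - 5/2" "\<rho> \<ge> \<beta> - \<alpha> - 2"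
  obtains C where "C > 0" "\<And>n y y1 y2 \<xi> t. n \<ge> 1 \<Longrightarrow> jacobi_ode \<alpha> \<beta> n y y1 y2 \<Longrightarrow> y 1 \<noteq> 0 \<Longrightarrow>
     0 \<le> \<xi> \<Longrightarrow> \<xi> < 1 \<Longrightarrow> y \<xi> = 0 \<Longrightarrow> -1 \<le> t \<Longrightarrow> t \<le> 1 \<Longrightarrow> \<bar>t - \<xi>\<bar> \<ge> (1 - \<xi>) / 2 \<Longrightarrow>
     ((1 - t\<^sup>2) * y t)\<^sup>2 \<le> C * (c / (jacobi_shift \<alpha> \<beta> n)\<^sup>2) powr (- \<rho>) * ((1 - \<xi>) * y1 \<xi> * (t - \<xi>))\<^sup>2"
proof -
  obtain C1 where C1: "C1 > 0"
    "\<And>n y y1 y2 t. n \<ge> 1 \<Longrightarrow> jacobi_ode \<alpha> \<beta> n y y1 y2 \<Longrightarrow> 0 \<le> t \<Longrightarrow> t \<le> 1 \<Longrightarrow>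
     (y t)\<^sup>2 * max (1 - t) (c / (jacobi_shift \<alpha> \<beta> n)\<^sup>2) powr (\<alpha> + 1/2) \<le> C1 * jacobi_energy \<alpha> \<beta> n y y1 0"
    "\<And>n y y1 y2 t. n \<ge> 1 \<Longrightarrow> jacobi_ode \<alpha> \<beta> n y y1 y2 \<Longrightarrow> -1 \<le> t \<Longrightarrow> t \<le> 0 \<Longrightarrow>
     (y t)\<^sup>2 * max (1 + t) (c / (jacobi_shift \<alpha> \<beta> n)\<^sup>2) powr (\<beta> + 1/2) \<le> C1 * jacobi_energy \<alpha> \<beta> n y y1 0"
    by (rule jacobi_value_bound_both[OF ab c]) blast
  obtain C2 where C2: "C2 > 0" "\<And>n y y1 y2 \<xi>. n \<ge> 1 \<Longrightarrow> jacobi_ode \<alpha> \<beta> n y y1 y2 \<Longrightarrow> y 1 \<noteq> 0 \<Longrightarrow>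
     0 \<le> \<xi> \<Longrightarrow> \<xi> < 1 \<Longrightarrow> y \<xi> = 0 \<Longrightarrow>
     c / (jacobi_shift \<alpha> \<beta> n)\<^sup>2 \<le> 1 - \<xi> \<and>
     jacobi_energy \<alpha> \<beta> n y y1 0
       \<le> C2 * (1 - \<xi>) powr (\<alpha> + 3/2) * (y1 \<xi>)\<^sup>2 * (c / (jacobi_shift \<alpha> \<beta> n)\<^sup>2)"
    by (rule jacobi_root_deriv_lower[OF ab c(1,2)]) blast
  define a b where "a = \<alpha> + 1/2" and "b = \<beta> + 1/2"
  define A where "A = 2 powr (\<bar>a\<bar> + \<bar>a - 3\<bar>)"
  define B where "B = 2 powr (\<bar>2 - b\<bar> + \<bar>a - 1\<bar>)"
  define C where "C = 4 * (C1 * C2) * (49 * A + 9 * B)"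
  have C12: "C1 * C2 > 0" using C1(1) C2(1) by simp
  have AB: "A > 0" "B > 0" by (simp_all add: A_def B_def)
  have C0: "C > 0" using C12 AB by (simp add: C_def add_pos_pos)
  have "((1 - t\<^sup>2) * y t)\<^sup>2 \<le> C * (c / (jacobi_shift \<alpha> \<beta> n)\<^sup>2) powr (- \<rho>) * ((1 - \<xi>) * y1 \<xi> * (t - \<xi>))\<^sup>2"
    if n: "n \<ge> 1" and ode: "jacobi_ode \<alpha> \<beta> n y y1 y2" and y1n: "y 1 \<noteq> 0"
      and xi: "0 \<le> \<xi>" "\<xi> < 1" "y \<xi> = 0" and t: "-1 \<le> t" "t \<le> 1" "\<bar>t - \<xi>\<bar> \<ge> (1 - \<xi>) / 2" for n y y1 y2 \<xi> t
  proof -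
    define e where "e = c / (jacobi_shift \<alpha> \<beta> n)\<^sup>2"
    define G0 where "G0 = jacobi_energy \<alpha> \<beta> n y y1 0"
    define S where "S = 1 - \<xi>"
    define d where "d = \<bar>t - \<xi>\<bar>"
    have c4: "c \<le> 1/4" using c by (simp add: endpoint_scale_def)
    have e: "0 < e" "e \<le> 1" unfolding e_def using endpoint_width[OF ab n c(1) c4] by auto
    have S: "0 < S" "S \<le> 1" "e \<le> S" and low: "G0 \<le> C2 * S powr (a + 1) * (y1 \<xi>)\<^sup>2 * e"
      using xi C2(2)[OF n ode y1n xi] by (auto simp: S_def e_def a_def G0_def add.assoc)
    have "C1 * G0 \<le> C1 * (C2 * S powr (a + 1) * (y1 \<xi>)\<^sup>2 * e)"
      using low C1(1) by (intro mult_left_mono) auto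
    also have "S powr (a + 1) = S powr (a - 1) * S\<^sup>2"
      using S powr_add[of S "a - 1" 2] by (simp add: add.commute)
    finally have low2: "C1 * G0 \<le> C1 * C2 * (S powr (a - 1) * e) * (S\<^sup>2 * (y1 \<xi>)\<^sup>2)" by (simp add: mult_ac)
    have pq: "(1 - t\<^sup>2)\<^sup>2 = (1 - t)\<^sup>2 * (1 + t)\<^sup>2"
    proof -
      have "1 - t\<^sup>2 = (1 - t) * (1 + t)" by (simp add: power2_eq_square algebra_simps)
      then show ?thesis by (simp only: power_mult_distrib)
    qed
    have main: "((1 - t\<^sup>2) * y t)\<^sup>2 \<le> 4 * (P powr (2 - s) * (S powr (a - 1) * e)) * (C1 * C2) * (S\<^sup>2 * (y1 \<xi>)\<^sup>2)"
      if P: "P > 0" "(1 - t\<^sup>2)\<^sup>2 \<le> 4 * P\<^sup>2" and yP: "(y t)\<^sup>2 * P powr s \<le> C1 * G0" for P s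
    proof -
      have "((1 - t\<^sup>2) * y t)\<^sup>2 \<le> 4 * P\<^sup>2 * (y t)\<^sup>2"
        unfolding power_mult_distrib by (intro mult_right_mono P(2)) auto
      also have "\<dots> = 4 * P powr (2 - s) * ((y t)\<^sup>2 * P powr s)"
        using P(1) powr_add[of P "2 - s" s] by simp
      also have "\<dots> \<le> 4 * P powr (2 - s) * (C1 * C2 * (S powr (a - 1) * e) * (S\<^sup>2 * (y1 \<xi>)\<^sup>2))"
        using yP low2 by (intro mult_left_mono) auto
      finally show ?thesis by (simp add: mult_ac)
    qed
    have fin: "4 * (Y * e powr (- \<rho>) * Z) * (C1 * C2) * (S\<^sup>2 * (y1 \<xi>)\<^sup>2)
        \<le> C * e powr (- \<rho>) * ((1 - \<xi>) * y1 \<xi> * (t - \<xi>))\<^sup>2"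
      if "Y * Z \<le> (49 * A + 9 * B) * d\<^sup>2" for Y Z
    proof -
      have "4 * (Y * e powr (- \<rho>) * Z) * (C1 * C2) * (S\<^sup>2 * (y1 \<xi>)\<^sup>2)
          = (Y * Z) * (4 * e powr (- \<rho>) * (C1 * C2) * (S\<^sup>2 * (y1 \<xi>)\<^sup>2))" by (simp add: mult_ac)
      also have "\<dots> \<le> ((49 * A + 9 * B) * d\<^sup>2) * (4 * e powr (- \<rho>) * (C1 * C2) * (S\<^sup>2 * (y1 \<xi>)\<^sup>2))"
        using that C12 by (intro mult_right_mono) auto
      also have "\<dots> = C * e powr (- \<rho>) * ((1 - \<xi>) * y1 \<xi> * (t - \<xi>))\<^sup>2"
        by (simp add: C_def d_def S_def power_mult_distrib mult_ac)
      finally show ?thesis .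
    qed
    show ?thesis
    proof (cases "t \<ge> 0")
      case True
      define P where "P = max (1 - t) e"
      have P: "e \<le> P" "P \<le> 2" "P > 0" using e t True by (auto simp: P_def)
      have "((1 - t\<^sup>2) * y t)\<^sup>2 \<le> 4 * (P powr (2 - a) * (S powr (a - 1) * e)) * (C1 * C2) * (S\<^sup>2 * (y1 \<xi>)\<^sup>2)"
      proof (rule main[OF P(3)])
        have "(1 - t)\<^sup>2 * (1 + t)\<^sup>2 \<le> P\<^sup>2 * 2\<^sup>2"
          using t True by (intro mult_mono power_mono) (auto simp: P_def)
        then show "(1 - t\<^sup>2)\<^sup>2 \<le> 4 * P\<^sup>2" unfolding pq by simp
        show "(y t)\<^sup>2 * P powr a \<le> C1 * G0"
          using C1(2)[OF n ode True t(2)] by (simp add: P_def e_def G0_def a_def)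
      qed
      also have "\<dots> \<le> 4 * (A * e powr (- \<rho>) * (P + S)\<^sup>2) * (C1 * C2) * (S\<^sup>2 * (y1 \<xi>)\<^sup>2)"
      proof -
        have "P powr (2 - a) * S powr (a - 1) * e \<le> A * e powr (- \<rho>) * (P + S)\<^sup>2"
          unfolding A_def by (rule powr_ratio_bound_near) (use e P S \<rho> in \<open>auto simp: a_def\<close>)
        then show ?thesis using C12 by (intro mult_right_mono mult_left_mono) (auto simp: mult.assoc)
      qed
      also have "\<dots> \<le> C * e powr (- \<rho>) * ((1 - \<xi>) * y1 \<xi> * (t - \<xi>))\<^sup>2"
      proof (rule fin)
        \<comment> \<open>Here \<open>S \<le> 2 * d\<close>, \<open>1 - t \<le> S + d\<close> and
          \<open>e \<le> S\<close>, so P + S is bounded by a multiple of the distance d.\<close>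
        have "P + S \<le> 7 * d"
          using t(3) S unfolding P_def d_def S_def by (auto simp: abs_if max_def split: if_splits)
        then have "(P + S)\<^sup>2 \<le> (7 * d)\<^sup>2" using P S by (intro power_mono) auto
        then have "A * (P + S)\<^sup>2 \<le> A * (49 * d\<^sup>2)" using AB by (intro mult_left_mono) (auto simp: power_mult_distrib)
        also have "\<dots> \<le> (49 * A + 9 * B) * d\<^sup>2" using AB by (simp add: algebra_simps)
        finally show "A * (P + S)\<^sup>2 \<le> (49 * A + 9 * B) * d\<^sup>2" .
      qed
      finally show ?thesis by (simp add: e_def)
    next
      case False
      define P where "P = max (1 + t) e"
      have P: "e \<le> P" "P \<le> 2" "P > 0" using e t False by (auto simp: P_def)
      have "((1 - t\<^sup>2) * y t)\<^sup>2 \<le> 4 * (P powr (2 - b) * (S powr (a - 1) * e)) * (C1 * C2) * (S\<^sup>2 * (y1 \<xi>)\<^sup>2)"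
      proof (rule main[OF P(3)])
        have "(1 + t)\<^sup>2 * (1 - t)\<^sup>2 \<le> P\<^sup>2 * 2\<^sup>2"
          using t by (intro mult_mono power_mono) (auto simp: P_def)
        then show "(1 - t\<^sup>2)\<^sup>2 \<le> 4 * P\<^sup>2" unfolding pq by (simp add: mult_ac)
        show "(y t)\<^sup>2 * P powr b \<le> C1 * G0"
          using C1(3)[OF n ode t(1)] False by (simp add: P_def e_def G0_def b_def)
      qed
      also have "\<dots> \<le> 4 * (B * e powr (- \<rho>) * 1) * (C1 * C2) * (S\<^sup>2 * (y1 \<xi>)\<^sup>2)"
      proof -
        have "P powr (2 - b) * S powr (a - 1) * e powr 1 \<le> B * e powr (- \<rho>)"
          unfolding B_def by (rule powr_product_bound) (use e P S \<rho> in \<open>auto simp: a_def b_def\<close>)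
        then show ?thesis using C12 e by (intro mult_right_mono mult_left_mono) (auto simp: mult.assoc)
      qed
      also have "\<dots> \<le> C * e powr (- \<rho>) * ((1 - \<xi>) * y1 \<xi> * (t - \<xi>))\<^sup>2"
      proof (rule fin)
        \<comment> \<open>From \<open>d \<ge> \<xi>\<close>, as t is negative, and
          \<open>2 * d \<ge> 1 - \<xi>\<close>.\<close>
        have "1 \<le> 3 * d" using t(3) False xi unfolding d_def by (auto simp: abs_if split: if_splits)
        then have "1\<^sup>2 \<le> (3 * d)\<^sup>2" by (intro power_mono) auto
        then have "B * 1 \<le> B * (9 * d\<^sup>2)" using AB by (intro mult_left_mono) (auto simp: power_mult_distrib)
        also have "\<dots> \<le> (49 * A + 9 * B) * d\<^sup>2" using AB by (simp add: algebra_simps)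
        finally show "B * 1 \<le> (49 * A + 9 * B) * d\<^sup>2" .
      qed
      finally show ?thesis by (simp add: e_def)
    qed
  qed
  then show thesis by (rule that[OF C0])
qed

lemma jacobi_root_basis_bound:
  assumes ab: "\<alpha> > -1" "\<beta> > -1"
    and c: "0 < c" "c \<le> endpoint_scale \<alpha> \<beta>" "c \<le> endpoint_scale \<beta> \<alpha>"
    and \<rho>: "\<rho> \<ge> 0" "\<rho> \<ge> - (\<alpha> + 1/2)" "\<rho> \<ge> \<alpha> - 5/2" "\<rho> \<ge> \<beta> - 5/2" "\<rho> \<ge> \<beta> - \<alpha> - 2"
  obtains C where "C > 0" "\<And>n y y1 y2 \<xi> t. n \<ge> 1 \<Longrightarrow> jacobi_ode \<alpha> \<beta> n y y1 y2 \<Longrightarrow> y 1 \<noteq> 0 \<Longrightarrow>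
     0 \<le> \<xi> \<Longrightarrow> \<xi> < 1 \<Longrightarrow> y \<xi> = 0 \<Longrightarrow> -1 \<le> t \<Longrightarrow> t \<le> 1 \<Longrightarrow>
     ((1 - t\<^sup>2) * y t)\<^sup>2 \<le> C * (c / (jacobi_shift \<alpha> \<beta> n)\<^sup>2) powr (- \<rho>) * ((1 - \<xi>\<^sup>2) * y1 \<xi> * (t - \<xi>))\<^sup>2"
proof -
  obtain C1 where C1: "C1 > 0" "\<And>n y y1 y2 \<xi> t. n \<ge> 1 \<Longrightarrow> jacobi_ode \<alpha> \<beta> n y y1 y2 \<Longrightarrow> y 1 \<noteq> 0 \<Longrightarrow>
     0 \<le> \<xi> \<Longrightarrow> \<xi> < 1 \<Longrightarrow> y \<xi> = 0 \<Longrightarrow> \<bar>t - \<xi>\<bar> \<le> (1 - \<xi>) / 2 \<Longrightarrow>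
     ((1 - t\<^sup>2) * y t)\<^sup>2 \<le> C1 * ((1 - \<xi>) * y1 \<xi> * (t - \<xi>))\<^sup>2"
    by (rule jacobi_near_root_bound[OF ab c(1,2)]) blast
  obtain C2 where C2: "C2 > 0" "\<And>n y y1 y2 \<xi> t. n \<ge> 1 \<Longrightarrow> jacobi_ode \<alpha> \<beta> n y y1 y2 \<Longrightarrow> y 1 \<noteq> 0 \<Longrightarrow>
     0 \<le> \<xi> \<Longrightarrow> \<xi> < 1 \<Longrightarrow> y \<xi> = 0 \<Longrightarrow> -1 \<le> t \<Longrightarrow> t \<le> 1 \<Longrightarrow> \<bar>t - \<xi>\<bar> \<ge> (1 - \<xi>) / 2 \<Longrightarrow>
     ((1 - t\<^sup>2) * y t)\<^sup>2 \<le> C2 * (c / (jacobi_shift \<alpha> \<beta> n)\<^sup>2) powr (- \<rho>) * ((1 - \<xi>) * y1 \<xi> * (t - \<xi>))\<^sup>2"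
    by (rule jacobi_far_root_bound[OF ab c \<rho>]) blast
  define C where "C = C1 + C2"
  have C0: "C > 0" using C1(1) C2(1) by (simp add: C_def)
  have "((1 - t\<^sup>2) * y t)\<^sup>2 \<le> C * (c / (jacobi_shift \<alpha> \<beta> n)\<^sup>2) powr (- \<rho>) * ((1 - \<xi>\<^sup>2) * y1 \<xi> * (t - \<xi>))\<^sup>2"
    if n: "n \<ge> 1" and ode: "jacobi_ode \<alpha> \<beta> n y y1 y2" and y1n: "y 1 \<noteq> 0"
      and xi: "0 \<le> \<xi>" "\<xi> < 1" "y \<xi> = 0" and t: "-1 \<le> t" "t \<le> 1" for n y y1 y2 \<xi> t
  proof -
    define e where "e = c / (jacobi_shift \<alpha> \<beta> n)\<^sup>2"
    define E where "E = e powr (- \<rho>)"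
    define Z where "Z = ((1 - \<xi>) * y1 \<xi> * (t - \<xi>))\<^sup>2"
    have c4: "c \<le> 1/4" using c by (simp add: endpoint_scale_def)
    have e: "0 < e" "e \<le> 1" unfolding e_def using endpoint_width[OF ab n c(1) c4] by auto
    have E1: "E \<ge> 1" unfolding E_def using powr_mono'[of "- \<rho>" 0 e] e \<rho>(1) by simp
    have Z0: "Z \<ge> 0" by (simp add: Z_def)
    have "((1 - t\<^sup>2) * y t)\<^sup>2 \<le> C * E * Z"
    proof (cases "\<bar>t - \<xi>\<bar> \<le> (1 - \<xi>) / 2")
      case True
      have "((1 - t\<^sup>2) * y t)\<^sup>2 \<le> C1 * Z" unfolding Z_def by (rule C1(2)[OF n ode y1n xi True])
      also have "\<dots> \<le> (C * E) * Z"
      proof (rule mult_right_mono[OF _ Z0])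
        have "C1 * 1 \<le> C * E" using C1(1) C2(1) E1 by (intro mult_mono) (auto simp: C_def)
        then show "C1 \<le> C * E" by simp
      qed
      finally show ?thesis .
    next
      case False
      then have "((1 - t\<^sup>2) * y t)\<^sup>2 \<le> C2 * E * Z"
        unfolding Z_def E_def e_def using C2(2)[OF n ode y1n xi t] by simp
      also have "\<dots> \<le> C * E * Z"
        using C1(1) E1 Z0 by (intro mult_right_mono) (auto simp: C_def)
      finally show ?thesis .
    qed
    also have "\<dots> \<le> C * E * ((1 - \<xi>\<^sup>2) * y1 \<xi> * (t - \<xi>))\<^sup>2"
    proof (rule mult_left_mono)
      \<comment> \<open>The factor \<open>1 + \<xi> \<ge> 1\<close> is restored to match the
        denominator of the fundamental polynomial.\<close>
      have "1 - \<xi> \<le> 1 - \<xi>\<^sup>2" using one_minus_square_ge[of \<xi> "1 - \<xi>"] xi by simp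
      then have "(1 - \<xi>)\<^sup>2 \<le> (1 - \<xi>\<^sup>2)\<^sup>2" using xi by (intro power_mono) auto
      then show "Z \<le> ((1 - \<xi>\<^sup>2) * y1 \<xi> * (t - \<xi>))\<^sup>2"
        unfolding Z_def power_mult_distrib by (intro mult_right_mono) auto
    qed (use C0 E1 in auto)
    finally show ?thesis by (simp add: E_def e_def)
  qed
  then show thesis by (rule that[OF C0])
qed

section \<open>The fundamental polynomials of the Jacobi nodes\<close>

lemma lagrange_basis_of_factor:
  assumes fin: "finite X" and x: "x \<in> X" and Q: "degree Q < card X" "\<And>z. z \<in> X - {x} \<Longrightarrow> poly Q z = 0"
  shows "poly Q t = poly Q x * lagrange_basis X x t"
proof -
  have "(\<Sum>z\<in>X. poly Q z * lagrange_basis X z t) = (\<Sum>z\<in>X. if z = x then poly Q x * lagrange_basis X x t else 0)"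
    using Q(2) by (intro sum.cong) auto
  then show ?thesis
    using lagrange_error_poly[OF fin Q(1), of t] fin x by (simp add: lagrange_error_def)
qed

lemma jacobi_nodes_facts:
  assumes ab: "\<alpha> > -1" "\<beta> > -1"
  shows "finite (jacobi_nodes \<alpha> \<beta> n)" "jacobi_nodes \<alpha> \<beta> n \<subseteq> {-1..1}"
    "card (jacobi_nodes \<alpha> \<beta> n) = n + 2" "degree (jacobi_poly \<alpha> \<beta> n) = n"
    "\<And>x :: real. x \<in> jacobi_nodes \<alpha> \<beta> n \<longleftrightarrow> x = 1 \<or> x = -1 \<or> poly (jacobi_poly \<alpha> \<beta> n) x = 0"
    "poly (jacobi_poly \<alpha> \<beta> n) 1 \<noteq> 0" "poly (jacobi_poly \<alpha> \<beta> n) (-1) \<noteq> 0"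
proof -
  show c: "card (jacobi_nodes \<alpha> \<beta> n) = n + 2" by (rule card_jacobi_nodes[OF ab])
  then show "finite (jacobi_nodes \<alpha> \<beta> n)" by (metis card.infinite add_is_0 zero_neq_numeral)
  show m: "x \<in> jacobi_nodes \<alpha> \<beta> n \<longleftrightarrow> x = 1 \<or> x = -1 \<or> poly (jacobi_poly \<alpha> \<beta> n) x = 0" for x :: real
    by (auto simp: jacobi_nodes_def power2_eq_1_iff)
  show "degree (jacobi_poly \<alpha> \<beta> n) = n"
    using is_jacobi_poly_jacobi_poly[OF ab, of n] by (simp add: is_jacobi_poly_def)
  note r = jacobi_poly_roots(2)[OF ab, of n]
  have r': "-1 < x \<and> x < 1" if "poly (jacobi_poly \<alpha> \<beta> n) x = 0" for x
    using subsetD[OF r, of x] that by simp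
  show "jacobi_nodes \<alpha> \<beta> n \<subseteq> {-1..1}"
  proof
    fix x assume "x \<in> jacobi_nodes \<alpha> \<beta> n"
    then consider "x = 1" | "x = -1" | "poly (jacobi_poly \<alpha> \<beta> n) x = 0" using m by blast
    then show "x \<in> {-1..1}" using r' by cases force+
  qed
  show "poly (jacobi_poly \<alpha> \<beta> n) 1 \<noteq> 0" using r'[of 1] by linarith
  show "poly (jacobi_poly \<alpha> \<beta> n) (-1) \<noteq> 0" using r'[of "-1"] by linarith
qed

text \<open>The polynomial Q is \<open>(1 - t\<^sup>2) * P t\<close> with the factor
  \<open>t - \<xi>\<close> removed. It vanishes at all other nodes and so equals its value at \<xi>
  times the fundamental polynomial. That value is \<open>1 - \<xi>\<^sup>2\<close> times the
  derivative of P at \<xi>, and it cannot be 0, since Q would then vanish identically.\<close>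

lemma jacobi_root_factor:
  assumes ab: "\<alpha> > -1" "\<beta> > -1" and \<xi>: "poly (jacobi_poly \<alpha> \<beta> n) \<xi> = 0"
  shows "lagrange_basis (jacobi_nodes \<alpha> \<beta> n) \<xi> t * ((1 - \<xi>\<^sup>2) * poly (pderiv (jacobi_poly \<alpha> \<beta> n)) \<xi> * (t - \<xi>))
       = (1 - t\<^sup>2) * poly (jacobi_poly \<alpha> \<beta> n) t"
    and "(1 - \<xi>\<^sup>2) * poly (pderiv (jacobi_poly \<alpha> \<beta> n)) \<xi> \<noteq> 0"
proof -
  note X = jacobi_nodes_facts[OF ab, where n = n]
  define P where "P = jacobi_poly \<alpha> \<beta> n"
  have P0: "P \<noteq> 0" using X(6) by (auto simp: P_def)
  obtain R where R: "P = [:-\<xi>, 1:] * R" using \<xi> unfolding P_def by (metis poly_eq_0_iff_dvd dvdE)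
  have R0: "R \<noteq> 0" using R P0 by auto
  have "degree P = Suc (degree R)" unfolding R using R0 by (subst degree_mult_eq) auto
  then have dR: "Suc (degree R) = n" using X(4) by (simp add: P_def)
  define Q where "Q = [:1, 0, -1:] * R"
  have "degree Q \<le> n + 1" unfolding Q_def using degree_mult_le[of "[:1, 0, -1:]" R] dR by simp
  then have dQ: "degree Q < card (jacobi_nodes \<alpha> \<beta> n)" using X(3) by simp
  have pQ: "poly Q z = (1 - z\<^sup>2) * poly R z" for z by (simp add: Q_def power2_eq_square algebra_simps)
  have PR: "poly P z = (z - \<xi>) * poly R z" for z by (simp add: R algebra_simps)
  have z: "poly Q z = 0" if "z \<in> jacobi_nodes \<alpha> \<beta> n - {\<xi>}" for z
    using that X(5)[of z] PR[of z] by (auto simp: pQ P_def)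
  have \<xi>X: "\<xi> \<in> jacobi_nodes \<alpha> \<beta> n" using X(5)[of \<xi>] \<xi> by simp
  note l = lagrange_basis_of_factor[OF X(1) \<xi>X dQ z]
  have d: "poly (pderiv P) \<xi> = poly R \<xi>" unfolding R pderiv_mult by (simp add: pderiv_pCons)
  have "Q \<noteq> 0" unfolding Q_def using R0 by (simp only: mult_eq_0_iff) simp
  then obtain w where "poly Q w \<noteq> 0" by (metis poly_all_0_iff_0)
  then have "poly Q \<xi> \<noteq> 0" using l[of w] by auto
  then show "(1 - \<xi>\<^sup>2) * poly (pderiv (jacobi_poly \<alpha> \<beta> n)) \<xi> \<noteq> 0"
    unfolding P_def[symmetric] d pQ .
  define b where "b = lagrange_basis (jacobi_nodes \<alpha> \<beta> n) \<xi> t"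
  have "(1 - t\<^sup>2) * poly P t = (t - \<xi>) * poly Q t" by (simp add: PR pQ)
  also have "poly Q t = poly Q \<xi> * b" unfolding b_def by (rule l)
  also have "(t - \<xi>) * (poly Q \<xi> * b) = b * ((1 - \<xi>\<^sup>2) * poly (pderiv P) \<xi> * (t - \<xi>))"
    unfolding d pQ by (simp only: mult_ac)
  finally show "lagrange_basis (jacobi_nodes \<alpha> \<beta> n) \<xi> t * ((1 - \<xi>\<^sup>2) * poly (pderiv (jacobi_poly \<alpha> \<beta> n)) \<xi> * (t - \<xi>))
       = (1 - t\<^sup>2) * poly (jacobi_poly \<alpha> \<beta> n) t" by (simp add: P_def b_def)
qed

lemma jacobi_endpoint_factor:
  assumes ab: "\<alpha> > -1" "\<beta> > -1" and s: "s = 1 \<or> s = -1"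
  shows "lagrange_basis (jacobi_nodes \<alpha> \<beta> n) s t * (2 * poly (jacobi_poly \<alpha> \<beta> n) s)
       = (1 + s * t) * poly (jacobi_poly \<alpha> \<beta> n) t"
proof -
  note X = jacobi_nodes_facts[OF ab, where n = n]
  define Q where "Q = [:1, s:] * jacobi_poly \<alpha> \<beta> n"
  have "degree Q \<le> n + 1"
    unfolding Q_def using degree_mult_le[of "[:1, s:]" "jacobi_poly \<alpha> \<beta> n"] X(4) s by auto
  then have dQ: "degree Q < card (jacobi_nodes \<alpha> \<beta> n)" using X(3) by simp
  have pQ: "poly Q z = (1 + s * z) * poly (jacobi_poly \<alpha> \<beta> n) z" for z by (simp add: Q_def algebra_simps)
  have "poly Q t = poly Q s * lagrange_basis (jacobi_nodes \<alpha> \<beta> n) s t"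
    by (rule lagrange_basis_of_factor[OF X(1) _ dQ]) (use X(5) s in \<open>auto simp: pQ\<close>)
  moreover have "1 + s * s = 2" using s by auto
  ultimately show ?thesis unfolding pQ by simp
qed

text \<open>There are four kinds of nodes: 1, -1 and the roots on either side of 0. Those on the
  left are treated through the reflected equation, which is why the conditions on \<rho> are
  symmetric in \<alpha> and \<beta>. Squares are kept because the energy is quadratic.\<close>

lemma jacobi_basis_square_bound:
  assumes ab: "\<alpha> > -1" "\<beta> > -1"
    and c: "0 < c" "c \<le> endpoint_scale \<alpha> \<beta>" "c \<le> endpoint_scale \<beta> \<alpha>"
    and \<rho>: "\<rho> \<ge> 0" "\<rho> \<ge> - (\<alpha> + 1/2)" "\<rho> \<ge> - (\<beta> + 1/2)" "\<rho> \<ge> \<alpha> - 5/2" "\<rho> \<ge> \<beta> - 5/2"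
      "\<rho> \<ge> \<beta> - \<alpha> - 2" "\<rho> \<ge> \<alpha> - \<beta> - 2"
  obtains C where "C > 0" "\<And>n x t. n \<ge> 1 \<Longrightarrow> x \<in> jacobi_nodes \<alpha> \<beta> n \<Longrightarrow> -1 \<le> t \<Longrightarrow> t \<le> 1 \<Longrightarrow>
     (lagrange_basis (jacobi_nodes \<alpha> \<beta> n) x t)\<^sup>2 \<le> C * (c / (jacobi_shift \<alpha> \<beta> n)\<^sup>2) powr (- \<rho>)"
proof -
  have \<rho>1: "\<rho> \<ge> 0" "\<rho> \<ge> - (\<alpha> + 1/2)" "\<rho> \<ge> \<alpha> - 5/2" "\<rho> \<ge> \<beta> - 5/2" "\<rho> \<ge> \<beta> - \<alpha> - 2"
    and \<rho>2: "\<rho> \<ge> 0" "\<rho> \<ge> - (\<beta> + 1/2)" "\<rho> \<ge> \<beta> - 5/2" "\<rho> \<ge> \<alpha> - 5/2" "\<rho> \<ge> \<alpha> - \<beta> - 2"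
    using \<rho> by auto
  obtain C1 where C1: "C1 > 0" "\<And>n y y1 y2 \<xi> t. n \<ge> 1 \<Longrightarrow> jacobi_ode \<alpha> \<beta> n y y1 y2 \<Longrightarrow> y 1 \<noteq> 0 \<Longrightarrow>
     0 \<le> \<xi> \<Longrightarrow> \<xi> < 1 \<Longrightarrow> y \<xi> = 0 \<Longrightarrow> -1 \<le> t \<Longrightarrow> t \<le> 1 \<Longrightarrow>
     ((1 - t\<^sup>2) * y t)\<^sup>2 \<le> C1 * (c / (jacobi_shift \<alpha> \<beta> n)\<^sup>2) powr (- \<rho>) * ((1 - \<xi>\<^sup>2) * y1 \<xi> * (t - \<xi>))\<^sup>2"
    by (rule jacobi_root_basis_bound[OF ab c \<rho>1]) blast
  obtain C2 where C2: "C2 > 0" "\<And>n y y1 y2 \<xi> t. n \<ge> 1 \<Longrightarrow> jacobi_ode \<beta> \<alpha> n y y1 y2 \<Longrightarrow> y 1 \<noteq> 0 \<Longrightarrow>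
     0 \<le> \<xi> \<Longrightarrow> \<xi> < 1 \<Longrightarrow> y \<xi> = 0 \<Longrightarrow> -1 \<le> t \<Longrightarrow> t \<le> 1 \<Longrightarrow>
     ((1 - t\<^sup>2) * y t)\<^sup>2 \<le> C2 * (c / (jacobi_shift \<beta> \<alpha> n)\<^sup>2) powr (- \<rho>) * ((1 - \<xi>\<^sup>2) * y1 \<xi> * (t - \<xi>))\<^sup>2"
    by (rule jacobi_root_basis_bound[OF ab(2,1) c(1,3,2) \<rho>2]) blast
  obtain C3 where C3: "C3 > 0" "\<And>n y y1 y2 t. n \<ge> 1 \<Longrightarrow> jacobi_ode \<alpha> \<beta> n y y1 y2 \<Longrightarrow> -1 \<le> t \<Longrightarrow> t \<le> 1 \<Longrightarrow>
     ((1 + t) * y t)\<^sup>2 \<le> C3 * (c / (jacobi_shift \<alpha> \<beta> n)\<^sup>2) powr (- \<rho>) * (y 1)\<^sup>2"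
    by (rule jacobi_endpoint_basis_bound[OF ab c \<rho>(1,2,6)]) blast
  obtain C4 where C4: "C4 > 0" "\<And>n y y1 y2 t. n \<ge> 1 \<Longrightarrow> jacobi_ode \<beta> \<alpha> n y y1 y2 \<Longrightarrow> -1 \<le> t \<Longrightarrow> t \<le> 1 \<Longrightarrow>
     ((1 + t) * y t)\<^sup>2 \<le> C4 * (c / (jacobi_shift \<beta> \<alpha> n)\<^sup>2) powr (- \<rho>) * (y 1)\<^sup>2"
    by (rule jacobi_endpoint_basis_bound[OF ab(2,1) c(1,3,2) \<rho>(1,3,7)]) blast
  define C where "C = 1 + C1 + C2 + C3 + C4"
  have C0: "C > 0" using C1(1) C2(1) C3(1) C4(1) by (simp add: C_def)
  have "(lagrange_basis (jacobi_nodes \<alpha> \<beta> n) x t)\<^sup>2 \<le> C * (c / (jacobi_shift \<alpha> \<beta> n)\<^sup>2) powr (- \<rho>)"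
    if n: "n \<ge> 1" and x: "x \<in> jacobi_nodes \<alpha> \<beta> n" and t: "-1 \<le> t" "t \<le> 1" for n x t
  proof -
    note X = jacobi_nodes_facts[OF ab, where n = n]
    define y y1 y2 where "y = poly (jacobi_poly \<alpha> \<beta> n)" and "y1 = poly (pderiv (jacobi_poly \<alpha> \<beta> n))"
      and "y2 = poly (pderiv (pderiv (jacobi_poly \<alpha> \<beta> n)))"
    define e where "e = c / (jacobi_shift \<alpha> \<beta> n)\<^sup>2"
    define E where "E = e powr (- \<rho>)"
    define l where "l = lagrange_basis (jacobi_nodes \<alpha> \<beta> n) x t"
    have ode: "jacobi_ode \<alpha> \<beta> n y y1 y2" unfolding y_def y1_def y2_def by (rule jacobi_poly_ode[OF ab])
    note odr = jacobi_ode_reflect[OF ode]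
    have c4: "c \<le> 1/4" using c by (simp add: endpoint_scale_def)
    have e: "0 < e" "e \<le> 1" unfolding e_def using endpoint_width[OF ab n c(1) c4] by auto
    have E1: "E \<ge> 1" unfolding E_def using powr_mono'[of "- \<rho>" 0 e] e \<rho>(1) by simp
    have er: "c / (jacobi_shift \<beta> \<alpha> n)\<^sup>2 = e" unfolding e_def jacobi_shift_commute[of \<beta> \<alpha>] ..
    have fin: "l\<^sup>2 \<le> C * E" if "D \<noteq> 0" "(l * D)\<^sup>2 \<le> K * E * D\<^sup>2" "K \<le> C" for D K
    proof -
      have "l\<^sup>2 * D\<^sup>2 \<le> (K * E) * D\<^sup>2" using that(2) by (simp add: power_mult_distrib)
      then have "l\<^sup>2 \<le> K * E" using that(1) by simp
      also have "\<dots> \<le> C * E" using that(3) E1 by (intro mult_right_mono) auto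
      finally show ?thesis .
    qed
    have KC: "C1 \<le> C" "C2 \<le> C" "C3 \<le> C" "C4 \<le> C" "1 \<le> C"
      using C1(1) C2(1) C3(1) C4(1) by (auto simp: C_def)
    have "l\<^sup>2 \<le> C * E"
    proof (cases "x = 1 \<or> x = -1")
      case True
      note f = jacobi_endpoint_factor[OF ab True, of n t, folded l_def y_def]
      show ?thesis
      proof (cases "x = 1")
        case x1: True
        have "((1 + t) * y t)\<^sup>2 \<le> C3 * E * (y 1)\<^sup>2"
          using C3(2)[OF n ode t] by (simp add: E_def e_def)
        also have "\<dots> \<le> C3 * E * (2 * y 1)\<^sup>2"
          using C3(1) E1 by (intro mult_left_mono) (auto simp: power_mult_distrib)
        also have "(1 + t) * y t = l * (2 * y 1)" using f x1 by simp
        finally show ?thesis by (rule fin[rotated]) (use KC X(6) in \<open>simp_all add: y_def\<close>)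
      next
        case False
        then have x1: "x = -1" using True by simp
        have "((1 - t) * y t)\<^sup>2 \<le> C4 * E * (y (-1))\<^sup>2"
          using C4(2)[OF n odr, of "- t"] t unfolding er E_def[symmetric] by simp
        also have "\<dots> \<le> C4 * E * (2 * y (-1))\<^sup>2"
          using C4(1) E1 by (intro mult_left_mono) (auto simp: power_mult_distrib)
        also have "(1 - t) * y t = l * (2 * y (-1))" using f x1 by simp
        finally show ?thesis by (rule fin[rotated]) (use KC X(7) in \<open>simp_all add: y_def\<close>)
      qed
    next
      case False
      then have yx: "poly (jacobi_poly \<alpha> \<beta> n) x = 0" using x X(5) by auto
      have x1: "-1 < x" "x < 1" using subsetD[OF jacobi_poly_roots(2)[OF ab, of n], of x] yx by simp_all
      note f = jacobi_root_factor(1)[OF ab yx, of t, folded l_def y_def y1_def]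
        jacobi_root_factor(2)[OF ab yx, folded y1_def]
      \<comment> \<open>At the node itself the identity for l reads 0 = 0 and gives no information,
        but there l is 1.\<close>
      show ?thesis
      proof (cases "t = x")
        case True
        then have "l = 1" unfolding l_def using lagrange_basis_node[OF X(1) x x] by simp
        then show ?thesis using mult_mono[OF KC(5) E1] KC(5) by simp
      next
        case tx: False
        define D where "D = (1 - x\<^sup>2) * y1 x * (t - x)"
        have D0: "D \<noteq> 0" using f(2) tx by (simp add: D_def)
        have lD: "l * D = (1 - t\<^sup>2) * y t" using f(1) by (simp add: D_def)
        show ?thesis
        proof (cases "x \<ge> 0")
          case True
          have "((1 - t\<^sup>2) * y t)\<^sup>2 \<le> C1 * E * D\<^sup>2"
            unfolding D_def E_def e_def
            by (rule C1(2)[OF n ode _ True x1(2) _ t]) (use X(6) yx in \<open>auto simp: y_def\<close>)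
          then show ?thesis unfolding lD[symmetric] by (rule fin[OF D0 _ KC(1)])
        next
          case False
          have "((1 - (- t)\<^sup>2) * y (- (- t)))\<^sup>2
              \<le> C2 * (c / (jacobi_shift \<beta> \<alpha> n)\<^sup>2) powr (- \<rho>) * ((1 - (- x)\<^sup>2) * - y1 (- (- x)) * (- t - - x))\<^sup>2"
            by (rule C2(2)[OF n odr]) (use X(7) yx False x1 t in \<open>auto simp: y_def\<close>)
          then have "((1 - t\<^sup>2) * y t)\<^sup>2 \<le> C2 * E * D\<^sup>2"
            unfolding er E_def[symmetric] D_def by (simp add: power_mult_distrib power2_commute)
          then show ?thesis unfolding lD[symmetric] by (rule fin[OF D0 _ KC(2)])
        qed
      qed
    qed
    then show ?thesis by (simp add: l_def E_def e_def)
  qed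
  then show thesis by (rule that[OF C0])
qed

lemma jacobi_basis_bound:
  assumes ab: "\<alpha> > -1" "\<beta> > -1"
    and \<rho>: "\<rho> \<ge> 0" "\<rho> \<ge> - (\<alpha> + 1/2)" "\<rho> \<ge> - (\<beta> + 1/2)" "\<rho> \<ge> \<alpha> - 5/2" "\<rho> \<ge> \<beta> - 5/2"
      "\<rho> \<ge> \<beta> - \<alpha> - 2" "\<rho> \<ge> \<alpha> - \<beta> - 2"
  obtains C where "C > 0" "\<And>n x t. n \<ge> 1 \<Longrightarrow> x \<in> jacobi_nodes \<alpha> \<beta> n \<Longrightarrow> t \<in> {-1..1} \<Longrightarrow>
     \<bar>lagrange_basis (jacobi_nodes \<alpha> \<beta> n) x t\<bar> \<le> C * real n powr \<rho>"
proof -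
  define c where "c = min (endpoint_scale \<alpha> \<beta>) (endpoint_scale \<beta> \<alpha>)"
  have c: "0 < c" "c \<le> endpoint_scale \<alpha> \<beta>" "c \<le> endpoint_scale \<beta> \<alpha>"
    using endpoint_scale_pos ab by (auto simp: c_def)
  obtain C1 where C1: "C1 > 0" "\<And>n x t. n \<ge> 1 \<Longrightarrow> x \<in> jacobi_nodes \<alpha> \<beta> n \<Longrightarrow> -1 \<le> t \<Longrightarrow> t \<le> 1 \<Longrightarrow>
     (lagrange_basis (jacobi_nodes \<alpha> \<beta> n) x t)\<^sup>2 \<le> C1 * (c / (jacobi_shift \<alpha> \<beta> n)\<^sup>2) powr (- \<rho>)"
    by (rule jacobi_basis_square_bound[OF ab c \<rho>]) blast
  \<comment> \<open>Chosen so that \<open>N \<le> K * n\<close> for \<open>n \<ge> 1\<close>. As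
    \<rho> is nonnegative, an upper bound for N suffices.\<close>
  define K where "K = 1 + \<bar>\<alpha> + \<beta> + 1\<bar> / 2"
  define C2 where "C2 = C1 * ((K\<^sup>2 / c) powr \<rho>)"
  have K0: "K > 0" by (simp add: K_def add_pos_nonneg)
  have C20: "C2 > 0" using C1(1) c(1) K0 by (simp add: C2_def)
  have "\<bar>lagrange_basis (jacobi_nodes \<alpha> \<beta> n) x t\<bar> \<le> sqrt C2 * real n powr \<rho>"
    if n: "n \<ge> 1" and x: "x \<in> jacobi_nodes \<alpha> \<beta> n" and t: "t \<in> {-1..1}" for n x t
  proof -
    define N where "N = jacobi_shift \<alpha> \<beta> n"
    have n1: "real n \<ge> 1" using n by simp
    have N0: "N > 0" unfolding N_def using jacobi_shift_pos[OF ab n] by simp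
    have NK: "N \<le> K * real n"
    proof -
      have "(\<alpha> + \<beta> + 1) / 2 \<le> \<bar>\<alpha> + \<beta> + 1\<bar> / 2 * 1"
        unfolding mult_1_right by (intro divide_right_mono abs_ge_self) simp
      also have "\<dots> \<le> \<bar>\<alpha> + \<beta> + 1\<bar> / 2 * real n" using n1 by (intro mult_left_mono) auto
      finally show ?thesis by (simp add: N_def jacobi_shift_def K_def distrib_right)
    qed
    have "(c / N\<^sup>2) powr (- \<rho>) = (N\<^sup>2 / c) powr \<rho>"
      using c(1) N0 by (simp add: powr_minus powr_divide)
    also have "\<dots> \<le> ((K * real n)\<^sup>2 / c) powr \<rho>"
      using NK N0 c(1) \<rho>(1) by (intro powr_mono2 divide_right_mono power_mono) auto
    also have "(K * real n)\<^sup>2 / c = K\<^sup>2 / c * (real n)\<^sup>2" by (simp add: power_mult_distrib)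
    also have "(K\<^sup>2 / c * (real n)\<^sup>2) powr \<rho> = (K\<^sup>2 / c) powr \<rho> * ((real n)\<^sup>2) powr \<rho>"
      by (rule powr_mult)
    also have "((real n)\<^sup>2) powr \<rho> = (real n powr \<rho>)\<^sup>2"
      using n1 by (simp add: power2_eq_square powr_mult)
    finally have "C1 * (c / N\<^sup>2) powr (- \<rho>) \<le> C1 * ((K\<^sup>2 / c) powr \<rho> * (real n powr \<rho>)\<^sup>2)"
      using C1(1) by (intro mult_left_mono) auto
    then have "(lagrange_basis (jacobi_nodes \<alpha> \<beta> n) x t)\<^sup>2 \<le> C2 * (real n powr \<rho>)\<^sup>2"
      using C1(2)[OF n x, of t] t by (simp add: C2_def N_def mult_ac)
    then have "sqrt ((lagrange_basis (jacobi_nodes \<alpha> \<beta> n) x t)\<^sup>2) \<le> sqrt (C2 * (real n powr \<rho>)\<^sup>2)"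
      by (rule real_sqrt_le_mono)
    then show ?thesis by (simp add: real_sqrt_mult)
  qed
  moreover have "sqrt C2 > 0" using C20 by simp
  ultimately show thesis by (intro that)
qed

text \<open>In each case of the definition the expressions not listed are dominated by those listed:
  \<open>\<beta> \<le> 3/2\<close>, for instance, gives
  \<open>\<alpha> + 1/2 \<le> 2 + \<alpha> - \<beta>\<close> and makes \<open>5/2 - \<beta>\<close>
  positive. The case distinction thus disappears, and
  \<open>- rate_exponent \<alpha> \<beta>\<close> meets all conditions on \<rho> at once.\<close>

lemma rate_exponent_bounds:
  "rate_exponent \<alpha> \<beta> \<le> 0" "rate_exponent \<alpha> \<beta> \<le> \<alpha> + 1/2" "rate_exponent \<alpha> \<beta> \<le> \<beta> + 1/2"
  "rate_exponent \<alpha> \<beta> \<le> 5/2 - \<alpha>" "rate_exponent \<alpha> \<beta> \<le> 5/2 - \<beta>"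
  "rate_exponent \<alpha> \<beta> \<le> 2 + \<alpha> - \<beta>" "rate_exponent \<alpha> \<beta> \<le> 2 + \<beta> - \<alpha>"
proof -
  consider "\<alpha> \<le> 3/2" "\<beta> \<le> 3/2" | "\<alpha> \<le> 3/2" "\<beta> > 3/2" | "\<alpha> > 3/2" "\<beta> \<le> 3/2" | "\<alpha> > 3/2" "\<beta> > 3/2"
    by linarith
  then have "rate_exponent \<alpha> \<beta> \<le> 0 \<and> rate_exponent \<alpha> \<beta> \<le> \<alpha> + 1/2 \<and> rate_exponent \<alpha> \<beta> \<le> \<beta> + 1/2 \<and>
    rate_exponent \<alpha> \<beta> \<le> 5/2 - \<alpha> \<and> rate_exponent \<alpha> \<beta> \<le> 5/2 - \<beta> \<and>
    rate_exponent \<alpha> \<beta> \<le> 2 + \<alpha> - \<beta> \<and> rate_exponent \<alpha> \<beta> \<le> 2 + \<beta> - \<alpha>"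
    by cases (simp_all add: rate_exponent_def, linarith+)
  then show "rate_exponent \<alpha> \<beta> \<le> 0" "rate_exponent \<alpha> \<beta> \<le> \<alpha> + 1/2" "rate_exponent \<alpha> \<beta> \<le> \<beta> + 1/2"
    "rate_exponent \<alpha> \<beta> \<le> 5/2 - \<alpha>" "rate_exponent \<alpha> \<beta> \<le> 5/2 - \<beta>"
    "rate_exponent \<alpha> \<beta> \<le> 2 + \<alpha> - \<beta>" "rate_exponent \<alpha> \<beta> \<le> 2 + \<beta> - \<alpha>"
    by blast+
qed

text \<open>Inside the square, \<open>2 + \<alpha> < \<beta>\<close> forces
  \<open>\<alpha> < 1/2\<close>, and \<open>\<beta> < \<alpha> - 2\<close> forces
  \<open>\<alpha> > 3/2\<close>. The two removed triangles are therefore exactly the places where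
  one of the mixed expressions is negative.\<close>

lemma rate_exponent_good_params:
  assumes "(\<alpha>, \<beta>) \<in> good_params"
  shows "rate_exponent \<alpha> \<beta> = 0"
proof -
  have "-1/2 \<le> \<alpha>" "\<alpha> \<le> 5/2" "-1/2 \<le> \<beta>" "\<beta> \<le> 5/2"
    "\<not> (\<alpha> \<le> 1/2 \<and> 2 + \<alpha> < \<beta>)" "\<not> (3/2 \<le> \<alpha> \<and> \<beta> < \<alpha> - 2)"
    using assms by (auto simp: good_params_def)
  then have "0 \<le> \<alpha> + 1/2" "0 \<le> \<beta> + 1/2" "0 \<le> 5/2 - \<alpha>" "0 \<le> 5/2 - \<beta>"
    "0 \<le> 2 + \<alpha> - \<beta>" "0 \<le> 2 + \<beta> - \<alpha>" by linarith+
  then show ?thesis by (simp add: rate_exponent_def min_absorb1)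
qed

lemma interp_error_eq:
  assumes ab: "\<alpha> > -1" "\<beta> > -1"
  shows "interp_error \<alpha> \<beta> n f t = lagrange_error (jacobi_nodes \<alpha> \<beta> n) f t"
proof -
  note X = jacobi_nodes_facts[OF ab, where n = n]
  define L where "L = jacobi_interpolant \<alpha> \<beta> n f"
  have L: "degree L \<le> n + 1" "\<And>x. x \<in> jacobi_nodes \<alpha> \<beta> n \<Longrightarrow> poly L x = f x"
    using theI'[OF jacobi_interpolant_ex1[OF ab, of n f]] unfolding L_def jacobi_interpolant_def by auto
  have "poly L t = (\<Sum>x\<in>jacobi_nodes \<alpha> \<beta> n. poly L x * lagrange_basis (jacobi_nodes \<alpha> \<beta> n) x t)"
    using lagrange_error_poly[OF X(1), of L t] L(1) X(3) by (simp add: lagrange_error_def)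
  also have "\<dots> = (\<Sum>x\<in>jacobi_nodes \<alpha> \<beta> n. f x * lagrange_basis (jacobi_nodes \<alpha> \<beta> n) x t)"
    using L(2) by (intro sum.cong) auto
  finally show ?thesis by (simp add: interp_error_def lagrange_error_def L_def)
qed

theorem theorem4p5:
  fixes \<alpha> \<beta> :: real and r :: nat and f g :: "real \<Rightarrow> real"
  assumes "\<alpha> > -1" and "\<beta> > -1" and "r \<ge> 1"
    and "times_differentiable_on (r - 1) f {-1..1}"
    and "abs_continuous_on {-1..1} (nth_deriv_on {-1..1} (r - 1) f)"
    and "g absolutely_integrable_on {-1..1}"
    and "bounded_variation_on {-1..1} g"
    and "\<And>t. t \<in> {-1..1} \<Longrightarrow>
           nth_deriv_on {-1..1} (r - 1) f t = nth_deriv_on {-1..1} (r - 1) f (-1) + integral {-1..t} g"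
  shows "(\<exists>C. \<forall>n\<ge>r + 1. sup_norm (interp_error \<alpha> \<beta> n f)
             \<le> C * (real n powr - real r * real n powr - rate_exponent \<alpha> \<beta>))
       \<and> ((\<alpha>, \<beta>) \<in> good_params \<longrightarrow>
          (\<exists>C. \<forall>n\<ge>r + 1. sup_norm (interp_error \<alpha> \<beta> n f) \<le> C * real n powr - real r))"
proof -
  note ab = assms(1,2)
  define \<rho> where "\<rho> = - rate_exponent \<alpha> \<beta>"
  have \<rho>: "\<rho> \<ge> 0" "\<rho> \<ge> - (\<alpha> + 1/2)" "\<rho> \<ge> - (\<beta> + 1/2)" "\<rho> \<ge> \<alpha> - 5/2" "\<rho> \<ge> \<beta> - 5/2"
      "\<rho> \<ge> \<beta> - \<alpha> - 2" "\<rho> \<ge> \<alpha> - \<beta> - 2"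
    unfolding \<rho>_def using rate_exponent_bounds[of \<alpha> \<beta>] by linarith+
  obtain C1 where C1: "C1 > 0" "\<And>n x t. n \<ge> 1 \<Longrightarrow> x \<in> jacobi_nodes \<alpha> \<beta> n \<Longrightarrow> t \<in> {-1..1} \<Longrightarrow>
     \<bar>lagrange_basis (jacobi_nodes \<alpha> \<beta> n) x t\<bar> \<le> C1 * real n powr \<rho>"
    by (rule jacobi_basis_bound[OF ab \<rho>]) blast
  obtain C2 where C2: "C2 \<ge> 0" "\<And>X n t \<Lambda>. n \<ge> r + 1 \<Longrightarrow> finite X \<Longrightarrow> X \<subseteq> {-1..1} \<Longrightarrow> card X = n + 2 \<Longrightarrow>
    t \<in> {-1..1} \<Longrightarrow> (\<And>x. x \<in> X \<Longrightarrow> \<bar>lagrange_basis X x t\<bar> \<le> \<Lambda>) \<Longrightarrow>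
    \<bar>lagrange_error X f t\<bar> \<le> C2 * (1 / real n) ^ r * \<Lambda>"
    by (rule lagrange_error_bound[OF assms(3,4,7,8)]) blast+
  \<comment> \<open>The power with exponent -r comes from the Peano kernels and the one with
    exponent \<rho> from the fundamental polynomials; both bounds are uniform in t.\<close>
  have main: "sup_norm (interp_error \<alpha> \<beta> n f) \<le> C2 * C1 * (real n powr - real r * real n powr \<rho>)"
    if n: "n \<ge> r + 1" for n
    unfolding sup_norm_def
  proof (rule cSUP_least)
    fix t :: real assume t: "t \<in> {-1..1}"
    note X = jacobi_nodes_facts[OF ab, where n = n]
    have n1: "n \<ge> 1" using n by simp
    have "\<bar>interp_error \<alpha> \<beta> n f t\<bar> \<le> C2 * (1 / real n) ^ r * (C1 * real n powr \<rho>)"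
      unfolding interp_error_eq[OF ab] by (rule C2(2)[OF n X(1-3) t]) (rule C1(2)[OF n1 _ t])
    also have "(1 / real n) ^ r = real n powr - real r"
      using n1 by (simp add: powr_minus powr_realpow divide_inverse power_inverse)
    finally show "\<bar>interp_error \<alpha> \<beta> n f t\<bar> \<le> C2 * C1 * (real n powr - real r * real n powr \<rho>)"
      by (simp add: mult_ac)
  qed simp
  have "\<exists>C. \<forall>n\<ge>r + 1. sup_norm (interp_error \<alpha> \<beta> n f)
      \<le> C * (real n powr - real r * real n powr - rate_exponent \<alpha> \<beta>)"
    using main unfolding \<rho>_def by blast
  moreover have "\<exists>C. \<forall>n\<ge>r + 1. sup_norm (interp_error \<alpha> \<beta> n f) \<le> C * real n powr - real r"
    if "(\<alpha>, \<beta>) \<in> good_params"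
  proof (intro exI allI impI)
    fix n assume n: "n \<ge> r + 1"
    have "real n powr \<rho> = 1" using n rate_exponent_good_params[OF that] by (simp add: \<rho>_def)
    then show "sup_norm (interp_error \<alpha> \<beta> n f) \<le> C2 * C1 * real n powr - real r" using main[OF n] by simp
  qed
  ultimately show ?thesis by blast
qed

end
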